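(* Let $G(\Gamma)$ be a graph of groups over a finite simplicial graph $\Gamma$, with fundamental group $G$ and Bass--Serre tree $T$. Let $(A_\xi, H_\xi)_{\xi \in \Xi}$ be a rotation family for the action of $G$ on $T$ such that: (RF$_1$) each $H_\xi$ is an infinite cyclic subgroup of $G$ generated by an element acting hyperbolically on $T$ with axis $A_\xi$; (RF$_2$) for every $\xi\in\Xi$, the set of elements $g\in G$ such that $gA_\xi=A_\xi$ is infinite cyclic. Suppose that $(A_\xi,H_\xi)_{\xi\in\Xi}$ satisfies the geometric small cancellation condition $C''(1/6)$. Then the quotient map $G\to G/\ll H_\xi\gg$ embeds each local group of $G(\Gamma)$ (i.e. its restriction to each local group is injective).
   Context: The local groups of $G(\Gamma)$ are its vertex groups and edge groups, viewed as subgroups of $G$. $\ll H_\xi\gg$ is the normal closure in $G$ of the subgroup generated by all the $H_\xi$, $\xi\in\Xi$. Rotation family: given a group $G$ acting isometrically on a metric space $X$, a rotation family is a pairwise distinct collection $(A_\xi,H_\xi)_{\xi\in\Xi}$ where each $H_\xi$ is a subgroup of $G$ stabilising a subspace $A_\xi\subset X$ (i.e. $H_\xi A_\xi=A_\xi$), together with an action of $G$ on $\Xi$ such that $A_{g\xi}=gA_\xi$ and $H_{g\xi}=gH_\xi g^{-1}$ for all $g\in G$, $\xi\in\Xi$. Here $X=T$ is a simplicial tree with edges of length $1$. Condition $C''(\alpha)$: let $g_\xi$ be a generator of $H_\xi$ and $l(g_\xi)$ its translation length on $T$. Put $l_{\max}=\max_{\xi\neq\xi'}\mathrm{diam}(A_\xi\cap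 A_{\xi'})$ and $R_{\min}=\min_{\xi\in\Xi} l(g_\xi)$. The family satisfies $C''(\alpha)$ if $l_{\max}<\alpha R_{\min}$. *)

theory Defs
  imports
    "HOL-Algebra.Group_Action"
    "HOL-Algebra.Left_Coset"
    "HOL-Algebra.Generated_Groups"
    "HOL-Library.Extended_Nonnegative_Real"
    "Graph_Theory.Graph_Theory"
begin

section \<open>Graphs of groups\<close>

text \<open>
  Serre's conventions: a graph is a symmetric digraph, the two orientations \<open>e = (u, v)\<close> and
  \<open>prod.swap e = (v, u)\<close> of an edge carry the same edge group, and \<open>emb e\<close> is the monomorphism
  from the group of \<open>e\<close> into the group of the \<^emph>\<open>terminal\<close> vertex \<open>snd e\<close>.
\<close>

record ('v, 'g, 'h) gog =
  base :: "'v pair_pre_digraph"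
  vgrp :: "'v \<Rightarrow> 'g monoid"
  egrp :: "'v \<times> 'v \<Rightarrow> 'h monoid"
  emb :: "'v \<times> 'v \<Rightarrow> 'h \<Rightarrow> 'g"

text \<open>\<open>pair_graph\<close> is the library's notion of a finite simple undirected graph.\<close>

locale graph_of_groups =
  fixes \<G> :: "('v, 'g, 'h) gog"
  assumes finite_simplicial: "pair_graph (base \<G>)"
    and base_connected: "Digraph_Component.connected (with_proj (base \<G>))"
    and group_vgrp: "v \<in> pverts (base \<G>) \<Longrightarrow> group (vgrp \<G> v)"
    and group_egrp: "e \<in> parcs (base \<G>) \<Longrightarrow> group (egrp \<G> e)"
    and egrp_swap: "e \<in> parcs (base \<G>) \<Longrightarrow> egrp \<G> (prod.swap e) = egrp \<G> e"
    and emb_hom: "e \<in> parcs (base \<G>) \<Longrightarrow> emb \<G> e \<in> hom (egrp \<G> e) (vgrp \<G> (snd e))"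
    and emb_inj: "e \<in> parcs (base \<G>) \<Longrightarrow> inj_on (emb \<G> e) (carrier (egrp \<G> e))"

text \<open>
  The library predicate \<^const>\<open>spanning_tree\<close> only excludes \<^emph>\<open>directed\<close> cycles, so it counts the two
  orientations of an edge as a cycle, while it accepts an acyclic orientation of a triangle. In a
  simple undirected graph, the cycles of length 2 are the backtracks along an edge.
\<close>

definition undirected_spanning_tree :: "'v pair_pre_digraph \<Rightarrow> 'v pair_pre_digraph \<Rightarrow> bool" where
  "undirected_spanning_tree S \<Gamma> \<longleftrightarrow>
     spanning (with_proj S) (with_proj \<Gamma>) \<and> symmetric (with_proj S) \<and>
     Digraph_Component.connected (with_proj S) \<and>
     \<not> (\<exists>p. pre_digraph.cycle (with_proj S) p \<and> 3 \<le> length p)"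


section \<open>The fundamental group\<close>

text \<open>
  Serre's group \<open>\<pi>\<^sub>1(\<G>, S)\<close> relative to a spanning tree \<open>S\<close> of the base graph. The generators are
  the elements of the vertex groups and one stable letter for each oriented edge. This set of
  generators is closed under inverses, so the group is obtained as the monoid of words modulo the
  congruence generated by the defining relations; its elements are classes of words.
\<close>

datatype ('v, 'g) letter = Vtx 'v 'g | Arc "'v \<times> 'v"

definition letters :: "('v, 'g, 'h) gog \<Rightarrow> ('v, 'g) letter set" where
  "letters \<G> = {Vtx v x | v x. v \<in> pverts (base \<G>) \<and> x \<in> carrier (vgrp \<G> v)} \<union>
     Arc ` parcs (base \<G>)"

inductive word_eq ::
  "('v, 'g, 'h) gog \<Rightarrow> 'v pair_pre_digraph \<Rightarrow> ('v, 'g) letter list \<Rightarrow> ('v, 'g) letter list \<Rightarrow> bool"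
  for \<G> S where
  refl: "w \<in> lists (letters \<G>) \<Longrightarrow> word_eq \<G> S w w"
| sym: "word_eq \<G> S w w' \<Longrightarrow> word_eq \<G> S w' w"
| trans: "word_eq \<G> S w w' \<Longrightarrow> word_eq \<G> S w' w'' \<Longrightarrow> word_eq \<G> S w w''"
| congruence: "word_eq \<G> S w w' \<Longrightarrow> a \<in> lists (letters \<G>) \<Longrightarrow> b \<in> lists (letters \<G>) \<Longrightarrow>
    word_eq \<G> S (a @ w @ b) (a @ w' @ b)"
| vertex_one: "v \<in> pverts (base \<G>) \<Longrightarrow> word_eq \<G> S [Vtx v \<one>\<^bsub>vgrp \<G> v\<^esub>] []"
| vertex_mult: "v \<in> pverts (base \<G>) \<Longrightarrow> x \<in> carrier (vgrp \<G> v) \<Longrightarrow> y \<in> carrier (vgrp \<G> v) \<Longrightarrow>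
    word_eq \<G> S [Vtx v x, Vtx v y] [Vtx v (x \<otimes>\<^bsub>vgrp \<G> v\<^esub> y)]"
| arc_inverse: "e \<in> parcs (base \<G>) \<Longrightarrow> word_eq \<G> S [Arc e, Arc (prod.swap e)] []"
| edge_relation: "e \<in> parcs (base \<G>) \<Longrightarrow> c \<in> carrier (egrp \<G> e) \<Longrightarrow>
    word_eq \<G> S [Arc e, Vtx (snd e) (emb \<G> e c), Arc (prod.swap e)]
      [Vtx (fst e) (emb \<G> (prod.swap e) c)]"
| tree_arc: "e \<in> parcs S \<Longrightarrow> e \<in> parcs (base \<G>) \<Longrightarrow> word_eq \<G> S [Arc e] []"

definition word_class ::
  "('v, 'g, 'h) gog \<Rightarrow> 'v pair_pre_digraph \<Rightarrow> ('v, 'g) letter list \<Rightarrow> ('v, 'g) letter list set" where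
  "word_class \<G> S w = {w'. word_eq \<G> S w w'}"

definition fundamental_group ::
  "('v, 'g, 'h) gog \<Rightarrow> 'v pair_pre_digraph \<Rightarrow> ('v, 'g) letter list set monoid" where
  "fundamental_group \<G> S =
     \<lparr>carrier = word_class \<G> S ` lists (letters \<G>),
      monoid.mult = (\<lambda>X Y. \<Union>x\<in>X. \<Union>y\<in>Y. word_class \<G> S (x @ y)),
      one = word_class \<G> S []\<rparr>"

definition vertex_map ::
  "('v, 'g, 'h) gog \<Rightarrow> 'v pair_pre_digraph \<Rightarrow> 'v \<Rightarrow> 'g \<Rightarrow> ('v, 'g) letter list set" where
  "vertex_map \<G> S v x = word_class \<G> S [Vtx v x]"

definition stable_letter ::
  "('v, 'g, 'h) gog \<Rightarrow> 'v pair_pre_digraph \<Rightarrow> 'v \<times> 'v \<Rightarrow> ('v, 'g) letter list set" where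
  "stable_letter \<G> S e = word_class \<G> S [Arc e]"

text \<open>
  The edge group of \<open>e\<close> is mapped into \<open>\<pi>\<^sub>1(\<G>, S)\<close> through the group of the origin of \<open>e\<close>. Going
  through the terminal vertex instead amounts to replacing \<open>e\<close> by \<open>prod.swap e\<close>, which conjugates
  the image by the stable letter.
\<close>

definition edge_map ::
  "('v, 'g, 'h) gog \<Rightarrow> 'v pair_pre_digraph \<Rightarrow> 'v \<times> 'v \<Rightarrow> 'h \<Rightarrow> ('v, 'g) letter list set" where
  "edge_map \<G> S e c = vertex_map \<G> S (fst e) (emb \<G> (prod.swap e) c)"

abbreviation vertex_subgroup where
  "vertex_subgroup \<G> S v \<equiv> vertex_map \<G> S v ` carrier (vgrp \<G> v)"

abbreviation edge_subgroup where
  "edge_subgroup \<G> S e \<equiv> edge_map \<G> S e ` carrier (egrp \<G> e)"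


section \<open>The Bass--Serre tree\<close>

text \<open>
  With \<open>G = \<pi>\<^sub>1(\<G>, S)\<close>, the vertices are the cosets \<open>g G\<^sub>v\<close> and the oriented edges are the cosets
  \<open>g G\<^sub>e\<close>; the edge \<open>g G\<^sub>e\<close> goes from \<open>g G\<^sub>u\<close> to \<open>g t\<^sub>e G\<^sub>v\<close>, where \<open>e = (u, v)\<close> and \<open>t\<^sub>e\<close> is the
  stable letter.
\<close>

type_synonym ('v, 'g) bs_vertex = "'v \<times> ('v, 'g) letter list set set"
type_synonym ('v, 'g) bs_arc = "('v \<times> 'v) \<times> ('v, 'g) letter list set set"

definition bass_serre_tree ::
  "('v, 'g, 'h) gog \<Rightarrow> 'v pair_pre_digraph \<Rightarrow> (('v, 'g) bs_vertex, ('v, 'g) bs_arc) pre_digraph" where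
  "bass_serre_tree \<G> S = (let G = fundamental_group \<G> S in
     \<lparr>verts = {(v, C). v \<in> pverts (base \<G>) \<and> C \<in> lcosets\<^bsub>G\<^esub> (vertex_subgroup \<G> S v)},
      arcs = {(e, C). e \<in> parcs (base \<G>) \<and> C \<in> lcosets\<^bsub>G\<^esub> (edge_subgroup \<G> S e)},
      tail = (\<lambda>(e, C). (fst e, C <#>\<^bsub>G\<^esub> vertex_subgroup \<G> S (fst e))),
      head = (\<lambda>(e, C). (snd e, C <#>\<^bsub>G\<^esub> (stable_letter \<G> S e <#\<^bsub>G\<^esub> vertex_subgroup \<G> S (snd e))))\<rparr>)"

definition bs_vertex_action ::
  "('v, 'g, 'h) gog \<Rightarrow> 'v pair_pre_digraph \<Rightarrow> ('v, 'g) letter list set \<Rightarrow>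
    ('v, 'g) bs_vertex \<Rightarrow> ('v, 'g) bs_vertex" where
  "bs_vertex_action \<G> S g = (\<lambda>(v, C). (v, g <#\<^bsub>fundamental_group \<G> S\<^esub> C))"


section \<open>A simplicial tree as a metric space with edges of length 1\<close>

text \<open>
  The points of the geometric realization are given by their barycentric coordinates. The
  definition is meant for graphs without loops and multiple edges, hence in particular for trees.
\<close>

definition simplices :: "('x, 'b) pre_digraph \<Rightarrow> 'x set set" where
  "simplices T = (\<lambda>x. {x}) ` verts T \<union> (\<lambda>e. {tail T e, head T e}) ` arcs T"

definition supp :: "('x \<Rightarrow> real) \<Rightarrow> 'x set" where
  "supp p = {x. p x \<noteq> 0}"

definition realization :: "('x, 'b) pre_digraph \<Rightarrow> ('x \<Rightarrow> real) set" where
  "realization T = {p. (\<forall>x. 0 \<le> p x) \<and> supp p \<in> simplices T \<and> (\<Sum>x\<in>supp p. p x) = 1}"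

definition vertex_dist :: "('x, 'b) pre_digraph \<Rightarrow> 'x \<Rightarrow> 'x \<Rightarrow> real" where
  "vertex_dist T x y = real_of_ereal (wf_digraph.\<mu> T (\<lambda>_. 1) x y)"

text \<open>
  In a closed edge with endpoints \<open>x\<close> and \<open>y\<close>, the points \<open>p\<close> and \<open>q\<close> are at distance
  \<open>\<bar>p x - q x\<bar> = \<bar>p y - q y\<bar>\<close>, and \<open>p\<close> is at distance \<open>1 - p x\<close> from \<open>x\<close>. If \<open>p\<close> and \<open>q\<close> do not
  lie in a common closed edge, a shortest path from \<open>p\<close> to \<open>q\<close> leaves the cell of \<open>p\<close> through a
  vertex \<open>x\<close> and enters that of \<open>q\<close> through a vertex \<open>y\<close>.
\<close>

definition realization_dist :: "('x, 'b) pre_digraph \<Rightarrow> ('x \<Rightarrow> real) \<Rightarrow> ('x \<Rightarrow> real) \<Rightarrow> real" where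
  "realization_dist T p q =
     (if \<exists>s\<in>simplices T. supp p \<union> supp q \<subseteq> s
      then (\<Sum>x\<in>supp p \<union> supp q. \<bar>p x - q x\<bar>) / 2
      else Min ((\<lambda>(x, y). (1 - p x) + vertex_dist T x y + (1 - q y)) ` (supp p \<times> supp q)))"

text \<open>The affine extension of a map on vertices.\<close>

definition realization_map ::
  "('x, 'b) pre_digraph \<Rightarrow> ('x \<Rightarrow> 'x) \<Rightarrow> ('x \<Rightarrow> real) \<Rightarrow> 'x \<Rightarrow> real" where
  "realization_map T f = (\<lambda>p\<in>realization T. \<lambda>y. \<Sum>x\<in>{x \<in> supp p. f x = y}. p x)"

definition bs_space ::
  "('v, 'g, 'h) gog \<Rightarrow> 'v pair_pre_digraph \<Rightarrow> (('v, 'g) bs_vertex \<Rightarrow> real) set" where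
  "bs_space \<G> S = realization (bass_serre_tree \<G> S)"

definition bs_dist ::
  "('v, 'g, 'h) gog \<Rightarrow> 'v pair_pre_digraph \<Rightarrow>
    (('v, 'g) bs_vertex \<Rightarrow> real) \<Rightarrow> (('v, 'g) bs_vertex \<Rightarrow> real) \<Rightarrow> real" where
  "bs_dist \<G> S = realization_dist (bass_serre_tree \<G> S)"

definition bs_action ::
  "('v, 'g, 'h) gog \<Rightarrow> 'v pair_pre_digraph \<Rightarrow> ('v, 'g) letter list set \<Rightarrow>
    (('v, 'g) bs_vertex \<Rightarrow> real) \<Rightarrow> ('v, 'g) bs_vertex \<Rightarrow> real" where
  "bs_action \<G> S g = realization_map (bass_serre_tree \<G> S) (bs_vertex_action \<G> S g)"


section \<open>Isometries\<close>

text \<open>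
  For an isometry \<open>f\<close> of a simplicial tree, the points with minimal displacement form the axis
  of \<open>f\<close> if the translation length is positive, that is, if \<open>f\<close> is hyperbolic.
\<close>

definition translation_length :: "'p set \<Rightarrow> ('p \<Rightarrow> 'p \<Rightarrow> real) \<Rightarrow> ('p \<Rightarrow> 'p) \<Rightarrow> real" where
  "translation_length X d f = (INF p\<in>X. d p (f p))"

definition hyperbolic :: "'p set \<Rightarrow> ('p \<Rightarrow> 'p \<Rightarrow> real) \<Rightarrow> ('p \<Rightarrow> 'p) \<Rightarrow> bool" where
  "hyperbolic X d f \<longleftrightarrow> 0 < translation_length X d f"

definition axis :: "'p set \<Rightarrow> ('p \<Rightarrow> 'p \<Rightarrow> real) \<Rightarrow> ('p \<Rightarrow> 'p) \<Rightarrow> 'p set" where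
  "axis X d f = {p \<in> X. d p (f p) = translation_length X d f}"

definition diam :: "('p \<Rightarrow> 'p \<Rightarrow> real) \<Rightarrow> 'p set \<Rightarrow> ennreal" where
  "diam d Y = (SUP p\<in>Y. SUP q\<in>Y. ennreal (d p q))"


section \<open>Rotation families and small cancellation\<close>

definition infinite_cyclic :: "('a, 'b) monoid_scheme \<Rightarrow> 'a set \<Rightarrow> bool" where
  "infinite_cyclic G K \<longleftrightarrow> infinite K \<and> (\<exists>g\<in>carrier G. K = generate G {g})"

definition normal_closure :: "('a, 'b) monoid_scheme \<Rightarrow> 'a set \<Rightarrow> 'a set" where
  "normal_closure G Y = \<Inter>{N. N \<lhd> G \<and> Y \<subseteq> N}"

text \<open>
  \<open>G\<close> acts on the space \<open>X\<close> through \<open>act\<close> and on the index set \<open>\<Xi>\<close> through \<open>\<sigma>\<close>.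
  The isometric action on \<open>X\<close> is given data; the axioms concern the family only.
\<close>

locale rotation_family = group_action G \<Xi> \<sigma>
  for G :: "('a, 'b) monoid_scheme" (structure)
    and X :: "'p set" and act :: "'a \<Rightarrow> 'p \<Rightarrow> 'p"
    and \<Xi> :: "'i set" and \<sigma> :: "'a \<Rightarrow> 'i \<Rightarrow> 'i"
    and A :: "'i \<Rightarrow> 'p set" and H :: "'i \<Rightarrow> 'a set" +
  assumes pairwise_distinct: "inj_on (\<lambda>\<xi>. (A \<xi>, H \<xi>)) \<Xi>"
    and A_subset: "\<xi> \<in> \<Xi> \<Longrightarrow> A \<xi> \<subseteq> X"
    and H_subgroup: "\<xi> \<in> \<Xi> \<Longrightarrow> subgroup (H \<xi>) G"
    and H_stabilises: "\<xi> \<in> \<Xi> \<Longrightarrow> h \<in> H \<xi> \<Longrightarrow> act h ` A \<xi> = A \<xi>"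
    and A_equivariant: "g \<in> carrier G \<Longrightarrow> \<xi> \<in> \<Xi> \<Longrightarrow> A (\<sigma> g \<xi>) = act g ` A \<xi>"
    and H_equivariant: "g \<in> carrier G \<Longrightarrow> \<xi> \<in> \<Xi> \<Longrightarrow> H (\<sigma> g \<xi>) = g <# H \<xi> #> inv g"

text \<open>
  The maximum and minimum of the definition are written as supremum and infimum in \<open>[0, \<infinity>]\<close>:
  \<open>l\<^sub>m\<^sub>a\<^sub>x\<close> can be infinite, in which case \<open>C''(\<alpha>)\<close> fails. Here \<open>gen \<xi>\<close> is a generator of \<open>H \<xi>\<close>.
\<close>

definition l_max :: "('p \<Rightarrow> 'p \<Rightarrow> real) \<Rightarrow> 'i set \<Rightarrow> ('i \<Rightarrow> 'p set) \<Rightarrow> ennreal" where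
  "l_max d \<Xi> A = (SUP \<xi>\<in>\<Xi>. SUP \<xi>'\<in>\<Xi> - {\<xi>}. diam d (A \<xi> \<inter> A \<xi>'))"

definition R_min ::
  "'p set \<Rightarrow> ('p \<Rightarrow> 'p \<Rightarrow> real) \<Rightarrow> ('a \<Rightarrow> 'p \<Rightarrow> 'p) \<Rightarrow> 'i set \<Rightarrow> ('i \<Rightarrow> 'a) \<Rightarrow> ennreal" where
  "R_min X d act \<Xi> gen = (INF \<xi>\<in>\<Xi>. ennreal (translation_length X d (act (gen \<xi>))))"

definition small_cancellation ::
  "real \<Rightarrow> 'p set \<Rightarrow> ('p \<Rightarrow> 'p \<Rightarrow> real) \<Rightarrow> ('a \<Rightarrow> 'p \<Rightarrow> 'p) \<Rightarrow> 'i set \<Rightarrow> ('i \<Rightarrow> 'p set) \<Rightarrow>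
    ('i \<Rightarrow> 'a) \<Rightarrow> bool" where
  "small_cancellation \<alpha> X d act \<Xi> A gen \<longleftrightarrow> l_max d \<Xi> A < ennreal \<alpha> * R_min X d act \<Xi> gen"

end

theory Submission imports Defs
begin

text \<open>
  Let \<open>L\<close> bound the overlaps of distinct axes, so that all translation lengths exceed \<open>6L\<close>. Starting
  from a vertex \<open>v\<close> and the trivial group, one grows a subtree \<open>W\<close> and a group \<open>M\<close> acting on it (a
  windmill in the sense of Gromov). The next group is generated by \<open>M\<close> and the \<open>H \<xi>\<close> of all axes which
  meet \<open>W\<close>, and the next subtree is the orbit of the union of \<open>W\<close> and these axes. The invariants are that
  no nontrivial element of \<open>M\<close> fixes \<open>v\<close> and that the axes whose group is not yet in \<open>M\<close> meet \<open>W\<close> in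
  diameter at most \<open>2L\<close>. A rotation moves such an intersection at least \<open>4L\<close> away from itself, so a
  geodesic which passes through successive translates of \<open>W\<close> follows every connecting axis for more than
  \<open>2L\<close>. Hence it is not closed, and another axis can share with the new subtree at most two consecutive
  overlaps. In the limit the windmill is the whole tree, and the normal closure of the \<open>H \<xi>\<close> acts freely on the vertices.

  The Bass--Serre graph is a tree because the fundamental group acts on the sets of its edges by affine
  maps in such a way that the orbit of the base point yields, for every vertex, a set of edges that changes
  along each edge by that edge. The vertex groups embed because free actions of the vertex groups
  on a large set can be matched along the edges.
\<close>

section \<open>Convexity in discrete trees\<close>

text \<open>Two elements of a local group with the same image in the quotient differ by an element
  of the normal closure that fixes a vertex of the tree. So the theorem comes down to freeness of
  the action on vertices, together with the embedding of the local groups in the fundamental group.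

  All estimates are made for vertices and integer distances; the realization enters only when the
  hypotheses are translated. This loses nothing: the action preserves the image of a vertex in the
  base graph, so no edge is inverted and minimal displacement is attained at a vertex.

  The constant 6 is spent as follows. A rotation moves its axis by more than 6L; the axis may extend
  over 2L inside W, and at each of the two ends a projection may land up to L outside W. What is
  left exceeds 2L, which is more than any overlap of two axes, and the inequality is strict even for
  L = 0.

  The axes need not cover the tree, and the windmills could stop growing too early. Therefore the
  edges outside all axes join the family with trivial groups.\<close>

locale tree_metric =
  fixes V :: "'x set" and d :: "'x \<Rightarrow> 'x \<Rightarrow> nat"
  assumes d_zero: "\<lbrakk>x \<in> V; y \<in> V\<rbrakk> \<Longrightarrow> d x y = 0 \<longleftrightarrow> x = y"
    and d_sym: "\<lbrakk>x \<in> V; y \<in> V\<rbrakk> \<Longrightarrow> d x y = d y x"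
    and d_triangle: "\<lbrakk>x \<in> V; y \<in> V; z \<in> V\<rbrakk> \<Longrightarrow> d x z \<le> d x y + d y z"
    and median: "\<lbrakk>x \<in> V; y \<in> V; z \<in> V\<rbrakk> \<Longrightarrow>
      \<exists>m\<in>V. d x m + d m y = d x y \<and> d y m + d m z = d y z \<and> d x m + d m z = d x z"
    and tripod: "\<lbrakk>x \<in> V; y \<in> V; z \<in> V; w \<in> V; d x z + d z y = d x y\<rbrakk> \<Longrightarrow>
      d x z + d z w = d x w \<or> d w z + d z y = d w y"
begin

definition btw :: "'x \<Rightarrow> 'x \<Rightarrow> 'x \<Rightarrow> bool" where
  "btw x z y \<longleftrightarrow> d x z + d z y = d x y"

definition convex :: "'x set \<Rightarrow> bool" where
  "convex C \<longleftrightarrow> C \<subseteq> V \<and> (\<forall>x\<in>C. \<forall>y\<in>C. \<forall>z\<in>V. btw x z y \<longrightarrow> z \<in> C)"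

text \<open>The nearest-point projection to a convex set, encoded by the property that is used:
  geodesics from \<open>p\<close> into \<open>C\<close> pass through it. \<open>gate_ex\<close>
  makes the choice meaningful for nonempty convex \<open>C\<close>, and \<open>gate_eqI\<close>
  shows that it is unique.\<close>

definition gate :: "'x set \<Rightarrow> 'x \<Rightarrow> 'x" where
  "gate C p = (SOME b. b \<in> C \<and> (\<forall>c\<in>C. btw p b c))"

lemma d_self [simp]: "x \<in> V \<Longrightarrow> d x x = 0"
  using d_zero by simp

lemma btw_sym: "\<lbrakk>x \<in> V; y \<in> V; z \<in> V\<rbrakk> \<Longrightarrow> btw x z y \<longleftrightarrow> btw y z x"
  by (simp add: btw_def d_sym add.commute)

lemma btw_self [simp]: "\<lbrakk>x \<in> V; y \<in> V\<rbrakk> \<Longrightarrow> btw x x y" "\<lbrakk>x \<in> V; y \<in> V\<rbrakk> \<Longrightarrow> btw x y y"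
  by (auto simp: btw_def)

lemma btw_tripod: "\<lbrakk>x \<in> V; y \<in> V; z \<in> V; w \<in> V; btw x z y\<rbrakk> \<Longrightarrow> btw x z w \<or> btw w z y"
  unfolding btw_def using tripod by blast

text \<open>The tripod axiom at \<open>y\<close> leaves only the alternative that \<open>y\<close>
  lies between \<open>w\<close> and \<open>z\<close>, which contradicts \<open>btw y z w\<close>
  unless \<open>y = z\<close>. So geodesics that overlap in a nontrivial segment can be
  glued.\<close>

lemma btw_concat:
  assumes "x \<in> V" "y \<in> V" "z \<in> V" "w \<in> V" "btw x y z" "btw y z w" "y \<noteq> z"
  shows "btw x y w" "btw x z w" "d x w = d x y + d y z + d z w"
proof -
  have "\<not> btw w y z"
    using assms d_zero[of y z] d_sym[of w y] d_sym[of w z] unfolding btw_def by auto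
  hence 1: "btw x y w"
    using btw_tripod[of x z y w] assms by blast
  thus "btw x y w" .
  show 2: "d x w = d x y + d y z + d z w"
    using 1 assms unfolding btw_def by auto
  show "btw x z w"
    using 2 assms unfolding btw_def by auto
qed

lemma btw_trans:
  assumes "x \<in> V" "y \<in> V" "z \<in> V" "w \<in> V" "btw x z y" "btw x w z"
  shows "btw x w y" "btw w z y"
  using assms d_triangle[of x w y] d_triangle[of w z y] d_triangle[of x w z] unfolding btw_def by auto

lemma convexD: "\<lbrakk>convex C; x \<in> C; y \<in> C; z \<in> V; btw x z y\<rbrakk> \<Longrightarrow> z \<in> C"
  unfolding convex_def by blast

lemma convex_subset: "convex C \<Longrightarrow> C \<subseteq> V"
  unfolding convex_def by blast

text \<open>A point \<open>b\<close> of \<open>C\<close> closest to \<open>p\<close> works: the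
  median of \<open>p\<close>, \<open>b\<close>, \<open>c\<close> lies between \<open>b\<close> and
  \<open>c\<close>, hence in \<open>C\<close>, and is no farther from \<open>p\<close> than
  \<open>b\<close>, so it equals \<open>b\<close>.\<close>

lemma gate_ex:
  assumes C: "convex C" "C \<noteq> {}" and p: "p \<in> V"
  shows "\<exists>b. b \<in> C \<and> (\<forall>c\<in>C. btw p b c)"
proof -
  obtain b where b: "b \<in> C" "\<And>c. c \<in> C \<Longrightarrow> d p b \<le> d p c"
    using C(2) ex_has_least_nat[of "\<lambda>c. c \<in> C" _ "d p"] by blast
  have bV: "b \<in> V" using b C convex_subset by auto
  have "btw p b c" if c: "c \<in> C" for c
  proof -
    have cV: "c \<in> V" using c C convex_subset by auto
    obtain m where m: "m \<in> V" "d p m + d m b = d p b" "d b m + d m c = d b c" "d p m + d m c = d p c"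
      using median[OF p bV cV] by blast
    have "m \<in> C" using convexD[OF C(1) b(1) c m(1)] m(3) unfolding btw_def by simp
    hence "d m b = 0" using b(2)[of m] m(2) by linarith
    hence "m = b" using d_zero m(1) bV by blast
    thus ?thesis using m(4) unfolding btw_def by simp
  qed
  thus ?thesis using b by blast
qed

lemma
  assumes "convex C" "C \<noteq> {}" "p \<in> V"
  shows gate_in: "gate C p \<in> C" and gate_btw: "c \<in> C \<Longrightarrow> btw p (gate C p) c"
  using someI_ex[OF gate_ex[OF assms]] unfolding gate_def[symmetric] by blast+

lemma gate_in_V:
  assumes "convex C" "C \<noteq> {}" "p \<in> V"
  shows "gate C p \<in> V"
  using gate_in[OF assms] convex_subset[OF assms(1)] by blast

lemma gate_self:
  assumes "convex C" "p \<in> C"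
  shows "gate C p = p"
proof -
  have p: "p \<in> V" "C \<noteq> {}" using assms convex_subset by auto
  have "btw p (gate C p) p" using gate_btw[OF assms(1) p(2,1) assms(2)] .
  thus ?thesis using p gate_in_V[OF assms(1) p(2,1)] d_zero[of p "gate C p"] unfolding btw_def by simp
qed

text \<open>The segment between the two gates is nontrivial, so \<open>btw_concat\<close> applies.
  Later this forces a geodesic whose ends have distinct projections to an axis to run along that
  axis.\<close>

lemma gates_btw:
  assumes C: "convex C" "C \<noteq> {}" and p: "p \<in> V" and q: "q \<in> V" and ne: "gate C p \<noteq> gate C q"
  shows "btw p (gate C p) q" "btw p (gate C q) q"
proof -
  let ?a = "gate C p" and ?b = "gate C q"
  have V: "?a \<in> V" "?b \<in> V" using gate_in_V C p q by auto
  have 1: "btw p ?a ?b" using gate_btw[OF C p] gate_in[OF C q] by blast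
  have "btw q ?b ?a" using gate_btw[OF C q] gate_in[OF C p] by blast
  hence 2: "btw ?a ?b q" using btw_sym V q by blast
  show "btw p ?a q" "btw p ?b q" using btw_concat[OF p V q 1 2 ne] by auto
qed

lemma gate_eqI:
  assumes C: "convex C" and b: "b \<in> C" and p: "p \<in> V" and "\<And>c. c \<in> C \<Longrightarrow> btw p b c"
  shows "gate C p = b"
proof -
  have ne: "C \<noteq> {}" using b by auto
  have "btw p b (gate C p)" using assms gate_in[OF C ne p] by blast
  moreover have "btw p (gate C p) b" using gate_btw[OF C ne p b] .
  ultimately show ?thesis using b convex_subset[OF C] gate_in_V[OF C ne p] p
      d_zero[of b "gate C p"] d_sym[of b "gate C p"]
    unfolding btw_def by auto
qed

end

section \<open>Windmills\<close>

text \<open>\<open>Y \<xi>\<close> stands for the vertices of an axis, but \<open>H \<xi>\<close>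
  may be trivial, which admits single edges as members of the family. \<open>covering\<close> says
  that the members link all vertices together; it makes the union of the windmills the whole
  tree.\<close>

locale tree_rotation = tree_metric V d + group G
  for V :: "'x set" and d and G :: "('a, 'b) monoid_scheme" (structure) +
  fixes act :: "'a \<Rightarrow> 'x \<Rightarrow> 'x" and \<Xi> :: "'i set" and \<sigma> :: "'a \<Rightarrow> 'i \<Rightarrow> 'i"
    and Y :: "'i \<Rightarrow> 'x set" and H :: "'i \<Rightarrow> 'a set" and L :: nat
  assumes act_closed: "\<lbrakk>g \<in> carrier G; x \<in> V\<rbrakk> \<Longrightarrow> act g x \<in> V"
    and act_one: "x \<in> V \<Longrightarrow> act \<one> x = x"
    and act_mult: "\<lbrakk>g \<in> carrier G; h \<in> carrier G; x \<in> V\<rbrakk> \<Longrightarrow> act (g \<otimes> h) x = act g (act h x)"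
    and act_isometry: "\<lbrakk>g \<in> carrier G; x \<in> V; y \<in> V\<rbrakk> \<Longrightarrow> d (act g x) (act g y) = d x y"
    and \<sigma>_closed: "\<lbrakk>g \<in> carrier G; \<xi> \<in> \<Xi>\<rbrakk> \<Longrightarrow> \<sigma> g \<xi> \<in> \<Xi>"
    and \<sigma>_one: "\<xi> \<in> \<Xi> \<Longrightarrow> \<sigma> \<one> \<xi> = \<xi>"
    and \<sigma>_mult: "\<lbrakk>g \<in> carrier G; h \<in> carrier G; \<xi> \<in> \<Xi>\<rbrakk> \<Longrightarrow> \<sigma> (g \<otimes> h) \<xi> = \<sigma> g (\<sigma> h \<xi>)"
    and Y_convex: "\<xi> \<in> \<Xi> \<Longrightarrow> convex (Y \<xi>)"
    and Y_nonempty: "\<xi> \<in> \<Xi> \<Longrightarrow> Y \<xi> \<noteq> {}"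
    and Y_equivariant: "\<lbrakk>g \<in> carrier G; \<xi> \<in> \<Xi>\<rbrakk> \<Longrightarrow> Y (\<sigma> g \<xi>) = act g ` Y \<xi>"
    and H_subgroup: "\<xi> \<in> \<Xi> \<Longrightarrow> subgroup (H \<xi>) G"
    and H_conj: "\<lbrakk>g \<in> carrier G; \<xi> \<in> \<Xi>; h \<in> H \<xi>\<rbrakk> \<Longrightarrow> g \<otimes> h \<otimes> inv g \<in> H (\<sigma> g \<xi>)"
    and H_stabilises: "\<lbrakk>\<xi> \<in> \<Xi>; h \<in> H \<xi>; x \<in> Y \<xi>\<rbrakk> \<Longrightarrow> act h x \<in> Y \<xi>"
    and overlap: "\<lbrakk>\<xi> \<in> \<Xi>; \<eta> \<in> \<Xi>; \<xi> \<noteq> \<eta>; x \<in> Y \<xi>; x \<in> Y \<eta>; y \<in> Y \<xi>; y \<in> Y \<eta>\<rbrakk> \<Longrightarrow> d x y \<le> L"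
    and displacement: "\<lbrakk>\<xi> \<in> \<Xi>; h \<in> H \<xi>; h \<noteq> \<one>; x \<in> Y \<xi>\<rbrakk> \<Longrightarrow> 6 * L < d x (act h x)"
    and covering: "\<lbrakk>W \<subseteq> V; W \<noteq> {}; \<And>\<xi>. \<xi> \<in> \<Xi> \<Longrightarrow> Y \<xi> \<inter> W \<noteq> {} \<Longrightarrow> Y \<xi> \<subseteq> W\<rbrakk> \<Longrightarrow> W = V"
begin

lemma act_inv [simp]:
  assumes "g \<in> carrier G" "x \<in> V"
  shows "act (inv g) (act g x) = x" "act g (act (inv g) x) = x"
  using act_mult[of "inv g" g x] act_mult[of g "inv g" x] assms act_one by auto

lemma \<sigma>_inv [simp]:
  assumes "g \<in> carrier G" "\<xi> \<in> \<Xi>"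
  shows "\<sigma> (inv g) (\<sigma> g \<xi>) = \<xi>" "\<sigma> g (\<sigma> (inv g) \<xi>) = \<xi>"
  using \<sigma>_mult[of "inv g" g \<xi>] \<sigma>_mult[of g "inv g" \<xi>] assms \<sigma>_one by auto

lemma Y_V: "\<lbrakk>\<xi> \<in> \<Xi>; x \<in> Y \<xi>\<rbrakk> \<Longrightarrow> x \<in> V"
  using Y_convex convex_subset by blast

lemma H_carrier: "\<lbrakk>\<xi> \<in> \<Xi>; h \<in> H \<xi>\<rbrakk> \<Longrightarrow> h \<in> carrier G"
  using H_subgroup subgroup.mem_carrier by metis

lemma act_btw:
  "\<lbrakk>g \<in> carrier G; x \<in> V; y \<in> V; z \<in> V\<rbrakk> \<Longrightarrow> btw (act g x) (act g z) (act g y) \<longleftrightarrow> btw x z y"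
  unfolding btw_def by (simp add: act_isometry act_closed)

lemma act_Y: "\<lbrakk>g \<in> carrier G; \<xi> \<in> \<Xi>; x \<in> Y \<xi>\<rbrakk> \<Longrightarrow> act g x \<in> Y (\<sigma> g \<xi>)"
  using Y_equivariant by blast

text \<open>An element of \<open>H \<xi>\<close> preserves \<open>Y \<xi>\<close>, so it carries the
  characteristic property of the gate of \<open>q\<close> to that of \<open>act h q\<close>.\<close>

lemma gate_act:
  assumes "\<xi> \<in> \<Xi>" "h \<in> H \<xi>" "q \<in> V"
  shows "gate (Y \<xi>) (act h q) = act h (gate (Y \<xi>) q)"
proof -
  note C = Y_convex[OF assms(1)] Y_nonempty[OF assms(1)]
  note hG = H_carrier[OF assms(1,2)]
  have g: "gate (Y \<xi>) q \<in> Y \<xi>" using gate_in[OF C assms(3)] .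
  show ?thesis
  proof (rule gate_eqI[OF C(1) H_stabilises[OF assms(1,2) g] act_closed[OF hG assms(3)]])
    fix c assume c: "c \<in> Y \<xi>"
    have "inv h \<in> H \<xi>" using H_subgroup[OF assms(1)] assms(2) subgroup.m_inv_closed by metis
    hence c': "act (inv h) c \<in> Y \<xi>" using H_stabilises assms(1) c by blast
    have "btw (act h q) (act h (gate (Y \<xi>) q)) (act h (act (inv h) c))"
      using act_btw[OF hG assms(3) Y_V[OF assms(1) c'] Y_V[OF assms(1) g]]
        gate_btw[OF C assms(3) c'] by blast
    thus "btw (act h q) (act h (gate (Y \<xi>) q)) c" using act_inv(2) hG Y_V[OF assms(1) c] by simp
  qed
qed

end

text \<open>\<open>I\<close> lists the axes whose rotations are already in \<open>M\<close>. An axis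
  outside \<open>I\<close> may run along two consecutive axes inside \<open>W\<close>, hence
  \<open>2 * L\<close> rather than \<open>L\<close> in \<open>W_overlap\<close>.\<close>

locale windmill = tree_rotation V d G act \<Xi> \<sigma> Y H L
  for V :: "'x set" and d and G :: "('a, 'b) monoid_scheme" (structure)
    and act and \<Xi> :: "'i set" and \<sigma> and Y and H and L +
  fixes v :: 'x and W :: "'x set" and M :: "'a set" and I :: "'i set"
  assumes W_convex: "convex W" and v_W: "v \<in> W"
    and M_subgroup: "subgroup M G"
    and M_W: "\<lbrakk>m \<in> M; x \<in> W\<rbrakk> \<Longrightarrow> act m x \<in> W"
    and M_free: "\<lbrakk>m \<in> M; act m v = v\<rbrakk> \<Longrightarrow> m = \<one>"
    and I_subset: "I \<subseteq> \<Xi>"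
    and M_I: "\<lbrakk>m \<in> M; \<xi> \<in> I\<rbrakk> \<Longrightarrow> \<sigma> m \<xi> \<in> I"
    and Y_I: "\<xi> \<in> I \<Longrightarrow> Y \<xi> \<subseteq> W" and H_I: "\<xi> \<in> I \<Longrightarrow> H \<xi> \<subseteq> M"
    and W_overlap: "\<lbrakk>\<xi> \<in> \<Xi> - I; x \<in> Y \<xi>; x \<in> W; y \<in> Y \<xi>; y \<in> W\<rbrakk> \<Longrightarrow> d x y \<le> 2 * L"
begin

section \<open>Projections to the axes that meet the windmill\<close>

definition J where "J = {\<xi> \<in> \<Xi> - I. Y \<xi> \<inter> W \<noteq> {}}"

text \<open>The slack \<open>L\<close> is what a point on another axis needs: its projection to
  \<open>Y \<xi>\<close> may leave \<open>W\<close>, but only along an overlap of two axes. Unlike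
  membership in \<open>W\<close>, this condition propagates along words of rotations, see
  \<open>near_step\<close>.\<close>

definition near where
  "near \<xi> q \<longleftrightarrow> q \<in> V \<and> (\<exists>c\<in>Y \<xi> \<inter> W. d (gate (Y \<xi>) q) c \<le> L)"

lemma W_V: "x \<in> W \<Longrightarrow> x \<in> V"
  using W_convex convex_subset by auto

lemma J_\<Xi>: "\<xi> \<in> J \<Longrightarrow> \<xi> \<in> \<Xi>"
  unfolding J_def by auto

lemma M_carrier: "m \<in> M \<Longrightarrow> m \<in> carrier G"
  using M_subgroup subgroup.mem_carrier by metis

lemma M_inv: "m \<in> M \<Longrightarrow> inv m \<in> M"
  using M_subgroup subgroup.m_inv_closed by metis

lemma J_obtain:
  assumes "\<xi> \<in> J" obtains r where "r \<in> Y \<xi>" "r \<in> W" "r \<in> V"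
  using assms W_V unfolding J_def by auto

lemma gate_in_W:
  assumes "\<xi> \<in> J" "q \<in> W"
  shows "gate (Y \<xi>) q \<in> W" "gate (Y \<xi>) q \<in> Y \<xi>"
proof -
  note C = Y_convex[OF J_\<Xi>[OF assms(1)]] Y_nonempty[OF J_\<Xi>[OF assms(1)]]
  obtain r where r: "r \<in> Y \<xi>" "r \<in> W" "r \<in> V" using J_obtain assms by blast
  have "btw q (gate (Y \<xi>) q) r" using gate_btw[OF C W_V[OF assms(2)] r(1)] .
  thus "gate (Y \<xi>) q \<in> W"
    using convexD[OF W_convex assms(2) r(2) gate_in_V[OF C W_V[OF assms(2)]]] by blast
  show "gate (Y \<xi>) q \<in> Y \<xi>" using gate_in[OF C W_V[OF assms(2)]] .
qed

lemma near_W: "\<lbrakk>\<xi> \<in> J; q \<in> W\<rbrakk> \<Longrightarrow> near \<xi> q"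
  unfolding near_def using gate_in_W[of \<xi> q] W_V[of q] W_V[of "gate (Y \<xi>) q"] by force

text \<open>
  The last hypothesis says that a geodesic from \<open>q\<close> to \<open>W\<close> either starts in \<open>Y \<beta>\<close> or stays in \<open>Y \<beta>\<close>
  for so long that \<open>Y \<xi>\<close> cannot contain this whole part of it.
\<close>

lemma near_other_aux:
  assumes \<xi>: "\<xi> \<in> J" and \<beta>: "\<beta> \<in> J" and ne: "\<xi> \<noteq> \<beta>" and q: "q \<in> V"
    and far: "q \<in> Y \<beta> \<or> (\<forall>a\<in>Y \<beta> \<inter> W. L < d a (gate (Y \<beta>) q))"
  shows "near \<xi> q"
proof -
  note C\<xi> = Y_convex[OF J_\<Xi>[OF \<xi>]] Y_nonempty[OF J_\<Xi>[OF \<xi>]]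
  note C\<beta> = Y_convex[OF J_\<Xi>[OF \<beta>]] Y_nonempty[OF J_\<Xi>[OF \<beta>]]
  obtain r where r: "r \<in> Y \<xi>" "r \<in> W" "r \<in> V" using J_obtain \<xi> by blast
  define a where "a = gate (Y \<beta>) r"
  define b where "b = gate (Y \<beta>) q"
  define b' where "b' = gate (Y \<xi>) q"
  have a: "a \<in> W" "a \<in> Y \<beta>" "a \<in> V" unfolding a_def
    using gate_in_W[OF \<beta> r(2)] W_V by auto
  have b: "b \<in> Y \<beta>" "b \<in> V" unfolding b_def using gate_in[OF C\<beta> q] gate_in_V[OF C\<beta> q] by auto
  have b': "b' \<in> Y \<xi>" "b' \<in> V" unfolding b'_def using gate_in[OF C\<xi> q] gate_in_V[OF C\<xi> q] by auto
  have qb'r: "btw q b' r" unfolding b'_def using gate_btw[OF C\<xi> q r(1)] .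
  have qba: "btw q b a" using gate_btw[OF C\<beta> q a(2)] unfolding b_def .
  have rab: "btw r a b" using gate_btw[OF C\<beta> r(3) b(1)] unfolding a_def .
  hence bar: "btw b a r" using btw_sym r a b by blast
  have qar: "btw q a r"
  proof (cases "a = b")
    case True
    have "q \<in> Y \<beta>" using far a True d_self[OF a(3)] unfolding b_def[symmetric] by (metis Int_iff not_less_zero)
    hence "b = q" using gate_self C\<beta>(1) unfolding b_def by blast
    thus ?thesis using True q r by simp
  next
    case False
    show ?thesis using btw_concat(2)[OF q b(2) a(3) r(3) qba bar] False by blast
  qed
  \<comment> \<open>The geodesic from \<open>q\<close> to \<open>r\<close> passes through
    \<open>a\<close> and \<open>b'\<close>. If \<open>b'\<close> comes after \<open>a\<close>, it
    lies in the convex set \<open>W\<close>; otherwise \<open>a\<close> lies between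
    \<open>b'\<close> and \<open>r\<close> and so belongs to \<open>Y \<xi>\<close>.\<close>
  have "b' \<in> W \<or> btw q b' a"
    using btw_tripod[OF q r(3) b'(2) a(3) qb'r]
    using convexD[OF W_convex a(1) r(2) b'(2)] by blast
  thus ?thesis
  proof
    assume "b' \<in> W"
    thus ?thesis unfolding near_def b'_def[symmetric] using b' q by force
  next
    assume qb'a: "btw q b' a"
    have b'ar: "btw b' a r" using btw_trans(2)[OF q r(3) a(3) b'(2) qar qb'a] .
    have a\<xi>: "a \<in> Y \<xi>" using convexD[OF C\<xi>(1) b'(1) r(1) a(3) b'ar] .
    \<comment> \<open>If not, the geodesic would reach \<open>Y \<xi>\<close> before it enters
      \<open>Y \<beta>\<close> at \<open>b\<close>, and both axes would contain \<open>a\<close> and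
      \<open>b\<close>. The overlap bound contradicts \<open>far\<close> unless \<open>q\<close> is
      on \<open>Y \<beta>\<close>, and then \<open>b'\<close> is on it by convexity.\<close>
    have "b' \<in> Y \<beta>"
    proof (rule ccontr)
      assume nb: "b' \<notin> Y \<beta>"
      hence nbb: "\<not> btw b b' a" using convexD[OF C\<beta>(1) b(1) a(2) b'(2)] by blast
      hence "btw q b' b" using btw_tripod[OF q a(3) b'(2) b(2) qb'a] by blast
      hence "btw b' b a" using btw_trans(2)[OF q a(3) b(2) b'(2) qba] by blast
      hence "b \<in> Y \<xi>" using convexD[OF C\<xi>(1) b'(1) a\<xi> b(2)] by blast
      hence "d a b \<le> L" using overlap[OF J_\<Xi>[OF \<xi>] J_\<Xi>[OF \<beta>] ne] a a\<xi> b by blast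
      hence "q \<in> Y \<beta>" using far a unfolding b_def[symmetric] by (metis IntI leD)
      hence "b' \<in> Y \<beta>" using convexD[OF C\<beta>(1) _ a(2) b'(2) qb'a] by blast
      thus False using nb by blast
    qed
    hence "d b' a \<le> L" using overlap[OF J_\<Xi>[OF \<xi>] J_\<Xi>[OF \<beta>] ne] a a\<xi> b' by blast
    thus ?thesis unfolding near_def b'_def[symmetric] using a a\<xi> q by blast
  qed
qed

lemma near_Y:
  assumes "\<xi> \<in> J" "\<beta> \<in> J" "\<xi> \<noteq> \<beta>" "q \<in> Y \<beta>"
  shows "near \<xi> q"
  using near_other_aux assms Y_V J_\<Xi> by blast

text \<open>Here the factor 6 is spent. The first bound separates the projections of an unrotated
  and a rotated point; the second supplies the hypothesis of \<open>near_other_aux\<close> for the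
  next axis.\<close>

lemma near_separated:
  assumes \<xi>: "\<xi> \<in> J" and p: "near \<xi> p" and q: "near \<xi> q" and h: "h \<in> H \<xi>" "h \<noteq> \<one>"
  shows "2 * L < d (gate (Y \<xi>) p) (gate (Y \<xi>) (act h q))"
    and "a \<in> Y \<xi> \<inter> W \<Longrightarrow> L < d a (gate (Y \<xi>) (act h q))"
proof -
  note X = J_\<Xi>[OF \<xi>]
  note C = Y_convex[OF X] Y_nonempty[OF X]
  have hG: "h \<in> carrier G" using H_carrier X h by blast
  have pV: "p \<in> V" and qV: "q \<in> V" using p q unfolding near_def by auto
  obtain c where c: "c \<in> Y \<xi>" "c \<in> W" "d (gate (Y \<xi>) p) c \<le> L" using p unfolding near_def by blast
  obtain e where e: "e \<in> Y \<xi>" "e \<in> W" "d (gate (Y \<xi>) q) e \<le> L" using q unfolding near_def by blast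
  define b where "b = gate (Y \<xi>) q"
  define a0 where "a0 = gate (Y \<xi>) p"
  have b: "b \<in> V" "gate (Y \<xi>) (act h q) = act h b" unfolding b_def
    using gate_in_V[OF C qV] gate_act[OF X h(1) qV] by auto
  have a0: "a0 \<in> V" unfolding a0_def using gate_in_V[OF C pV] .
  have V: "c \<in> V" "e \<in> V" "act h b \<in> V" "act h e \<in> V" using c e W_V b act_closed hG by auto
  have he: "d (act h b) (act h e) \<le> L" using act_isometry[OF hG b(1) V(2)] e(3) unfolding b_def by simp
  \<comment> \<open>The point \<open>e\<close> of \<open>W\<close> moves by more than
    \<open>6 * L\<close>. At most \<open>2 * L\<close> is lost between \<open>a\<close> and
    \<open>e\<close>, and at most \<open>L\<close> between the images of \<open>b\<close> and
    \<open>e\<close>.\<close>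
  have key: "3 * L < d a (act h b)" if a: "a \<in> Y \<xi>" "a \<in> W" for a
  proof -
    have aV: "a \<in> V" using a W_V by blast
    have ae: "d a e \<le> 2 * L" using W_overlap[of \<xi> a e] a e \<xi> unfolding J_def by blast
    have "6 * L < d e (act h e)" using displacement[OF X h e(1)] .
    moreover have "d e (act h e) \<le> d e a + d a (act h e)" using d_triangle[OF V(2) aV V(4)] .
    moreover have "d a (act h e) \<le> d a (act h b) + d (act h b) (act h e)"
      using d_triangle[OF aV V(3) V(4)] .
    ultimately show ?thesis using ae he d_sym[OF V(2) aV] by linarith
  qed
  show "L < d a (gate (Y \<xi>) (act h q))" if "a \<in> Y \<xi> \<inter> W"
    using key[of a] that unfolding b(2) by simp
  have "d c (act h b) \<le> d c a0 + d a0 (act h b)" using d_triangle[OF V(1) a0 V(3)] .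
  thus "2 * L < d (gate (Y \<xi>) p) (gate (Y \<xi>) (act h q))"
    using key[OF c(1,2)] c(3) d_sym[OF V(1) a0] unfolding b(2) a0_def[symmetric] by linarith
qed

text \<open>The rotation carries the projection to \<open>Y \<beta>\<close> more than
  \<open>L\<close> away from \<open>W\<close>, which is the second alternative of
  \<open>near_other_aux\<close>. So nearness propagates along words in which consecutive axes
  differ.\<close>

lemma near_step:
  assumes "\<xi> \<in> J" "\<beta> \<in> J" "\<xi> \<noteq> \<beta>" "near \<beta> q" "h \<in> H \<beta>" "h \<noteq> \<one>"
  shows "near \<xi> (act h q)"
proof (rule near_other_aux[OF assms(1-3)])
  show "act h q \<in> V" using assms act_closed H_carrier J_\<Xi> unfolding near_def by blast
  show "act h q \<in> Y \<beta> \<or> (\<forall>a\<in>Y \<beta> \<inter> W. L < d a (gate (Y \<beta>) (act h q)))"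
    using near_separated(2)[OF assms(2,4,4,5,6)] by blast
qed

text \<open>
  \<open>beyond B \<mu> \<xi> q\<close>: the element \<open>q\<close> has the form \<open>h\<^sub>1 \<cdots> h\<^sub>k b\<close> with nontrivial
  \<open>h\<^sub>i \<in> H \<xi>\<^sub>i\<close>, \<open>\<xi>\<^sub>i \<noteq> \<xi>\<^sub>i\<^sub>+\<^sub>1\<close>, \<open>\<xi>\<^sub>1 = \<xi>\<close> and \<open>B \<xi>\<^sub>k b\<close>. This is used both for points
  of the tree and for elements of the group.
\<close>

inductive beyond :: "('i \<Rightarrow> 'z \<Rightarrow> bool) \<Rightarrow> ('a \<Rightarrow> 'z \<Rightarrow> 'z) \<Rightarrow> 'i \<Rightarrow> 'z \<Rightarrow> bool"
  for B \<mu> where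
  base: "\<lbrakk>B \<xi> q; \<xi> \<in> J; h \<in> H \<xi>; h \<noteq> \<one>\<rbrakk> \<Longrightarrow> beyond B \<mu> \<xi> (\<mu> h q)"
| step: "\<lbrakk>beyond B \<mu> \<beta> q; \<beta> \<noteq> \<xi>; \<xi> \<in> J; h \<in> H \<xi>; h \<noteq> \<one>\<rbrakk> \<Longrightarrow> beyond B \<mu> \<xi> (\<mu> h q)"

section \<open>The enlarged windmill and normal forms\<close>

definition M' where "M' = generate G (M \<union> (\<Union>\<xi>\<in>J. H \<xi>))"

definition U where "U = W \<union> (\<Union>\<xi>\<in>J. Y \<xi>)"

definition W' where "W' = (\<Union>g\<in>M'. act g ` U)"

definition I' where "I' = {\<sigma> g \<xi> | g \<xi>. g \<in> M' \<and> \<xi> \<in> I \<union> J}"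

lemma gens_carrier: "M \<union> (\<Union>\<xi>\<in>J. H \<xi>) \<subseteq> carrier G"
  using M_carrier H_carrier J_\<Xi> by blast

lemma M'_subgroup: "subgroup M' G"
  unfolding M'_def using generate_is_subgroup[OF gens_carrier] .

lemma M'_carrier: "g \<in> M' \<Longrightarrow> g \<in> carrier G"
  using M'_subgroup subgroup.mem_carrier by metis

lemma M'_inv: "g \<in> M' \<Longrightarrow> inv g \<in> M'"
  using M'_subgroup subgroup.m_inv_closed by metis

lemma M'_mult: "\<lbrakk>g \<in> M'; h \<in> M'\<rbrakk> \<Longrightarrow> g \<otimes> h \<in> M'"
  using M'_subgroup subgroup.m_closed by metis

lemma M_M': "M \<subseteq> M'"
  unfolding M'_def by (auto intro: generate.incl)

lemma one_M': "\<one> \<in> M'"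
  using M'_subgroup subgroup.one_closed by metis

lemma H_M': "\<xi> \<in> I \<union> J \<Longrightarrow> H \<xi> \<subseteq> M'"
  using H_I M_M' unfolding M'_def by (auto intro: generate.incl)

lemma M'_induct [consumes 1, case_names M H mult]:
  assumes "g \<in> M'"
    and "\<And>m. m \<in> M \<Longrightarrow> P m"
    and "\<And>\<xi> h. \<lbrakk>\<xi> \<in> J; h \<in> H \<xi>\<rbrakk> \<Longrightarrow> P h"
    and "\<And>g h. \<lbrakk>g \<in> M'; h \<in> M'; P g; P h\<rbrakk> \<Longrightarrow> P (g \<otimes> h)"
  shows "P g"
  using assms(1) unfolding M'_def
proof (induction rule: generate.induct)
  case one
  then show ?case using assms(2) M_subgroup subgroup.one_closed by metis
next
  case (incl h)
  then show ?case using assms(2,3) by blast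
next
  case (inv h)
  then show ?case
    using assms(2)[OF M_inv] assms(3) H_subgroup J_\<Xi> subgroup.m_inv_closed by fastforce
next
  case (eng h1 h2)
  then show ?case using assms(4) unfolding M'_def by blast
qed

lemma \<sigma>_J:
  assumes "m \<in> M" "\<xi> \<in> J"
  shows "\<sigma> m \<xi> \<in> J"
proof -
  obtain r where r: "r \<in> Y \<xi>" "r \<in> W" "r \<in> V" using J_obtain assms(2) by blast
  note mG = M_carrier[OF assms(1)]
  have "\<sigma> m \<xi> \<notin> I"
  proof
    assume "\<sigma> m \<xi> \<in> I"
    hence "\<sigma> (inv m) (\<sigma> m \<xi>) \<in> I" using M_I M_inv assms(1) by blast
    thus False using \<sigma>_inv(1)[OF mG J_\<Xi>[OF assms(2)]] assms(2) unfolding J_def by simp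
  qed
  moreover have "act m r \<in> Y (\<sigma> m \<xi>) \<inter> W"
    using act_Y[OF mG J_\<Xi>[OF assms(2)] r(1)] M_W[OF assms(1) r(2)] by blast
  ultimately show ?thesis unfolding J_def using \<sigma>_closed[OF mG J_\<Xi>[OF assms(2)]] by blast
qed

lemma beyond_J: "beyond B \<mu> \<xi> q \<Longrightarrow> \<xi> \<in> J"
  by (cases rule: beyond.cases) auto

text \<open>Normal forms by induction on generators of \<open>M'\<close>. Since \<open>M\<close>
  permutes \<open>J\<close>, its elements move through a word by conjugating the letters; an element
  of \<open>H \<xi>\<close> becomes a new first letter or merges with the existing one.
  \<open>D\<close> holds what has the empty word, and \<open>B\<close> prescribes which of these may
  follow a letter.\<close>

lemma beyond_closure:
  fixes \<mu> :: "'a \<Rightarrow> 'z \<Rightarrow> 'z"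
  assumes \<mu>_closed: "\<And>g q. \<lbrakk>g \<in> carrier G; q \<in> Z\<rbrakk> \<Longrightarrow> \<mu> g q \<in> Z"
    and \<mu>_one: "\<And>q. q \<in> Z \<Longrightarrow> \<mu> \<one> q = q"
    and \<mu>_mult: "\<And>g h q. \<lbrakk>g \<in> carrier G; h \<in> carrier G; q \<in> Z\<rbrakk> \<Longrightarrow> \<mu> (g \<otimes> h) q = \<mu> g (\<mu> h q)"
    and D_Z: "D \<subseteq> Z" and B_D: "\<And>\<xi> q. B \<xi> q \<Longrightarrow> q \<in> D"
    and H_D: "\<And>\<xi> h q. \<lbrakk>q \<in> D; \<xi> \<in> J; h \<in> H \<xi>\<rbrakk> \<Longrightarrow> B \<xi> q \<or> \<mu> h q \<in> D"
    and M_D: "\<And>m q. \<lbrakk>m \<in> M; q \<in> D\<rbrakk> \<Longrightarrow> \<mu> m q \<in> D"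
    and M_B: "\<And>m \<xi> q. \<lbrakk>m \<in> M; \<xi> \<in> J; B \<xi> q\<rbrakk> \<Longrightarrow> B (\<sigma> m \<xi>) (\<mu> m q)"
    and g: "g \<in> M'" and q: "q \<in> D \<or> (\<exists>\<xi>. beyond B \<mu> \<xi> q)"
  shows "\<mu> g q \<in> D \<or> (\<exists>\<xi>. beyond B \<mu> \<xi> (\<mu> g q))"
proof -
  have HG: "h \<in> carrier G" if "\<xi> \<in> J" "h \<in> H \<xi>" for \<xi> h using H_carrier J_\<Xi> that by blast
  have bZ: "q \<in> Z" if "beyond B \<mu> \<xi> q" for \<xi> q
    using that by induction (use \<mu>_closed HG B_D D_Z in blast)+
  have PZ: "q \<in> Z" if "q \<in> D \<or> (\<exists>\<xi>. beyond B \<mu> \<xi> q)" for q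
    using that
  proof (elim disjE exE)
    show "q \<in> Z" if "q \<in> D" using that D_Z ..
    show "q \<in> Z" if "beyond B \<mu> \<xi> q" for \<xi> using bZ[OF that] .
  qed
  have conj: "\<mu> m (\<mu> h q) = \<mu> (m \<otimes> h \<otimes> inv m) (\<mu> m q)" "m \<otimes> h \<otimes> inv m \<in> H (\<sigma> m \<xi>)"
    "m \<otimes> h \<otimes> inv m \<noteq> \<one>"
    if "m \<in> M" "\<xi> \<in> J" "h \<in> H \<xi>" "h \<noteq> \<one>" "q \<in> Z" for m h q \<xi>
  proof -
    have c: "m \<in> carrier G" "h \<in> carrier G" using M_carrier HG that by auto
    have eq: "(m \<otimes> h \<otimes> inv m) \<otimes> m = m \<otimes> h" using c by (simp add: m_assoc)
    thus "\<mu> m (\<mu> h q) = \<mu> (m \<otimes> h \<otimes> inv m) (\<mu> m q)"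
      using \<mu>_mult[of m h q] \<mu>_mult[of "m \<otimes> h \<otimes> inv m" m q] c that by simp
    show "m \<otimes> h \<otimes> inv m \<in> H (\<sigma> m \<xi>)" using H_conj c J_\<Xi> that by blast
    show "m \<otimes> h \<otimes> inv m \<noteq> \<one>"
    proof
      assume "m \<otimes> h \<otimes> inv m = \<one>"
      hence "m \<otimes> h = \<one> \<otimes> m" using eq by simp
      thus False using c that(4) by simp
    qed
  qed
  have Mb: "beyond B \<mu> (\<sigma> m \<xi>) (\<mu> m q)" if "beyond B \<mu> \<xi> q" "m \<in> M" for m \<xi> q
    using that
  proof induction
    case (base \<xi> q h)
    have "q \<in> Z" using base B_D D_Z by blast
    thus ?case using conj[OF base(5) base(2-4)] beyond.base[of B "\<sigma> m \<xi>" "\<mu> m q" "m \<otimes> h \<otimes> inv m" \<mu>]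
        M_B[OF base(5) base(2) base(1)] \<sigma>_J[OF base(5) base(2)] by simp
  next
    case (step \<beta> q \<xi> h)
    have "\<sigma> m \<beta> \<noteq> \<sigma> m \<xi>"
      using step(2) \<sigma>_inv(1) M_carrier[OF step(7)] J_\<Xi> beyond_J[OF step(1)] step(3) by metis
    thus ?case using conj[OF step(7) step(3-5) bZ[OF step(1)]] step(6)[OF step(7)]
        beyond.step[of B \<mu> "\<sigma> m \<beta>" "\<mu> m q" "\<sigma> m \<xi>" "m \<otimes> h \<otimes> inv m"] \<sigma>_J[OF step(7) step(3)]
      by simp
  qed
  \<comment> \<open>Two letters from the same \<open>H \<xi>\<close> combine into one. If their
    product is trivial, the remainder \<open>q\<close> reappears, which is in \<open>D\<close> or is
    a shorter word.\<close>
  have Hmerge: "\<mu> h (\<mu> h' q) \<in> {q} \<union> {q'. beyond B \<mu> \<xi> q'}"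
    if b: "\<And>k. \<lbrakk>k \<in> H \<xi>; k \<noteq> \<one>\<rbrakk> \<Longrightarrow> beyond B \<mu> \<xi> (\<mu> k q)" 
      and "\<xi> \<in> J" "h \<in> H \<xi>" "h' \<in> H \<xi>" "q \<in> Z" for h h' q \<xi>
  proof -
    have hh: "h \<otimes> h' \<in> H \<xi>" using that H_subgroup J_\<Xi> subgroup.m_closed by metis
    have "\<mu> h (\<mu> h' q) = \<mu> (h \<otimes> h') q" using that HG \<mu>_mult by metis
    thus ?thesis using b[OF hh] \<mu>_one[OF that(5)] by (cases "h \<otimes> h' = \<one>") auto
  qed
  show ?thesis using g q
  proof (induction arbitrary: q rule: M'_induct)
    case (M m)
    then show ?case using Mb M_D by blast
  next
    case (H \<xi> h)
    show ?case
    proof (cases "h = \<one>")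
      case True
      moreover have "q \<in> Z" using PZ[OF H(3)] .
      ultimately show ?thesis using H(3) \<mu>_one by simp
    next
      case ne: False
      show ?thesis
      proof (cases "q \<in> D")
        case True
        from H_D[OF True H(1,2)] show ?thesis
        proof
          assume "B \<xi> q"
          from beyond.base[of B, OF this H(1,2) ne] show ?thesis by (intro disjI2 exI)
        qed (rule disjI1)
      next
        case False
        then obtain \<beta> where \<beta>: "beyond B \<mu> \<beta> q" using H(3) by blast
        show ?thesis
        proof (cases "\<beta> = \<xi>")
          case False
          from beyond.step[OF \<beta> False H(1,2) ne] show ?thesis by (intro disjI2 exI)
        next
          case True
          from \<beta>[unfolded True] show ?thesis
          proof (cases rule: beyond.cases)
            case (base q0 h0)
            have q0: "q0 \<in> D" using B_D[OF base(2)] .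
            have "\<mu> h q \<in> {q0} \<union> {q'. beyond B \<mu> \<xi> q'}" unfolding base(1)
              by (rule Hmerge[OF beyond.base[of B, OF base(2) H(1)] H(1,2) base(4) subsetD[OF D_Z q0]])
            thus ?thesis using q0 by (elim UnE singletonE CollectE) (simp, intro disjI2 exI)
          next
            case (step \<gamma> q0 h0)
            have "\<mu> h q \<in> {q0} \<union> {q'. beyond B \<mu> \<xi> q'}" unfolding step(1)
              by (rule Hmerge[OF beyond.step[OF step(2,3) H(1)] H(1,2) step(5) bZ[OF step(2)]])
            thus ?thesis using step(2)
              by (elim UnE singletonE CollectE) (simp, intro disjI2 exI, assumption, intro disjI2 exI)
          qed
        qed
      qed
    qed
  next
    case (mult g h)
    have qZ: "q \<in> Z" using PZ[OF mult(5)] .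
    show ?case using mult(3)[OF mult(4)[OF mult(5)]] \<mu>_mult[of g h q] mult(1,2) M'_carrier qZ by simp
  qed
qed

text \<open>A point that is in \<open>U\<close> only because it lies on \<open>Y \<xi>\<close> is
  excluded: rotating it about \<open>\<xi>\<close> leaves it on \<open>Y \<xi>\<close>, so it must
  not count as a word with a letter from \<open>H \<xi>\<close>.\<close>

definition base_point where
  "base_point \<xi> q \<longleftrightarrow> q \<in> W \<or> (\<exists>\<beta>\<in>J. \<beta> \<noteq> \<xi> \<and> q \<in> Y \<beta>)"

lemma U_V: "U \<subseteq> V"
  unfolding U_def using W_V Y_V J_\<Xi> by blast

lemma act_Y_J: "\<lbrakk>m \<in> M; \<xi> \<in> J; q \<in> Y \<xi>\<rbrakk> \<Longrightarrow> act m q \<in> Y (\<sigma> m \<xi>)"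
  by (rule act_Y[OF M_carrier J_\<Xi>])

lemma M_U:
  assumes m: "m \<in> M" and q: "q \<in> U"
  shows "act m q \<in> U"
  using q unfolding U_def
proof (elim UnE UN_E)
  show "act m q \<in> W \<union> (\<Union>\<xi>\<in>J. Y \<xi>)" if "q \<in> W" using M_W[OF m that] by simp
  show "act m q \<in> W \<union> (\<Union>\<xi>\<in>J. Y \<xi>)" if "\<xi> \<in> J" "q \<in> Y \<xi>" for \<xi>
    using \<sigma>_J[OF m that(1)] act_Y_J[OF m that] by blast
qed

lemma W'_cases:
  assumes "q \<in> W'"
  shows "q \<in> U \<or> (\<exists>\<xi>. beyond base_point act \<xi> q)"
proof -
  obtain g u where g: "g \<in> M'" "u \<in> U" "q = act g u" using assms unfolding W'_def by blast
  have "act g u \<in> U \<or> (\<exists>\<xi>. beyond base_point act \<xi> (act g u))"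
  proof (rule beyond_closure[where Z = V and B = base_point and \<mu> = act and D = U])
    show "q \<in> U" if "base_point \<xi> q" for \<xi> q
      using that unfolding base_point_def U_def by blast
    show "base_point \<xi> q \<or> act h q \<in> U" if "q \<in> U" "\<xi> \<in> J" "h \<in> H \<xi>" for \<xi> h q
    proof (cases "q \<in> Y \<xi>")
      case True
      thus ?thesis using that(2) H_stabilises[OF J_\<Xi>[OF that(2)] that(3)] unfolding U_def by auto
    next
      case False
      hence "base_point \<xi> q" using that(1) unfolding base_point_def U_def by auto
      thus ?thesis ..
    qed
    show "base_point (\<sigma> m \<xi>) (act m q)" if m: "m \<in> M" "\<xi> \<in> J" "base_point \<xi> q" for m \<xi> q
    proof -
      have "\<sigma> m \<beta> \<noteq> \<sigma> m \<xi>" if "\<beta> \<in> J" "\<beta> \<noteq> \<xi>" for \<beta>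
        using that m \<sigma>_inv(1) M_carrier J_\<Xi> by metis
      hence "\<exists>\<beta>'\<in>J. \<beta>' \<noteq> \<sigma> m \<xi> \<and> act m q \<in> Y \<beta>'" if "\<beta> \<in> J" "\<beta> \<noteq> \<xi>" "q \<in> Y \<beta>" for \<beta>
        using that \<sigma>_J[OF m(1) that(1)] act_Y_J[OF m(1) that(1,3)] by blast
      thus ?thesis using m(3) M_W[OF m(1)] unfolding base_point_def by blast
    qed
    show "u \<in> U \<or> (\<exists>\<xi>. beyond base_point act \<xi> u)" using g(2) ..
  qed (fact act_closed act_one act_mult U_V M_U g)+
  thus ?thesis using g by simp
qed

text \<open>Only the first letter is exposed; what follows it is near its axis by
  \<open>near_step\<close>, applied letter by letter. This makes \<open>near_separated\<close>
  available for words of any length.\<close>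

lemma beyond_near:
  assumes "beyond base_point act \<xi> q"
  shows "\<exists>h\<in>H \<xi>. \<exists>q'. h \<noteq> \<one> \<and> q = act h q' \<and> near \<xi> q'"
  using assms
proof induction
  case (base \<xi> q h)
  then show ?case using near_W near_Y unfolding base_point_def by blast
next
  case (step \<beta> q \<xi> h)
  obtain k q' where "k \<in> H \<beta>" "k \<noteq> \<one>" "q = act k q'" "near \<beta> q'" using step(6) by blast
  thus ?case using near_step[OF step(3) beyond_J[OF step(1)] step(2)[symmetric]] step by blast
qed

text \<open>A normal form in the group lies in \<open>M\<close>, where freeness is known, or has a
  first letter. In the second case the word applied to \<open>v\<close> projects to the first axis
  more than \<open>2 * L\<close> away from the projection of \<open>v\<close>, so \<open>v\<close>
  is moved.\<close>

lemma M'_free: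
  assumes "g \<in> M'" "act g v = v"
  shows "g = \<one>"
proof -
  \<comment> \<open>Any element of \<open>M\<close> may follow the last letter, so this instance
    ignores the axis.\<close>
  let ?B = "\<lambda>_ m. m \<in> M"
  have "g \<otimes> \<one> \<in> M \<or> (\<exists>\<xi>. beyond ?B (\<otimes>) \<xi> (g \<otimes> \<one>))"
  proof (rule beyond_closure[where Z = "carrier G" and B = ?B and \<mu> = "(\<otimes>)" and D = M])
    show "\<one> \<in> M \<or> (\<exists>\<xi>. beyond (\<lambda>_ m. m \<in> M) (\<otimes>) \<xi> \<one>)"
      using M_subgroup subgroup.one_closed by metis
    show "m \<otimes> q \<in> M" if "m \<in> M" "q \<in> M" for m q using that M_subgroup subgroup.m_closed by metis
    thus "m \<otimes> q \<in> M" if "m \<in> M" "q \<in> M" for m q using that .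
    show "g \<otimes> h \<otimes> q = g \<otimes> (h \<otimes> q)" if "g \<in> carrier G" "h \<in> carrier G" "q \<in> carrier G" for g h q
      using that by (rule m_assoc)
    show "M \<subseteq> carrier G" using M_carrier by blast
  qed (use assms in simp_all)
  hence "g \<in> M \<or> (\<exists>\<xi>. beyond ?B (\<otimes>) \<xi> g)" using assms M'_carrier by simp
  moreover have False if b: "beyond ?B (\<otimes>) \<xi> g" for \<xi>
  proof -
    have gb: "beyond base_point act \<xi> (act k v) \<and> k \<in> carrier G" if "beyond ?B (\<otimes>) \<xi> k" for k \<xi>
      using that
    proof induction
      case (base \<xi> m h)
      have "base_point \<xi> (act m v)" using base M_W v_W unfolding base_point_def by blast
      moreover have "h \<in> carrier G" "m \<in> carrier G"
        using base H_carrier J_\<Xi> M_carrier by auto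
      ultimately show ?case
        using beyond.base[of base_point \<xi> "act m v" h act] act_mult W_V[OF v_W] base by simp
    next
      case (step \<beta> q \<xi> h)
      moreover have "h \<in> carrier G" using step H_carrier J_\<Xi> by blast
      ultimately show ?case
        using beyond.step[of base_point act \<beta> "act q v" \<xi> h] act_mult W_V[OF v_W] by simp
    qed
    have \<xi>: "\<xi> \<in> J" using beyond_J[OF b] .
    obtain h q where h: "h \<in> H \<xi>" "h \<noteq> \<one>" "v = act h q" "near \<xi> q"
      using beyond_near gb[OF b] assms(2) by fastforce
    have "2 * L < d (gate (Y \<xi>) v) (gate (Y \<xi>) v)"
      using near_separated(1)[OF \<xi> near_W[OF \<xi> v_W] h(4,1,2)] h(3) by simp
    thus False using gate_in_V[OF Y_convex[OF J_\<Xi>[OF \<xi>]] Y_nonempty[OF J_\<Xi>[OF \<xi>]] W_V[OF v_W]] by simp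
  qed
  ultimately show ?thesis using M_free assms(2) by blast
qed

lemma U_W': "U \<subseteq> W'"
proof
  fix u assume u: "u \<in> U"
  have "act \<one> u = u" using act_one u U_V by blast
  thus "u \<in> W'" unfolding W'_def using u one_M' by (metis UN_I imageI)
qed

lemma W_U: "W \<subseteq> U" and Y_U: "\<xi> \<in> J \<Longrightarrow> Y \<xi> \<subseteq> U"
  unfolding U_def by auto

lemma W'_V: "W' \<subseteq> V"
  unfolding W'_def using act_closed M'_carrier U_V by blast

lemma M'_W':
  assumes "g \<in> M'" "x \<in> W'"
  shows "act g x \<in> W'"
proof -
  obtain k u where k: "k \<in> M'" "u \<in> U" "x = act k u" using assms unfolding W'_def by blast
  have "act g x = act (g \<otimes> k) u" using act_mult k M'_carrier assms U_V by auto
  thus ?thesis unfolding W'_def using M'_mult[OF assms(1) k(1)] k(2) by blast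
qed

section \<open>Convexity of the enlarged tree\<close>

text \<open>Convexity of \<open>W'\<close> in a form that can be checked on generators: on
  \<open>V\<close> it is symmetric, transitive and preserved by \<open>M'\<close>.\<close>

definition joined where "joined x y \<longleftrightarrow> (\<forall>z\<in>V. btw x z y \<longrightarrow> z \<in> W')"

lemma joined_sym: "\<lbrakk>joined x y; x \<in> V; y \<in> V\<rbrakk> \<Longrightarrow> joined y x"
  unfolding joined_def using btw_sym by blast

lemma joined_trans: "\<lbrakk>joined x y; joined y w; x \<in> V; y \<in> V; w \<in> V\<rbrakk> \<Longrightarrow> joined x w"
  unfolding joined_def using btw_tripod by blast

lemma joined_convex: "\<lbrakk>convex C; C \<subseteq> W'; x \<in> C; y \<in> C\<rbrakk> \<Longrightarrow> joined x y"
  unfolding joined_def using convexD by blast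

lemma joined_act:
  assumes "joined x y" "g \<in> M'" "x \<in> V" "y \<in> V"
  shows "joined (act g x) (act g y)"
  unfolding joined_def
proof (intro ballI impI)
  note gG = M'_carrier[OF assms(2)]
  fix z assume z: "z \<in> V" "btw (act g x) z (act g y)"
  have z': "act (inv g) z \<in> V" using act_closed gG z by blast
  have "btw x (act (inv g) z) y"
    using act_btw[OF gG assms(3,4) z'] z act_inv(2)[OF gG z(1)] by simp
  hence "act (inv g) z \<in> W'" using assms(1) z' unfolding joined_def by blast
  hence "act g (act (inv g) z) \<in> W'" using M'_W' assms(2) by blast
  thus "z \<in> W'" using act_inv(2)[OF gG z(1)] by simp
qed

text \<open>It suffices to join every point to \<open>v\<close>. For a rotation \<open>h\<close>
  about \<open>\<xi>\<close> in \<open>J\<close> the chain is \<open>v\<close>, \<open>r\<close>,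
  \<open>act h r\<close>, \<open>act h v\<close> with \<open>r\<close> on both
  \<open>Y \<xi>\<close> and \<open>W\<close>: the middle link runs along the axis, and the last one
  is a translate of a link inside \<open>W\<close>.\<close>

lemma W'_convex: "convex W'"
proof -
  have vV: "v \<in> V" using W_V v_W by blast
  have W: "joined x y" if "x \<in> W" "y \<in> W" for x y
    using joined_convex[OF W_convex _ that] W_U U_W' by blast
  have Y: "joined x y" if "\<xi> \<in> J" "x \<in> Y \<xi>" "y \<in> Y \<xi>" for x y \<xi>
    using joined_convex[OF Y_convex[OF J_\<Xi>[OF that(1)]] _ that(2,3)] Y_U[OF that(1)] U_W' by blast
  have U: "joined v u" if "u \<in> U" for u
  proof (cases "u \<in> W")
    case True
    thus ?thesis using W v_W by blast
  next
    case False
    then obtain \<xi> where \<xi>: "\<xi> \<in> J" "u \<in> Y \<xi>" using \<open>u \<in> U\<close> unfolding U_def by blast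
    obtain r where r: "r \<in> Y \<xi>" "r \<in> W" "r \<in> V" using J_obtain \<xi>(1) by blast
    show ?thesis using joined_trans[OF W[OF v_W r(2)] Y[OF \<xi>(1) r(1) \<xi>(2)] vV r(3)] U_V that by blast
  qed
  have G: "joined v (act g v)" if "g \<in> M'" for g
    using that
  proof (induction rule: M'_induct)
    case (M m)
    then show ?case using W v_W M_W by blast
  next
    case (H \<xi> h)
    obtain r where r: "r \<in> Y \<xi>" "r \<in> W" "r \<in> V" using J_obtain H(1) by blast
    have h: "h \<in> M'" using H H_M' by blast
    have V: "act h r \<in> V" "act h v \<in> V" using act_closed M'_carrier[OF h] r vV by auto
    have 1: "joined r (act h r)" using Y[OF H(1) r(1) H_stabilises[OF J_\<Xi>[OF H(1)] H(2) r(1)]] .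
    have 2: "joined (act h r) (act h v)" using joined_act[OF W[OF r(2) v_W] h r(3) vV] .
    show ?case using joined_trans[OF W[OF v_W r(2)] joined_trans[OF 1 2 r(3) V] vV r(3) V(2)] .
  next
    case (mult g h)
    have G: "g \<in> carrier G" "h \<in> carrier G" using mult M'_carrier by auto
    have "joined (act g v) (act g (act h v))" using joined_act[OF mult(4,1) vV] act_closed G vV by blast
    thus ?case using joined_trans[OF mult(3) _ vV] act_closed G vV act_mult by simp
  qed
  have vW': "joined v x" if "x \<in> W'" for x
  proof -
    obtain g u where g: "g \<in> M'" "u \<in> U" "x = act g u" using \<open>x \<in> W'\<close> unfolding W'_def by blast
    have V: "u \<in> V" "act g v \<in> V" "act g u \<in> V" using g U_V act_closed M'_carrier vV by auto
    show ?thesis using joined_trans[OF G[OF g(1)] joined_act[OF U[OF g(2)] g(1) vV V(1)] vV V(2,3)] g(3) by simp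
  qed
  have "joined x y" if "x \<in> W'" "y \<in> W'" for x y
  proof -
    have V: "x \<in> V" "y \<in> V" using that W'_V by auto
    show ?thesis using joined_trans[OF joined_sym[OF vW'[OF that(1)] vV V(1)] vW'[OF that(2)] V(1) vV V(2)] .
  qed
  thus ?thesis unfolding convex_def joined_def using W'_V by blast
qed

section \<open>Overlaps of the remaining axes with the enlarged tree\<close>

lemma not_I'_act:
  assumes "g \<in> M'" "\<eta> \<in> \<Xi> - I'"
  shows "\<sigma> g \<eta> \<in> \<Xi> - I'"
proof -
  note gG = M'_carrier[OF assms(1)]
  have "\<sigma> g \<eta> \<notin> I'"
  proof
    assume "\<sigma> g \<eta> \<in> I'"
    then obtain k \<xi> where k: "k \<in> M'" "\<xi> \<in> I \<union> J" "\<sigma> g \<eta> = \<sigma> k \<xi>" unfolding I'_def by blast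
    have "\<xi> \<in> \<Xi>" using k(2) I_subset J_\<Xi> by blast
    hence "\<sigma> (inv g \<otimes> k) \<xi> = \<sigma> (inv g) (\<sigma> g \<eta>)" using \<sigma>_mult[of "inv g" k \<xi>] k gG M'_carrier by simp
    also have "\<dots> = \<eta>" using \<sigma>_inv gG assms(2) by blast
    finally have "\<eta> \<in> I'" unfolding I'_def using M'_mult[OF M'_inv[OF assms(1)] k(1)] k(2) by blast
    thus False using assms(2) by blast
  qed
  thus ?thesis using \<sigma>_closed gG assms(2) by blast
qed

lemma subset_I': "I \<union> J \<subseteq> I'"
proof
  fix \<xi> assume x: "\<xi> \<in> I \<union> J"
  hence "\<sigma> \<one> \<xi> = \<xi>" using \<sigma>_one I_subset J_\<Xi> by blast
  thus "\<xi> \<in> I'" unfolding I'_def using x one_M' by force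
qed

lemma not_I'_W: "\<lbrakk>\<eta> \<in> \<Xi> - I'; x \<in> Y \<eta>\<rbrakk> \<Longrightarrow> x \<notin> W"
  using subset_I' unfolding J_def by blast

text \<open>The axis \<open>\<eta>\<close> misses \<open>W\<close>, and it contains the projection
  \<open>s\<close> of \<open>q\<close> to \<open>Y \<alpha>\<close>. As \<open>W\<close> contains
  the geodesic between \<open>r\<close> and \<open>t\<close>, the point \<open>s\<close> must also
  lie on \<open>Y \<beta>\<close>. So the overlap splits at \<open>s\<close> into a part on
  \<open>\<alpha>\<close> and a part on \<open>\<beta>\<close>, each of length at most
  \<open>L\<close>.\<close>

lemma overlap_U:
  assumes \<eta>: "\<eta> \<in> \<Xi> - I'" and \<alpha>: "\<alpha> \<in> J" "p \<in> Y \<alpha>" and \<beta>: "\<beta> \<in> J" "q \<in> Y \<beta>"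
    and pq: "p \<in> Y \<eta>" "q \<in> Y \<eta>"
  shows "d p q \<le> 2 * L"
proof -
  have \<Xi>: "\<alpha> \<in> \<Xi>" "\<beta> \<in> \<Xi>" "\<eta> \<in> \<Xi>" and ne: "\<eta> \<noteq> \<alpha>" "\<eta> \<noteq> \<beta>"
    using \<eta> \<alpha> \<beta> J_\<Xi> subset_I' by auto
  have V: "p \<in> V" "q \<in> V" using Y_V \<Xi> pq by auto
  obtain r where r: "r \<in> Y \<alpha>" "r \<in> W" "r \<in> V" using J_obtain \<alpha>(1) by blast
  obtain t where t: "t \<in> Y \<beta>" "t \<in> W" "t \<in> V" using J_obtain \<beta>(1) by blast
  define s where "s = gate (Y \<alpha>) q"
  note C = Y_convex[OF \<Xi>(1)] Y_nonempty[OF \<Xi>(1)]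
  have s: "s \<in> Y \<alpha>" "s \<in> V" unfolding s_def using gate_in[OF C V(2)] gate_in_V[OF C V(2)] by auto
  have "btw q s p" "btw q s r" unfolding s_def using gate_btw[OF C V(2)] \<alpha> r by auto
  have s\<eta>: "s \<in> Y \<eta>" using convexD[OF Y_convex[OF \<Xi>(3)] pq(2,1) s(2) \<open>btw q s p\<close>] .
  hence "s \<notin> W" using not_I'_W \<eta> by blast
  hence "\<not> btw t s r" using convexD[OF W_convex t(2) r(2) s(2)] by blast
  hence "btw q s t" using btw_tripod[OF V(2) r(3) s(2) t(3) \<open>btw q s r\<close>] by blast
  hence s\<beta>: "s \<in> Y \<beta>" using convexD[OF Y_convex[OF \<Xi>(2)] \<beta>(2) t(1) s(2)] by blast
  have "d s p \<le> L" using overlap[OF \<Xi>(3,1) ne(1) s\<eta> s(1) pq(1) \<alpha>(2)] .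
  moreover have "d q s \<le> L" using overlap[OF \<Xi>(3,2) ne(2) pq(2) \<beta>(2) s\<eta> s\<beta>] .
  ultimately show ?thesis using \<open>btw q s p\<close> d_sym[OF V] unfolding btw_def by simp
qed

text \<open>The geodesic from \<open>p\<close> to \<open>q\<close> would follow
  \<open>Y \<xi>\<close> between two projections more than \<open>2 * L\<close> apart, and
  \<open>\<eta>\<close> would share this stretch with \<open>\<xi>\<close>, against the bound
  \<open>L\<close>.\<close>

lemma overlap_beyond:
  assumes \<eta>: "\<eta> \<in> \<Xi> - I'" and \<alpha>: "\<alpha> \<in> J" "p \<in> Y \<alpha>" and q: "beyond base_point act \<xi> q"
    and ne: "\<xi> \<noteq> \<alpha>" and pq: "p \<in> Y \<eta>" "q \<in> Y \<eta>"
  shows False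
proof -
  have \<xi>: "\<xi> \<in> J" using beyond_J[OF q] .
  have \<Xi>: "\<xi> \<in> \<Xi>" "\<eta> \<in> \<Xi>" "\<eta> \<noteq> \<xi>" using \<xi> J_\<Xi> subset_I' \<eta> by auto
  have V: "p \<in> V" "q \<in> V" using Y_V \<Xi> pq by auto
  note C = Y_convex[OF \<Xi>(1)] Y_nonempty[OF \<Xi>(1)]
  let ?a = "gate (Y \<xi>) p" and ?b = "gate (Y \<xi>) q"
  obtain h q' where h: "h \<in> H \<xi>" "h \<noteq> \<one>" "q = act h q'" "near \<xi> q'" using beyond_near[OF q] by blast
  have lt: "2 * L < d ?a ?b" using near_separated(1)[OF \<xi> near_Y[OF \<xi> \<alpha>(1) ne \<alpha>(2)] h(4,1,2)] h(3) by simp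
  have ab: "?a \<in> V" "?b \<in> V" "?a \<in> Y \<xi>" "?b \<in> Y \<xi>" using gate_in[OF C] gate_in_V[OF C] V by auto
  have "?a \<noteq> ?b" using lt ab by auto
  hence "btw p ?a q" "btw p ?b q" using gates_btw[OF C V] by auto
  hence "?a \<in> Y \<eta>" "?b \<in> Y \<eta>" using convexD[OF Y_convex[OF \<Xi>(2)] pq] ab by auto
  hence "d ?a ?b \<le> L" using overlap[OF \<Xi>(2,1,3)] ab by blast
  thus False using lt by simp
qed

text \<open>An element of \<open>M'\<close> brings \<open>p\<close> into \<open>U\<close>, and there
  onto an axis \<open>\<alpha>\<close> of \<open>J\<close> because the translated axis misses
  \<open>W\<close>. Unless the word of the other point starts with \<open>\<alpha>\<close>,
  \<open>overlap_U\<close> and \<open>overlap_beyond\<close> apply directly.\<close>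

lemma W'_overlap:
  assumes \<eta>: "\<eta> \<in> \<Xi> - I'" and p: "p \<in> Y \<eta>" "p \<in> W'" and q: "q \<in> Y \<eta>" "q \<in> W'"
  shows "d p q \<le> 2 * L"
proof -
  have main: "d p q \<le> 2 * L"
    if \<eta>: "\<eta> \<in> \<Xi> - I'" and pq: "p \<in> Y \<eta>" "q \<in> Y \<eta>" and \<alpha>: "\<alpha> \<in> J" "p \<in> Y \<alpha>"
      and q: "base_point \<alpha> q \<or> q \<in> U \<or> (\<exists>\<xi>. \<xi> \<noteq> \<alpha> \<and> beyond base_point act \<xi> q)" for \<eta> p q \<alpha>
  proof -
    have "\<not> (\<exists>\<xi>. \<xi> \<noteq> \<alpha> \<and> beyond base_point act \<xi> q)" using overlap_beyond[OF \<eta> \<alpha> _ _ pq] by blast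
    hence "q \<in> W \<or> (\<exists>\<beta>\<in>J. q \<in> Y \<beta>)" using q unfolding base_point_def U_def by blast
    then obtain \<beta> where "\<beta> \<in> J" "q \<in> Y \<beta>" using not_I'_W[OF \<eta> pq(2)] by blast
    thus ?thesis using overlap_U[OF \<eta> \<alpha> _ _ pq] by blast
  qed
  obtain g u where g: "g \<in> M'" "u \<in> U" "p = act g u" using p(2) unfolding W'_def by blast
  note gG = M'_carrier[OF g(1)]
  define \<eta>0 where "\<eta>0 = \<sigma> (inv g) \<eta>"
  define q0 where "q0 = act (inv g) q"
  have V: "p \<in> V" "q \<in> V" "u \<in> V" "q0 \<in> V" using p q W'_V g U_V act_closed gG unfolding q0_def by auto
  have u: "u = act (inv g) p" using g(3) act_inv(1)[OF gG V(3)] by simp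
  have \<eta>0: "\<eta>0 \<in> \<Xi> - I'" unfolding \<eta>0_def using not_I'_act M'_inv g(1) \<eta> by blast
  have uq: "u \<in> Y \<eta>0" "q0 \<in> Y \<eta>0" unfolding \<eta>0_def u q0_def using act_Y gG \<eta> p q by auto
  have q0: "q0 \<in> W'" unfolding q0_def using M'_W'[OF M'_inv[OF g(1)] q(2)] .
  obtain \<alpha> where \<alpha>: "\<alpha> \<in> J" "u \<in> Y \<alpha>"
    using g(2) not_I'_W[OF \<eta>0 uq(1)] unfolding U_def by blast
  have "d u q0 \<le> 2 * L"
  proof (cases "q0 \<in> U \<or> (\<exists>\<xi>. \<xi> \<noteq> \<alpha> \<and> beyond base_point act \<xi> q0)")
    case True
    thus ?thesis using main[OF \<eta>0 uq \<alpha>] by blast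
  next
    case False
    hence "beyond base_point act \<alpha> q0" using W'_cases[OF q0] by metis
    hence "\<exists>h q1. h \<in> H \<alpha> \<and> q0 = act h q1 \<and> q1 \<in> V \<and>
        (base_point \<alpha> q1 \<or> (\<exists>\<xi>. \<xi> \<noteq> \<alpha> \<and> beyond base_point act \<xi> q1))"
    proof (cases rule: beyond.cases)
      case (base q1 h)
      have "q1 \<in> V" using base(2) W_V Y_V J_\<Xi> unfolding base_point_def by blast
      thus ?thesis using base by blast
    next
      case (step \<beta> q1 h)
      have "q1 \<in> V" using beyond_near[OF step(2)] act_closed H_carrier J_\<Xi> beyond_J[OF step(2)]
        unfolding near_def by blast
      thus ?thesis using step by blast
    qed
    \<comment> \<open>The word of \<open>q0\<close> starts with a letter \<open>h\<close> of
      \<open>H \<alpha>\<close>. Undoing \<open>h\<close> keeps the first point on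
      \<open>Y \<alpha>\<close>, and the word that remains is empty or starts with another
      axis.\<close>
    then obtain h q1 where h: "h \<in> H \<alpha>" "q0 = act h q1" "q1 \<in> V"
      and q1: "base_point \<alpha> q1 \<or> (\<exists>\<xi>. \<xi> \<noteq> \<alpha> \<and> beyond base_point act \<xi> q1)" by blast
    have hM: "h \<in> M'" using H_M' \<alpha>(1) h(1) by blast
    note hG = M'_carrier[OF hM]
    have i: "inv h \<in> H \<alpha>" using H_subgroup[OF J_\<Xi>[OF \<alpha>(1)]] h(1) subgroup.m_inv_closed by metis
    have q1': "q1 = act (inv h) q0" using h act_inv(1)[OF hG] by simp
    have "d (act (inv h) u) q1 \<le> 2 * L"
    proof (rule main)
      show "\<sigma> (inv h) \<eta>0 \<in> \<Xi> - I'" using not_I'_act M'_inv hM \<eta>0 by blast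
      show "act (inv h) u \<in> Y (\<sigma> (inv h) \<eta>0)" "q1 \<in> Y (\<sigma> (inv h) \<eta>0)"
        unfolding q1' using act_Y hG \<eta>0 uq by auto
      show "\<alpha> \<in> J" using \<alpha> by blast
      show "act (inv h) u \<in> Y \<alpha>" using H_stabilises[OF J_\<Xi>[OF \<alpha>(1)] i \<alpha>(2)] .
      show "base_point \<alpha> q1 \<or> q1 \<in> U \<or> (\<exists>\<xi>. \<xi> \<noteq> \<alpha> \<and> beyond base_point act \<xi> q1)" using q1 by blast
    qed
    thus ?thesis unfolding q1' using act_isometry[of "inv h" u q0] hG V by simp
  qed
  thus ?thesis using act_isometry[of "inv g" p q] gG V unfolding q0_def u by simp
qed

lemma windmill_step:
  "windmill V d G act \<Xi> \<sigma> Y H L v W' M' I'"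
proof (intro windmill.intro windmill_axioms.intro, rule tree_rotation_axioms)
  show "convex W'" using W'_convex .
  show "v \<in> W'" using v_W W_U U_W' by blast
  show "subgroup M' G" using M'_subgroup .
  show "act m x \<in> W'" if "m \<in> M'" "x \<in> W'" for m x using M'_W' that .
  show "m = \<one>" if "m \<in> M'" "act m v = v" for m using M'_free that .
  show "I' \<subseteq> \<Xi>" unfolding I'_def using \<sigma>_closed M'_carrier I_subset J_\<Xi> by blast
  show "\<sigma> m \<xi> \<in> I'" if m: "m \<in> M'" "\<xi> \<in> I'" for m \<xi>
  proof -
    obtain g \<zeta> where g: "g \<in> M'" "\<zeta> \<in> I \<union> J" "\<xi> = \<sigma> g \<zeta>" using m(2) unfolding I'_def by blast
    have "\<zeta> \<in> \<Xi>" using g I_subset J_\<Xi> by blast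
    hence "\<sigma> m \<xi> = \<sigma> (m \<otimes> g) \<zeta>" using g \<sigma>_mult m M'_carrier by simp
    thus ?thesis unfolding I'_def using M'_mult[OF m(1) g(1)] g(2) by blast
  qed
  show "Y \<xi> \<subseteq> W'" and "H \<xi> \<subseteq> M'" if \<xi>: "\<xi> \<in> I'" for \<xi>
  proof -
    obtain g \<zeta> where g: "g \<in> M'" "\<zeta> \<in> I \<union> J" "\<xi> = \<sigma> g \<zeta>" using \<xi> unfolding I'_def by blast
    have \<zeta>: "\<zeta> \<in> \<Xi>" using g I_subset J_\<Xi> by blast
    note gG = M'_carrier[OF g(1)]
    have "Y \<zeta> \<subseteq> W'" using g(2) Y_I W_U Y_U U_W' by blast
    thus "Y \<xi> \<subseteq> W'" using Y_equivariant[OF gG \<zeta>] g(3) M'_W'[OF g(1)] by auto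
    show "H \<xi> \<subseteq> M'"
    proof
      fix x assume x: "x \<in> H \<xi>"
      have \<xi>\<Xi>: "\<xi> \<in> \<Xi>" using \<sigma>_closed gG \<zeta> g(3) by blast
      have xG: "x \<in> carrier G" using H_carrier \<xi>\<Xi> x by blast
      have "inv g \<otimes> x \<otimes> inv (inv g) \<in> H (\<sigma> (inv g) \<xi>)" using H_conj[OF inv_closed[OF gG] \<xi>\<Xi> x] .
      hence "inv g \<otimes> x \<otimes> g \<in> M'" using \<sigma>_inv(1)[OF gG \<zeta>] g(3) gG H_M'[OF g(2)] by auto
      hence "g \<otimes> (inv g \<otimes> x \<otimes> g) \<otimes> inv g \<in> M'" using M'_mult M'_inv g(1) by blast
      moreover have "g \<otimes> (inv g \<otimes> x \<otimes> g) \<otimes> inv g = x" using gG xG m_assoc[of g "inv g" x] by (simp add: m_assoc)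
      ultimately show "x \<in> M'" by simp
    qed
  qed
  show "d x y \<le> 2 * L" if "\<xi> \<in> \<Xi> - I'" "x \<in> Y \<xi>" "x \<in> W'" "y \<in> Y \<xi>" "y \<in> W'" for \<xi> x y
    using W'_overlap that .
qed

lemma windmill_next:
  "\<exists>W1 M1 I1. windmill V d G act \<Xi> \<sigma> Y H L v W1 M1 I1 \<and> W \<subseteq> W1 \<and> M \<subseteq> M1 \<and> I \<subseteq> I1 \<and>
     {\<xi> \<in> \<Xi>. Y \<xi> \<inter> W \<noteq> {}} \<subseteq> I1"
proof (intro exI conjI)
  show "windmill V d G act \<Xi> \<sigma> Y H L v W' M' I'" using windmill_step .
  show "W \<subseteq> W'" "M \<subseteq> M'" "I \<subseteq> I'" using W_U U_W' M_M' subset_I' by auto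
  show "{\<xi> \<in> \<Xi>. Y \<xi> \<inter> W \<noteq> {}} \<subseteq> I'" using subset_I' unfolding J_def by blast
qed

end

section \<open>Exhaustion of the tree by windmills\<close>

context tree_rotation begin

lemma windmill_start:
  assumes "v \<in> V"
  shows "windmill V d G act \<Xi> \<sigma> Y H L v {v} {\<one>} {}"
proof (intro windmill.intro windmill_axioms.intro, rule tree_rotation_axioms)
  show "convex {v}" unfolding convex_def btw_def using assms d_zero[of v] by auto
  show "subgroup {\<one>} G" using triv_subgroup .
qed (use assms act_one in auto)

theorem rotations_act_freely:
  assumes v: "v \<in> V" and n: "n \<in> generate G (\<Union>\<xi>\<in>\<Xi>. H \<xi>)" and fix_v: "act n v = v"
  shows "n = \<one>"
proof -
  let ?P = "\<lambda>(W, M, I). windmill V d G act \<Xi> \<sigma> Y H L v W M I"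
  let ?R = "\<lambda>(W, M, I) (W1, M1, I1). W \<subseteq> W1 \<and> M \<subseteq> M1 \<and> I \<subseteq> I1 \<and> {\<xi> \<in> \<Xi>. Y \<xi> \<inter> W \<noteq> {}} \<subseteq> I1"
  have "\<exists>f. \<forall>k. ?P (f k) \<and> ?R (f k) (f (Suc k))"
  proof (rule dependent_nat_choice)
    show "\<exists>x. ?P x" using windmill_start[OF v] by auto
    show "\<exists>y. ?P y \<and> ?R x y" if "?P x" for x n
      using windmill.windmill_next[of V d G act \<Xi> \<sigma> Y H L v "fst x" "fst (snd x)" "snd (snd x)"] that
      by (auto simp: split_beta)
  qed
  then obtain f where f0: "\<forall>k. ?P (f k) \<and> ?R (f k) (f (Suc k))" ..
  note f = f0[THEN spec, THEN conjunct1] f0[THEN spec, THEN conjunct2]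
  define W M I where "W k = fst (f k)" and "M k = fst (snd (f k))" and "I k = snd (snd (f k))" for k
  have P: "windmill V d G act \<Xi> \<sigma> Y H L v (W k) (M k) (I k)" for k
    using f(1)[of k] unfolding W_def M_def I_def by (simp add: split_beta)
  have M_mono: "M k \<subseteq> M (Suc k)" and I_next: "\<lbrakk>\<xi> \<in> \<Xi>; Y \<xi> \<inter> W k \<noteq> {}\<rbrakk> \<Longrightarrow> \<xi> \<in> I (Suc k)" for k \<xi>
    using f(2)[of k] unfolding W_def M_def I_def by (auto simp: split_beta)
  have M_le: "M i \<subseteq> M j" if "i \<le> j" for i j using lift_Suc_mono_le[of M, OF M_mono that] .
  \<comment> \<open>Every axis that meets \<open>W k\<close> is absorbed at the next stage, so the
    union is saturated.\<close>
  have "(\<Union>k. W k) = V"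
  proof (rule covering)
    show "(\<Union>k. W k) \<subseteq> V" using windmill.W_V[OF P] by blast
    show "(\<Union>k. W k) \<noteq> {}" using windmill.v_W[OF P] by blast
    show "Y \<xi> \<subseteq> (\<Union>k. W k)" if "\<xi> \<in> \<Xi>" "Y \<xi> \<inter> (\<Union>k. W k) \<noteq> {}" for \<xi>
      using that I_next windmill.Y_I[OF P] by blast
  qed
  have H_M: "H \<xi> \<subseteq> (\<Union>k. M k)" if "\<xi> \<in> \<Xi>" for \<xi>
  proof -
    obtain k where "Y \<xi> \<inter> W k \<noteq> {}" using \<open>(\<Union>k. W k) = V\<close> Y_V Y_nonempty \<open>\<xi> \<in> \<Xi>\<close> by blast
    thus ?thesis using windmill.H_I[OF P I_next[OF \<open>\<xi> \<in> \<Xi>\<close>]] by blast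
  qed
  have "x \<in> (\<Union>k. M k)" if "x \<in> generate G (\<Union>\<xi>\<in>\<Xi>. H \<xi>)" for x
    using that
  proof (induction rule: generate.induct)
    case one
    then show ?case using subgroup.one_closed windmill.M_subgroup[OF P] by blast
  next
    case (incl h)
    then show ?case using H_M by blast
  next
    case (inv h)
    then show ?case using H_M windmill.M_inv[OF P] by blast
  next
    case (eng h1 h2)
    then obtain i j where "h1 \<in> M i" "h2 \<in> M j" by blast
    hence "h1 \<in> M (max i j)" "h2 \<in> M (max i j)"
      using M_le[of i "max i j"] M_le[of j "max i j"] by auto
    hence "h1 \<otimes> h2 \<in> M (max i j)" using subgroup.m_closed windmill.M_subgroup[OF P] by metis
    thus ?case by blast
  qed
  then obtain k where "n \<in> M k" using n by blast
  thus ?thesis using windmill.M_free[OF P] fix_v by blast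
qed

end

section \<open>Isometries of trees\<close>

context tree_metric begin

text \<open>Choose ends \<open>a\<close>, \<open>c\<close> of the segment such that a geodesic from
  \<open>a\<close> to \<open>g c\<close> passes through \<open>z\<close> and then
  \<open>g z\<close>. Its length is \<open>d c z + d a z + d z (g z)\<close>. It is also at most
  \<open>\<tau>\<close> if \<open>a = c\<close>, and at most \<open>\<tau>\<close> plus the length
  of the segment otherwise.\<close>

lemma convex_min_displacement:
  assumes closed: "\<And>x. x \<in> V \<Longrightarrow> g x \<in> V"
    and isometry: "\<And>x y. \<lbrakk>x \<in> V; y \<in> V\<rbrakk> \<Longrightarrow> d (g x) (g y) = d x y"
    and min: "\<And>x. x \<in> V \<Longrightarrow> \<tau> \<le> d x (g x)"
  shows "convex {x \<in> V. d x (g x) = \<tau>}"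
  unfolding convex_def
proof (intro conjI ballI impI, goal_cases)
  case 1
  show ?case by blast
next
  case (2 x y z)
  hence V: "x \<in> V" "y \<in> V" "z \<in> V" and b: "btw x z y" and \<tau>: "d x (g x) = \<tau>" "d y (g y) = \<tau>" by auto
  note gV = closed[OF V(1)] closed[OF V(2)] closed[OF V(3)]
  have bg: "btw (g x) (g z) (g y)" using b V isometry unfolding btw_def by simp
  obtain a where a: "a = x \<or> a = y" "d a (g z) = d a z + d z (g z)"
    using btw_tripod[OF V gV(3) b] V gV d_sym[of "g z" y] d_sym[of "g z" z] d_sym[of z y]
    unfolding btw_def by (metis add.commute)
  have aV: "a \<in> V" using a V by auto
  obtain c where c: "c = x \<or> c = y" "d (g c) a = d (g c) (g z) + d (g z) a"
    using btw_tripod[OF gV aV bg] V gV aV d_sym[of a "g y"] d_sym[of "g z" a] d_sym[of "g z" "g y"]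
    unfolding btw_def by (metis add.commute)
  have eq: "d a (g c) = d c z + d a z + d z (g z)"
    using a(2) c V gV aV isometry d_sym[of "g c" a] d_sym[of "g z" a] by auto
  have "d x (g y) \<le> \<tau> + d x y" "d y (g x) \<le> \<tau> + d x y"
    using d_triangle[of x "g x" "g y"] d_triangle[of y "g y" "g x"] V gV \<tau> isometry d_sym[of x y] by auto
  hence "d z (g z) \<le> \<tau>"
    using eq a(1) c(1) \<tau> b d_sym[of y z] V unfolding btw_def by auto
  thus ?case using min[OF V(3)] V by auto
qed

text \<open>The alignment of three consecutive points is transported along the orbit, and successive
  triples overlap in a nontrivial segment, so \<open>btw_concat\<close> glues them.\<close>

lemma iterate_displacement:
  assumes closed: "\<And>x. x \<in> V \<Longrightarrow> g x \<in> V"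
    and isometry: "\<And>x y. \<lbrakk>x \<in> V; y \<in> V\<rbrakk> \<Longrightarrow> d (g x) (g y) = d x y"
    and x: "x \<in> V" "g x \<noteq> x" and b: "btw x (g x) (g (g x))"
  shows "d x ((g ^^ Suc n) x) = Suc n * d x (g x)"
proof -
  have V: "(g ^^ n) x \<in> V" for n by (induction n) (use x closed in auto)
  have s: "d ((g ^^ n) x) ((g ^^ n) y) = d x y" if "y \<in> V" "\<And>n. (g ^^ n) y \<in> V" for n y
    by (induction n) (use V that isometry in auto)
  have s1: "d ((g ^^ n) x) ((g ^^ Suc n) x) = d x (g x)" for n
    using s[OF closed[OF x(1)], of n] V[of "Suc _"] by (simp add: funpow_swap1)
  have sb: "btw ((g ^^ n) x) ((g ^^ Suc n) x) ((g ^^ Suc (Suc n)) x)" for n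
  proof (induction n)
    case 0
    then show ?case using b by simp
  next
    case (Suc n)
    then show ?case using isometry V[of n] V[of "Suc n"] V[of "Suc (Suc n)"] V[of "Suc (Suc (Suc n))"]
      unfolding btw_def by simp
  qed
  have ne: "(g ^^ n) x \<noteq> (g ^^ Suc n) x" for n
    using s1[of n] d_zero[OF V V, of n "Suc n"] d_zero[OF x(1) closed[OF x(1)]] x(2) by metis
  have "btw x ((g ^^ Suc n) x) ((g ^^ Suc (Suc n)) x) \<and> d x ((g ^^ Suc n) x) = Suc n * d x (g x)" for n
  proof (induction n)
    case 0
    then show ?case using b by simp
  next
    case (Suc n)
    have "btw x ((g ^^ Suc (Suc n)) x) ((g ^^ Suc (Suc (Suc n))) x)"
      using btw_concat(2)[OF x(1) V V V conjunct1[OF Suc] sb ne] .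
    moreover have "d x ((g ^^ Suc (Suc n)) x) = Suc (Suc n) * d x (g x)"
      using Suc s1[of "Suc n"] unfolding btw_def by (simp del: funpow.simps)
    ultimately show ?case by blast
  qed
  thus ?thesis by blast
qed

end

text \<open>
  A graph whose vertices embed into a cube in such a way that every edge flips exactly the
  coordinate which it indexes is a tree: \<open>f x\<close> is the set of edges separating \<open>x\<close> from a base point.
\<close>

locale cube_tree =
  fixes V :: "'x set" and R :: "('x \<times> 'x) set" and f :: "'x \<Rightarrow> 'x set set"
  assumes R_V: "R \<subseteq> V \<times> V" and R_sym: "sym R"
    and connected: "\<lbrakk>x \<in> V; y \<in> V\<rbrakk> \<Longrightarrow> (x, y) \<in> R\<^sup>*"
    and flip: "(x, y) \<in> R \<Longrightarrow> (e \<in> f x) \<noteq> (e \<in> f y) \<longleftrightarrow> e = {x, y}"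
begin

definition D :: "'x \<Rightarrow> 'x \<Rightarrow> nat" where
  "D x y = (LEAST n. (x, y) \<in> R ^^ n)"

definition sep where "sep e x y \<longleftrightarrow> (e \<in> f x) \<noteq> (e \<in> f y)"

lemma RD: "(x, y) \<in> R \<Longrightarrow> x \<in> V" "(x, y) \<in> R \<Longrightarrow> y \<in> V" "(x, y) \<in> R \<Longrightarrow> (y, x) \<in> R"
  using R_V R_sym by (auto dest: symD)

lemma relpow_sym: "(x, y) \<in> R ^^ n \<Longrightarrow> (y, x) \<in> R ^^ n"
proof (induction n arbitrary: y)
  case (Suc n)
  then obtain z where "(x, z) \<in> R ^^ n" "(z, y) \<in> R" by auto
  thus ?case using Suc.IH RD(3) relpow_Suc_I2 by metis
qed simp

lemma D_relpow: "\<lbrakk>x \<in> V; y \<in> V\<rbrakk> \<Longrightarrow> (x, y) \<in> R ^^ D x y"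
  unfolding D_def by (rule LeastI_ex) (use connected rtrancl_imp_relpow in metis)

lemma D_le: "(x, y) \<in> R ^^ n \<Longrightarrow> D x y \<le> n"
  unfolding D_def by (rule Least_le)

lemma D_zero: "\<lbrakk>x \<in> V; y \<in> V\<rbrakk> \<Longrightarrow> D x y = 0 \<longleftrightarrow> x = y"
  using D_relpow[of x y] D_le[of x x 0] by auto

lemma D_sym: "\<lbrakk>x \<in> V; y \<in> V\<rbrakk> \<Longrightarrow> D x y = D y x"
  using D_le[OF relpow_sym[OF D_relpow]] by (simp add: le_antisym)

lemma D_triangle: "\<lbrakk>x \<in> V; y \<in> V; z \<in> V\<rbrakk> \<Longrightarrow> D x z \<le> D x y + D y z"
  using D_le D_relpow relpow_add by (metis relcomp.relcompI)

lemma D_adjacent_le: "(x, y) \<in> R \<Longrightarrow> D x y \<le> 1"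
  using D_le[of x y 1] by simp

lemma D_step:
  assumes "x \<in> V" "y \<in> V" "x \<noteq> y"
  obtains x' where "(x, x') \<in> R" "D x y = Suc (D x' y)"
proof -
  obtain n where n: "D x y = Suc n" using D_zero assms by (metis not0_implies_Suc)
  then obtain x' where x': "(x, x') \<in> R" "(x', y) \<in> R ^^ n"
    using D_relpow[OF assms(1,2)] relpow_Suc_D2 by metis
  have "D x' y \<le> n" using D_le x' by blast
  moreover have "D x y \<le> D x x' + D x' y" using D_triangle assms RD x' by blast
  ultimately have "D x y = Suc (D x' y)" using n D_adjacent_le[OF x'(1)] by linarith
  thus ?thesis using that x' by blast
qed

lemma sep_trans: "sep e x z \<Longrightarrow> sep e x y \<or> sep e y z"
  unfolding sep_def by blast

lemma sep_adjacent: "(x, y) \<in> R \<Longrightarrow> sep e x y \<longleftrightarrow> e = {x, y}"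
  unfolding sep_def using flip by blast

text \<open>Along a path the coordinate \<open>{a, b}\<close> of \<open>f\<close> changes only when
  this very edge is traversed, so a geodesic between separated points contains it.\<close>

lemma geodesic_crosses:
  assumes "x \<in> V" "y \<in> V" "(a, b) \<in> R" "sep {a, b} x y"
  shows "D x y = D x a + 1 + D b y \<or> D x y = D x b + 1 + D a y"
  using assms(1,4)
proof (induction "D x y" arbitrary: x)
  case 0
  then show ?case using D_zero[OF 0(2) assms(2)] unfolding sep_def by auto
next
  case (Suc n)
  have ne: "x \<noteq> y" using Suc(4) unfolding sep_def by auto
  obtain x' where x': "(x, x') \<in> R" "D x y = Suc (D x' y)" using D_step[OF Suc(3) assms(2) ne] by blast
  show ?case
  proof (cases "{a, b} = {x, x'}")
    case True
    hence "(a = x \<and> b = x') \<or> (a = x' \<and> b = x)" by (auto simp: doubleton_eq_iff)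
    thus ?thesis using x'(2) D_zero[OF Suc(3,3)] by auto
  next
    case False
    hence "sep {a, b} x' y" using sep_trans[OF Suc(4), of x'] sep_adjacent[OF x'(1)] by simp
    hence IH: "D x' y = D x' a + 1 + D b y \<or> D x' y = D x' b + 1 + D a y"
      using Suc(1)[of x'] Suc(2) x' RD by auto
    have V: "a \<in> V" "b \<in> V" "x' \<in> V" using RD assms(3) x'(1) by auto
    have le: "D x a \<le> 1 + D x' a" "D x b \<le> 1 + D x' b"
      using D_triangle[OF Suc(3) V(3)] V(1,2) D_adjacent_le[OF x'(1)] by (meson add_mono le_refl order_trans)+
    have "D a b \<le> 1" "D b a \<le> 1" using D_adjacent_le assms(3) RD(3) by auto
    hence "D x y \<le> D x a + 1 + D b y" "D x y \<le> D x b + 1 + D a y"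
      using D_triangle[OF Suc(3) V(1) assms(2)] D_triangle[OF Suc(3) V(2) assms(2)]
        D_triangle[OF V(1,2) assms(2)] D_triangle[OF V(2,1) assms(2)] by linarith+
    thus ?thesis using IH le x'(2) by linarith
  qed
qed

text \<open>One end of the edge is separated from \<open>w\<close> by the edge itself, so a geodesic
  from that end starts across it.\<close>

lemma bipartite:
  assumes "(x, x') \<in> R" "w \<in> V"
  shows "D x' w = Suc (D x w) \<or> D x w = Suc (D x' w)"
proof -
  have V: "x \<in> V" "x' \<in> V" using RD assms by auto
  have "sep {x, x'} x x'" using sep_adjacent assms by blast
  hence "sep {x, x'} x w \<or> sep {x, x'} x' w" unfolding sep_def by blast
  thus ?thesis
    using geodesic_crosses[OF V(1) assms(2,1)] geodesic_crosses[OF V(2) assms(2,1)]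
      D_zero[OF V(1,1)] D_zero[OF V(2,2)] by auto
qed

text \<open>If \<open>a\<close> and \<open>b\<close> were different, the edge from \<open>z\<close>
  to \<open>b\<close> would separate \<open>a\<close> from \<open>w\<close>, and a geodesic from
  \<open>a\<close> across this edge is too long.\<close>

lemma unique_step:
  assumes "(z, a) \<in> R" "(z, b) \<in> R" "w \<in> V" "D z w = Suc (D a w)" "D z w = Suc (D b w)"
  shows "a = b"
proof (rule ccontr)
  assume "a \<noteq> b"
  have V: "z \<in> V" "a \<in> V" "b \<in> V" using RD assms by auto
  let ?e = "{z, b}"
  have "\<not> sep ?e b w"
    using geodesic_crosses[OF V(3) assms(3,2)] assms(5) by auto
  hence "sep ?e z w" using sep_adjacent[OF assms(2), of ?e] unfolding sep_def by blast
  moreover have "\<not> sep ?e z a" using sep_adjacent[OF assms(1)] \<open>a \<noteq> b\<close> by (auto simp: doubleton_eq_iff)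
  ultimately have "sep ?e a w" unfolding sep_def by blast
  thus False using geodesic_crosses[OF V(2) assms(3,2)] assms(4,5) by auto
qed

text \<open>Contrapositively, a path without backtracking at \<open>m\<close> is geodesic. The
  induction peels off the first step at \<open>y\<close>: if it could not be added back, the next
  vertex \<open>y1\<close> would have two steps towards \<open>z\<close>, namely \<open>y\<close>
  and its successor on the way to \<open>m\<close>, against \<open>unique_step\<close>. If
  \<open>y1 = m\<close>, then \<open>y\<close> is itself a common step.\<close>

lemma common_step:
  assumes m: "m \<in> V" and z: "z \<in> V" and y: "y \<in> V" and ne: "D y m + D m z \<noteq> D y z"
  shows "\<exists>m'. (m, m') \<in> R \<and> D m y = Suc (D m' y) \<and> D m z = Suc (D m' z)"
proof (rule ccontr)
  assume no: "\<not> ?thesis"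
  have "D y m + D m z = D y z" using y no
  proof (induction "D y m" arbitrary: y)
    case 0
    then show ?case using D_zero m by simp
  next
    case (Suc n)
    have "y \<noteq> m" using Suc(2) D_zero[OF m m] by auto
    then obtain y1 where y1: "(y, y1) \<in> R" "D y m = Suc (D y1 m)" using D_step[OF Suc(3) m] by blast
    have V: "y1 \<in> V" using RD y1 by blast
    have sym: "D m y = D y m" "D m y1 = D y1 m" using D_sym m V Suc(3) by auto
    have "\<not> (\<exists>m'. (m, m') \<in> R \<and> D m y1 = Suc (D m' y1) \<and> D m z = Suc (D m' z))"
    proof
      assume "\<exists>m'. (m, m') \<in> R \<and> D m y1 = Suc (D m' y1) \<and> D m z = Suc (D m' z)"
      then obtain m' where m': "(m, m') \<in> R" "D m y1 = Suc (D m' y1)" "D m z = Suc (D m' z)" by blast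
      have V': "m' \<in> V" using RD m'(1) by blast
      have "D m' y \<le> D m' y1 + D y1 y" using D_triangle V' V Suc(3) by blast
      hence "D m' y \<le> D m y1" using m'(2) D_adjacent_le[OF RD(3)[OF y1(1)]] by linarith
      hence "D m y = Suc (D m' y)" using bipartite[OF m'(1) Suc(3)] sym y1(2) by linarith
      thus False using Suc(4) m' by blast
    qed
    hence IH: "D y1 m + D m z = D y1 z" using Suc(1)[of y1] Suc(2) V y1(2) by simp
    show ?case
    proof (rule ccontr)
      assume "D y m + D m z \<noteq> D y z"
      hence yz: "D y1 z = Suc (D y z)" using bipartite[OF y1(1) z] IH y1(2) by auto
      show False
      proof (cases "y1 = m")
        case True
        have "D m y = Suc (D y y)" using sym y1 True D_zero[OF m m] D_zero[OF Suc(3,3)] by simp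
        thus False using Suc(4) RD(3)[OF y1(1)] yz True by blast
      next
        case False
        then obtain y2 where y2: "(y1, y2) \<in> R" "D y1 m = Suc (D y2 m)" using D_step[OF V m] by blast
        have "D y2 z \<le> D y2 m + D m z" using D_triangle[OF RD(2)[OF y2(1)] m z] .
        hence "D y1 z = Suc (D y2 z)" using bipartite[OF y2(1) z] IH y2(2) by linarith
        hence "y = y2" using unique_step[OF RD(3)[OF y1(1)] y2(1) z yz] by simp
        thus False using y1(2) y2(2) by simp
      qed
    qed
  qed
  thus False using ne by blast
qed

sublocale tree_metric V D
proof
  show "D x y = 0 \<longleftrightarrow> x = y" if "x \<in> V" "y \<in> V" for x y using D_zero[OF that] .
  show "D x y = D y x" if "x \<in> V" "y \<in> V" for x y using D_sym[OF that] .
  show "D x z \<le> D x y + D y z" if "x \<in> V" "y \<in> V" "z \<in> V" for x y z using D_triangle[OF that] .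
  show "\<exists>m\<in>V. D x m + D m y = D x y \<and> D y m + D m z = D y z \<and> D x m + D m z = D x z"
    if V: "x \<in> V" "y \<in> V" "z \<in> V" for x y z
  proof -
    \<comment> \<open>The median is the point farthest from \<open>x\<close> that is on the way to
      both \<open>y\<close> and \<open>z\<close>; a common step would lead to a farther one.\<close>
    let ?P = "\<lambda>m. m \<in> V \<and> D x m + D m y = D x y \<and> D x m + D m z = D x z"
    have "?P x" using V D_zero[OF V(1,1)] by simp
    moreover have "\<forall>m. ?P m \<longrightarrow> D x m < Suc (D x y)" by auto
    ultimately obtain m where m: "?P m" "\<And>m'. ?P m' \<Longrightarrow> D x m' \<le> D x m"
      using ex_has_greatest_nat[of ?P x "D x" "Suc (D x y)"] by blast
    have mV: "m \<in> V" using m by blast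
    have "D y m + D m z = D y z"
    proof (rule ccontr)
      assume "D y m + D m z \<noteq> D y z"
      then obtain m' where m': "(m, m') \<in> R" "D m y = Suc (D m' y)" "D m z = Suc (D m' z)"
        using common_step[OF mV V(3,2)] by blast
      have m'V: "m' \<in> V" using RD m' by blast
      have "D x y \<le> D x m' + D m' y" "D x z \<le> D x m' + D m' z" "D x m' \<le> D x m + D m m'"
        using D_triangle V mV m'V by auto
      hence "D x m' = Suc (D x m)" using m(1) m' D_adjacent_le[OF m'(1)] by linarith
      hence "?P m'" using m(1) m' m'V by auto
      thus False using m(2)[of m'] \<open>D x m' = Suc (D x m)\<close> by simp
    qed
    thus ?thesis using m(1) by blast
  qed
  show "D x z + D z w = D x w \<or> D w z + D z y = D w y"
    if V: "x \<in> V" "y \<in> V" "z \<in> V" and w: "w \<in> V" and b: "D x z + D z y = D x y" for x y z w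
  proof (rule ccontr)
    assume no: "\<not> ?thesis"
    \<comment> \<open>If both alternatives failed, the unique step from \<open>z\<close> towards
      \<open>w\<close> would lead towards both \<open>x\<close> and \<open>y\<close>, although
      \<open>z\<close> lies between them.\<close>
    obtain a where a: "(z, a) \<in> R" "D z x = Suc (D a x)" "D z w = Suc (D a w)"
      using common_step[OF V(3) w V(1)] no by blast
    obtain c where c: "(z, c) \<in> R" "D z w = Suc (D c w)" "D z y = Suc (D c y)"
      using common_step[OF V(3,2) w] no by blast
    have ac: "a = c" using unique_step[OF a(1) c(1) w a(3) c(2)] .
    have "D x y \<le> D x a + D a y" "D x a = D a x" "D x z = D z x"
      using D_triangle[OF V(1) _ V(2)] D_sym V RD[OF a(1)] by auto
    thus False using a c(3)[folded ac] b by linarith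
  qed
qed

text \<open>Otherwise some neighbour \<open>u\<close> of \<open>g x\<close> is a step towards both
  \<open>x\<close> and \<open>g (g x)\<close>. Its preimage \<open>u'\<close> is a neighbour of
  \<open>x\<close> towards \<open>g x\<close>. Either \<open>u'\<close> is displaced less than
  \<open>x\<close>, or \<open>g\<close> swaps \<open>x\<close> and \<open>u'\<close> and inverts an
  edge.\<close>

lemma hyperbolic_btw:
  assumes closed: "\<And>x. x \<in> V \<Longrightarrow> g x \<in> V"
    and isometry: "\<And>x y. \<lbrakk>x \<in> V; y \<in> V\<rbrakk> \<Longrightarrow> D (g x) (g y) = D x y"
    and surj: "\<And>x y. (g x, y) \<in> R \<Longrightarrow> x \<in> V \<Longrightarrow> \<exists>y'. (x, y') \<in> R \<and> y = g y'"
    and no_inversion: "\<And>x y. (x, y) \<in> R \<Longrightarrow> \<not> (g x = y \<and> g y = x)"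
    and min: "\<And>y. y \<in> V \<Longrightarrow> D x (g x) \<le> D y (g y)"
    and x: "x \<in> V" and ne: "g x \<noteq> x"
  shows "btw x (g x) (g (g x))"
proof (rule ccontr)
  assume n: "\<not> ?thesis"
  note gx = closed[OF x] and ggx = closed[OF closed[OF x]]
  obtain u where u: "(g x, u) \<in> R" "D (g x) x = Suc (D u x)" "D (g x) (g (g x)) = Suc (D u (g (g x)))"
    using common_step[OF gx ggx x] n unfolding btw_def by blast
  obtain u' where u': "(x, u') \<in> R" "u = g u'" using surj[OF u(1) x] by blast
  have V: "u \<in> V" "u' \<in> V" using RD u u' by auto
  have d1: "D x (g x) = Suc (D u' (g x))"
    using u(3) isometry[OF x gx] isometry[OF V(2) gx] u'(2) by simp
  have s: "D x (g x) = D (g x) x" "D u' (g x) = D (g x) u'" using D_sym x gx V by auto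
  show False
  proof (cases "u' = g x")
    case True
    hence "D u x = 0" using d1 s u(2) D_zero[OF gx gx] by simp
    hence "u = x" using D_zero V x by blast
    thus False using no_inversion[OF u'(1)] u'(2) True by simp
  next
    case False
    then obtain t where t: "(g x, t) \<in> R" "D (g x) u' = Suc (D t u')"
      using D_step[OF gx V(2)] by metis
    have tV: "t \<in> V" using RD t by blast
    have "D t x \<le> D t u' + D u' x" using D_triangle tV V x by blast
    moreover have "D u' x \<le> 1" using D_adjacent_le RD(3) u'(1) by blast
    ultimately have "D (g x) x = Suc (D t x)" using bipartite[OF t(1) x] d1 s t(2) by linarith
    hence "t = u" using unique_step[OF t(1) u(1) x _ u(2)] by blast
    hence "D u' (g u') < D x (g x)" using d1 s t(2) u'(2) D_sym[OF V] by simp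
    thus False using min[OF V(2)] by simp
  qed
qed

end

section \<open>Representations of the fundamental group\<close>

primrec composite :: "('c \<Rightarrow> 'k \<Rightarrow> 'k) \<Rightarrow> 'c list \<Rightarrow> 'k \<Rightarrow> 'k" where
  "composite \<rho> [] = id"
| "composite \<rho> (a # w) = \<rho> a \<circ> composite \<rho> w"

lemma composite_append: "composite \<rho> (w @ w') = composite \<rho> w \<circ> composite \<rho> w'"
  by (induction w) (auto simp: o_assoc)

locale based_graph_of_groups = graph_of_groups \<G> for \<G> :: "('v, 'g, 'h) gog" +
  fixes S :: "'v pair_pre_digraph"
  assumes spanning: "undirected_spanning_tree S (base \<G>)"
begin

abbreviation "bverts \<equiv> pverts (base \<G>)"
abbreviation "barcs \<equiv> parcs (base \<G>)"
abbreviation "words \<equiv> lists (letters \<G>)"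
abbreviation "weq \<equiv> word_eq \<G> S"
abbreviation "cls \<equiv> word_class \<G> S"
abbreviation "pi1 \<equiv> fundamental_group \<G> S"
abbreviation pi1_mult (infixl "\<cdot>" 70) where "g \<cdot> h \<equiv> g \<otimes>\<^bsub>pi1\<^esub> h"
abbreviation pi1_one ("\<^bold>1") where "\<^bold>1 \<equiv> \<one>\<^bsub>pi1\<^esub>"
abbreviation "GG \<equiv> carrier pi1"
abbreviation "vcar v \<equiv> carrier (vgrp \<G> v)"
abbreviation "ecar e \<equiv> carrier (egrp \<G> e)"
abbreviation "vmap \<equiv> vertex_map \<G> S"
abbreviation "emap \<equiv> edge_map \<G> S"
abbreviation "stab v \<equiv> vmap v ` vcar v"
abbreviation "estab e \<equiv> emap e ` ecar e"
abbreviation "st \<equiv> stable_letter \<G> S"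
abbreviation "BT \<equiv> bass_serre_tree \<G> S"
abbreviation "BX \<equiv> bs_space \<G> S"
abbreviation "move \<equiv> bs_vertex_action \<G> S"
abbreviation "bsact \<equiv> bs_action \<G> S"
abbreviation "bsdist \<equiv> bs_dist \<G> S"

lemma arcD:
  assumes "e \<in> barcs"
  shows "fst e \<in> bverts" "snd e \<in> bverts" "fst e \<noteq> snd e"
    "prod.swap e \<in> barcs"
proof -
  interpret B: pair_graph "base \<G>" by (rule finite_simplicial)
  show "fst e \<in> bverts" "snd e \<in> bverts" "fst e \<noteq> snd e"
    using B.arc_fst_in_verts B.arc_snd_in_verts B.pair_no_loops assms by auto
  show "prod.swap e \<in> barcs"
    using B.pair_sym_arcs assms unfolding symmetric_def by (cases e) (auto dest: symD)
qed

lemma S_wf: "wf_digraph (with_proj S)"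
  and S_verts: "pverts S = bverts"
  and S_arcs: "parcs S \<subseteq> barcs"
  and S_symmetric: "symmetric (with_proj S)"
  and S_connected: "Digraph_Component.connected (with_proj S)"
  and S_acyclic: "\<not> (\<exists>p. pre_digraph.cycle (with_proj S) p \<and> 3 \<le> length p)"
  using spanning unfolding undirected_spanning_tree_def spanning_def subgraph_def by simp_all

lemma S_walk:
  assumes "u \<in> bverts" "v \<in> bverts"
  shows "\<exists>p. pre_digraph.awalk (with_proj S) u p v"
proof -
  interpret T: wf_digraph "with_proj S" by (rule S_wf)
  have "strongly_connected (with_proj S)"
    using T.symmetric_connected_imp_strongly_connected S_symmetric S_connected by blast
  hence "u \<rightarrow>\<^sup>*\<^bsub>with_proj S\<^esub> v" using assms S_verts unfolding strongly_connected_def by simp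
  thus ?thesis using T.reachable_awalk by blast
qed

text \<open>A repeated vertex splits off a shorter closed walk. A nonempty closed walk without
  repetition is a cycle, so its length is less than 3; as there are no loops, it is a backtrack
  along an edge, where \<open>\<phi>\<close> cancels.\<close>

lemma closed_walk_composite:
  assumes \<phi>: "\<And>e. e \<in> parcs S \<Longrightarrow> \<phi> e \<circ> \<phi> (prod.swap e) = id"
    and p: "pre_digraph.awalk (with_proj S) u p u"
  shows "composite \<phi> p = id"
proof -
  interpret T: wf_digraph "with_proj S" by (rule S_wf)
  show ?thesis using p
  proof (induction "length p" arbitrary: p u rule: less_induct)
    case less
    show ?case
    proof (cases p)
      case Nil
      thus ?thesis by simp
    next
      case (Cons e p')
      have e: "e \<in> parcs S" "fst e = u" and p': "T.awalk (snd e) p' u"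
        using less(2) unfolding Cons T.awalk_Cons_iff by auto
      show ?thesis
      proof (cases "distinct (T.awalk_verts (snd e) p')")
        case True
        hence "T.cycle p" using less(2) Cons unfolding T.cycle_def by auto
        hence "length p < 3" using S_acyclic by force
        moreover have "p' \<noteq> []"
          using p' e(2) arcD(3)[OF subsetD[OF S_arcs e(1)]] by (auto simp: T.awalk_Nil_iff)
        ultimately obtain e' where e': "p' = [e']" using Cons by (cases p'; cases "tl p'") auto
        have "e' = prod.swap e" using p' e(2) unfolding e' by (auto simp: T.awalk_simps prod_eq_iff)
        thus ?thesis using \<phi>[OF e(1)] Cons e' by simp
      next
        case False
        then obtain q r s w where q: "p' = q @ r @ s" "0 < length r"
          "T.awalk (snd e) q w" "T.awalk w r w" "T.awalk w s u"
          using T.awalk_not_distinct_decomp[OF p'] by blast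
        have "T.awalk u (e # q @ s) u" using e q T.awalk_appendI unfolding T.awalk_Cons_iff by auto
        hence "composite \<phi> (e # q @ s) = id" using less(1)[of "e # q @ s" u] q(1,2) Cons by simp
        moreover have "composite \<phi> r = id" using less(1)[of r w] q(1,4) Cons by simp
        ultimately show ?thesis using Cons q(1) by (simp add: composite_append)
      qed
    qed
  qed
qed

text \<open>Since \<open>S\<close> is a tree, the product of \<open>\<phi>\<close> along a path in \<open>S\<close> depends on its ends only.\<close>

lemma tree_potential:
  obtains path :: "'v \<Rightarrow> ('v \<times> 'v) list" where
    "\<And>v. v \<in> bverts \<Longrightarrow> set (path v) \<subseteq> parcs S"
    "\<And>(\<phi> :: 'v \<times> 'v \<Rightarrow> 'k \<Rightarrow> 'k) e. \<lbrakk>\<And>e. e \<in> parcs S \<Longrightarrow> \<phi> e \<circ> \<phi> (prod.swap e) = id; e \<in> parcs S\<rbrakk>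
      \<Longrightarrow> composite \<phi> (path (snd e)) = composite \<phi> (path (fst e)) \<circ> \<phi> e"
proof -
  interpret T: wf_digraph "with_proj S" by (rule S_wf)
  have "bverts \<noteq> {}"
    using S_connected unfolding connected_def strongly_connected_def mk_symmetric_def by (auto simp: S_verts)
  then obtain v0 where v0: "v0 \<in> bverts" by blast
  obtain path where path: "\<And>v. v \<in> bverts \<Longrightarrow> T.awalk v0 (path v) v"
    using S_walk[OF v0] by metis
  show ?thesis
  proof
    show "set (path v) \<subseteq> parcs S" if "v \<in> bverts" for v
      using path[OF that] by (auto simp: T.awalk_def)
    fix \<phi> :: "'v \<times> 'v \<Rightarrow> 'k \<Rightarrow> 'k" and e
    assume \<phi>: "\<And>e. e \<in> parcs S \<Longrightarrow> \<phi> e \<circ> \<phi> (prod.swap e) = id" and e: "e \<in> parcs S"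
    have V: "fst e \<in> bverts" "snd e \<in> bverts" using arcD[OF subsetD[OF S_arcs e]] by auto
    \<comment> \<open>The walk \<open>r\<close> back to the base point gives a common right inverse
      of both sides and a left inverse of \<open>composite \<phi> (path (snd e))\<close>.\<close>
    obtain r where r: "T.awalk (snd e) r v0" using S_walk[OF V(2) v0] by blast
    have "T.awalk v0 (path (snd e) @ r) v0" using T.awalk_appendI[OF path[OF V(2)] r] .
    hence 1: "composite \<phi> (path (snd e)) \<circ> composite \<phi> r = id"
      using closed_walk_composite[of \<phi>, OF \<phi>, of v0 "path (snd e) @ r"] by (simp only: composite_append)
    have er: "T.awalk (fst e) (e # r) v0" using r e by (simp add: T.awalk_Cons_iff)
    have "T.awalk v0 (path (fst e) @ e # r) v0" using T.awalk_appendI[OF path[OF V(1)] er] .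
    hence 2: "composite \<phi> (path (fst e)) \<circ> \<phi> e \<circ> composite \<phi> r = id"
      using closed_walk_composite[of \<phi>, OF \<phi>, of v0 "path (fst e) @ e # r"] by (simp only: composite_append composite.simps o_assoc)
    have "T.awalk (snd e) (r @ path (snd e)) (snd e)" using T.awalk_appendI[OF r path[OF V(2)]] .
    hence "composite \<phi> r \<circ> composite \<phi> (path (snd e)) = id"
      using closed_walk_composite[of \<phi>, OF \<phi>, of "snd e" "r @ path (snd e)"] by (simp only: composite_append)
    thus "composite \<phi> (path (snd e)) = composite \<phi> (path (fst e)) \<circ> \<phi> e"
      using 1 2 by (metis comp_assoc comp_id id_comp)
  qed
qed

lemma letters_iff [simp]:
  "Vtx v x \<in> letters \<G> \<longleftrightarrow> v \<in> bverts \<and> x \<in> vcar v"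
  "Arc e \<in> letters \<G> \<longleftrightarrow> e \<in> barcs"
  unfolding letters_def by auto

lemma emb_closed:
  "\<lbrakk>e \<in> barcs; c \<in> ecar e\<rbrakk> \<Longrightarrow> emb \<G> e c \<in> vcar (snd e)"
  using emb_hom unfolding hom_def by blast

lemma emb_swap_closed:
  assumes "e \<in> barcs" "c \<in> ecar e"
  shows "emb \<G> (prod.swap e) c \<in> vcar (fst e)"
  using emb_closed[OF arcD(4)[OF assms(1)]] egrp_swap[OF assms(1)] assms(2) by simp

text \<open>
  A representation of the groupoid of paths, given by operators \<open>\<alpha> v x\<close> for the elements \<open>x\<close> of the
  vertex groups and \<open>\<phi> e\<close> for the edges, is transported to the base point of \<open>S\<close> along paths in \<open>S\<close>.
\<close>

lemma representation:
  fixes \<alpha> :: "'v \<Rightarrow> 'g \<Rightarrow> 'k \<Rightarrow> 'k" and \<phi> :: "'v \<times> 'v \<Rightarrow> 'k \<Rightarrow> 'k"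
  assumes \<alpha>_one: "\<And>v. v \<in> bverts \<Longrightarrow> \<alpha> v \<one>\<^bsub>vgrp \<G> v\<^esub> = id"
    and \<alpha>_mult: "\<And>v x y. \<lbrakk>v \<in> bverts; x \<in> vcar v; y \<in> vcar v\<rbrakk> \<Longrightarrow>
      \<alpha> v (x \<otimes>\<^bsub>vgrp \<G> v\<^esub> y) = \<alpha> v x \<circ> \<alpha> v y"
    and \<phi>_swap: "\<And>e. e \<in> barcs \<Longrightarrow> \<phi> e \<circ> \<phi> (prod.swap e) = id"
    and \<phi>_edge: "\<And>e c. \<lbrakk>e \<in> barcs; c \<in> ecar e\<rbrakk> \<Longrightarrow>
      \<phi> e \<circ> \<alpha> (snd e) (emb \<G> e c) \<circ> \<phi> (prod.swap e) = \<alpha> (fst e) (emb \<G> (prod.swap e) c)"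
  obtains \<rho> :: "('v, 'g) letter \<Rightarrow> 'k \<Rightarrow> 'k" and \<gamma> :: "'v \<Rightarrow> 'k \<Rightarrow> 'k" and path where
    "\<And>w w'. weq w w' \<Longrightarrow> composite \<rho> w = composite \<rho> w'"
    "\<And>v x. \<lbrakk>v \<in> bverts\<rbrakk> \<Longrightarrow> \<rho> (Vtx v x) \<circ> \<gamma> v = \<gamma> v \<circ> \<alpha> v x"
    "\<And>e. e \<in> barcs \<Longrightarrow> \<rho> (Arc e) \<circ> \<gamma> (snd e) = \<gamma> (fst e) \<circ> \<phi> e"
    "\<And>v. v \<in> bverts \<Longrightarrow> bij (\<gamma> v)"
    "\<And>v. v \<in> bverts \<Longrightarrow> \<gamma> v = composite \<phi> (path v) \<and> set (path v) \<subseteq> parcs S"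
proof -
  obtain path where path: "\<And>v. v \<in> bverts \<Longrightarrow> set (path v) \<subseteq> parcs S"
    and pot: "\<And>(\<phi> :: 'v \<times> 'v \<Rightarrow> 'k \<Rightarrow> 'k) e. \<lbrakk>\<And>e. e \<in> parcs S \<Longrightarrow> \<phi> e \<circ> \<phi> (prod.swap e) = id; e \<in> parcs S\<rbrakk>
      \<Longrightarrow> composite \<phi> (path (snd e)) = composite \<phi> (path (fst e)) \<circ> \<phi> e"
    using tree_potential by metis
  define \<gamma> where "\<gamma> v = composite \<phi> (path v)" for v
  have \<phi>_bij: "bij (\<phi> e)" if "e \<in> barcs" for e
    using \<phi>_swap[OF that] \<phi>_swap[OF arcD(4)[OF that]] by (intro o_bij) auto
  have "bij (composite \<phi> p)" if "set p \<subseteq> parcs S" for p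
    using that
  proof (induction p)
    case (Cons e p)
    then show ?case unfolding composite.simps
      by (intro bij_comp) (use \<phi>_bij[OF subsetD[OF S_arcs, of e]] in auto)
  qed simp
  hence \<gamma>_bij: "bij (\<gamma> v)" if "v \<in> bverts" for v unfolding \<gamma>_def using path that by blast
  have \<gamma>_S: "\<gamma> (snd e) = \<gamma> (fst e) \<circ> \<phi> e" if "e \<in> parcs S" for e
    unfolding \<gamma>_def using pot[of \<phi> e] \<phi>_swap S_arcs that by blast
  \<comment> \<open>Each operator is conjugated by the transports of its ends. On an edge of
    \<open>S\<close>, \<open>\<gamma>_S\<close> turns the result into the identity, as
    \<open>tree_arc\<close> demands.\<close>
  define \<rho> where "\<rho> = (\<lambda>a. case a of Vtx v x \<Rightarrow> \<gamma> v \<circ> \<alpha> v x \<circ> inv_into UNIV (\<gamma> v)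
    | Arc e \<Rightarrow> \<gamma> (fst e) \<circ> \<phi> e \<circ> inv_into UNIV (\<gamma> (snd e)))"
  have \<rho>: "\<rho> (Vtx v x) = \<gamma> v \<circ> \<alpha> v x \<circ> inv_into UNIV (\<gamma> v)"
    "\<rho> (Arc e) = \<gamma> (fst e) \<circ> \<phi> e \<circ> inv_into UNIV (\<gamma> (snd e))" for v x e
    unfolding \<rho>_def by auto
  have inv: "inv_into UNIV (\<gamma> v) \<circ> \<gamma> v = id" "\<gamma> v \<circ> inv_into UNIV (\<gamma> v) = id"
    if "v \<in> bverts" for v
    using \<gamma>_bij[OF that] by (auto simp: bij_def surj_iff)
  have inv': "inv_into UNIV (\<gamma> v) (\<gamma> v z) = z" "\<gamma> v (inv_into UNIV (\<gamma> v) z) = z"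
    if "v \<in> bverts" for v z
    using inv[OF that] by (metis comp_apply id_apply)+
  have sw: "\<phi> e (\<phi> (prod.swap e) z) = z" if "e \<in> barcs" for e z
    using \<phi>_swap[OF that] by (metis comp_apply id_apply)
  show ?thesis
  proof
    show "composite \<rho> w = composite \<rho> w'" if "weq w w'" for w w'
      using that
    proof induction
      case (congruence w w' a b)
      then show ?case by (simp add: composite_append)
    next
      case (vertex_one v)
      then show ?case using \<alpha>_one inv by (simp add: \<rho>)
    next
      case (vertex_mult v x y)
      then show ?case using \<alpha>_mult inv' by (simp add: \<rho> fun_eq_iff)
    next
      case (arc_inverse e)
      then show ?case using arcD sw inv' by (simp add: \<rho> fun_eq_iff)
    next
      case (edge_relation e c)
      have "\<phi> e (\<alpha> (snd e) (emb \<G> e c) (\<phi> (prod.swap e) z)) = \<alpha> (fst e) (emb \<G> (prod.swap e) c) z" for z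
        using \<phi>_edge[OF edge_relation] by (metis comp_apply)
      then show ?case using arcD[OF edge_relation(1)] inv' by (simp add: \<rho> fun_eq_iff)
    next
      case (tree_arc e)
      then show ?case
        using inv(2)[OF arcD(2)[OF tree_arc(2)]] by (simp add: \<rho> \<gamma>_S[OF tree_arc(1), symmetric])
    qed auto
    show "\<rho> (Vtx v x) \<circ> \<gamma> v = \<gamma> v \<circ> \<alpha> v x" if "v \<in> bverts" for v x
      using inv[OF that] by (simp add: \<rho> comp_assoc)
    show "\<rho> (Arc e) \<circ> \<gamma> (snd e) = \<gamma> (fst e) \<circ> \<phi> e" if "e \<in> barcs" for e
      using inv arcD(2)[OF that] by (simp add: \<rho> comp_assoc)
    show "bij (\<gamma> v)" if "v \<in> bverts" for v using \<gamma>_bij that .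
    show "\<gamma> v = composite \<phi> (path v) \<and> set (path v) \<subseteq> parcs S" if "v \<in> bverts" for v
      using path[OF that] \<gamma>_def by blast
  qed
qed

section \<open>The group structure on classes of words\<close>

lemma word_eq_words: "weq w w' \<Longrightarrow> w \<in> words \<and> w' \<in> words"
proof (induction rule: word_eq.induct)
  case (vertex_one v)
  then show ?case using group_vgrp group.is_monoid monoid.one_closed by fastforce
next
  case (vertex_mult v x y)
  then show ?case using group_vgrp group.is_monoid monoid.m_closed by fastforce
next
  case (edge_relation e c)
  then show ?case using arcD emb_closed emb_swap_closed by auto
qed (use arcD in auto)

lemma cls_eq_iff: "w \<in> words \<Longrightarrow> cls w = cls w' \<longleftrightarrow> weq w w'"
  unfolding word_class_def using word_eq.refl word_eq.sym word_eq.trans by blast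

lemma cls_eqI: "weq w w' \<Longrightarrow> cls w = cls w'"
  using cls_eq_iff word_eq_words by blast

lemma word_eq_append:
  assumes "weq x x'" "weq y y'"
  shows "weq (x @ y) (x' @ y')"
proof -
  have w: "x \<in> words" "x' \<in> words" "y \<in> words" "y' \<in> words" using assms word_eq_words by auto
  have "weq (x @ y) (x' @ y)" using word_eq.congruence[OF assms(1), of "[]" y] w by simp
  moreover have "weq (x' @ y) (x' @ y')" using word_eq.congruence[OF assms(2), of x' "[]"] w by simp
  ultimately show ?thesis by (rule word_eq.trans)
qed

lemma cls_mult:
  assumes "x \<in> words" "y \<in> words"
  shows "cls x \<cdot> cls y = cls (x @ y)"
proof -
  have "(\<Union>x'\<in>cls x. \<Union>y'\<in>cls y. cls (x' @ y')) = (\<Union>x'\<in>cls x. \<Union>y'\<in>cls y. cls (x @ y))"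
    using cls_eqI[OF word_eq_append] unfolding word_class_def by (intro SUP_cong refl) auto
  also have "\<dots> = cls (x @ y)"
    using word_eq.refl[OF assms(1)] word_eq.refl[OF assms(2)] unfolding word_class_def by auto
  finally show ?thesis unfolding fundamental_group_def by simp
qed

lemma cls_closed: "w \<in> words \<Longrightarrow> cls w \<in> GG"
  unfolding fundamental_group_def by simp

lemma one_cls: "\<^bold>1 = cls []"
  unfolding fundamental_group_def by simp

lemma carrier_cls:
  assumes "g \<in> GG" obtains w where "w \<in> words" "g = cls w"
  using assms unfolding fundamental_group_def by auto

lemma letter_inverse:
  assumes "a \<in> letters \<G>"
  shows "\<exists>b\<in>letters \<G>. weq [b, a] []"
proof (cases a)
  case (Vtx v x)
  hence v: "v \<in> bverts" "x \<in> vcar v" using assms by auto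
  interpret K: group "vgrp \<G> v" by (rule group_vgrp[OF v(1)])
  have "weq [Vtx v (inv\<^bsub>vgrp \<G> v\<^esub> x), Vtx v x] [Vtx v (inv\<^bsub>vgrp \<G> v\<^esub> x \<otimes>\<^bsub>vgrp \<G> v\<^esub> x)]"
    by (intro word_eq.vertex_mult K.inv_closed v)
  hence "weq [Vtx v (inv\<^bsub>vgrp \<G> v\<^esub> x), Vtx v x] []"
    unfolding K.l_inv[OF v(2)] by (rule word_eq.trans) (rule word_eq.vertex_one[OF v(1)])
  thus ?thesis unfolding Vtx
    by (rule bexI[of _ "Vtx v (inv\<^bsub>vgrp \<G> v\<^esub> x)"]) (simp add: v)
next
  case (Arc e)
  hence e: "prod.swap e \<in> barcs" using assms arcD by auto
  hence "weq [Arc (prod.swap e), Arc (prod.swap (prod.swap e))] []" by (rule word_eq.arc_inverse)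
  thus ?thesis using Arc e by (intro bexI[of _ "Arc (prod.swap e)"]) simp_all
qed

lemma word_inverse:
  assumes "w \<in> words"
  shows "\<exists>w'\<in>words. weq (w' @ w) []"
  using assms
proof (induction w)
  case Nil
  then show ?case using word_eq.refl[of "[]"] by auto
next
  case (Cons a w)
  then obtain w' b where w': "w' \<in> words" "weq (w' @ w) []" "b \<in> letters \<G>" "weq [b, a] []"
    using letter_inverse[of a] by force
  have "weq (w' @ [b, a] @ w) (w' @ [] @ w)" using word_eq.congruence w' Cons by blast
  hence "weq ((w' @ [b]) @ (a # w)) []" using word_eq.trans w'(2) by simp
  thus ?case by (rule bexI[of _ "w' @ [b]"]) (use w' in simp)
qed

lemma pi1_group: "group pi1"
proof (rule groupI)
  show "\<^bold>1 \<in> GG" unfolding one_cls by (rule cls_closed) simp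
  fix x assume "x \<in> GG"
  then obtain a where a: "a \<in> words" "x = cls a" by (rule carrier_cls)
  show "\<^bold>1 \<cdot> x = x" using a cls_mult[of "[]" a] by (simp add: one_cls)
  obtain a' where "a' \<in> words" "weq (a' @ a) []" using word_inverse a by blast
  hence "cls a' \<in> GG" "cls a' \<cdot> x = \<^bold>1"
    using cls_closed cls_mult cls_eqI a one_cls by auto
  thus "\<exists>y\<in>GG. y \<cdot> x = \<^bold>1" by blast
  fix y assume "y \<in> GG"
  then obtain b where b: "b \<in> words" "y = cls b" by (rule carrier_cls)
  show "x \<cdot> y \<in> GG" using a b cls_mult cls_closed by simp
  fix z assume "z \<in> GG"
  then obtain c where c: "c \<in> words" "z = cls c" by (rule carrier_cls)
  show "x \<cdot> y \<cdot> z = x \<cdot> (y \<cdot> z)" using a b c by (simp add: cls_mult)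
qed

end

section \<open>The vertex groups embed\<close>

lemma (in group) transversal:
  assumes "subgroup B G"
  obtains Tr where "Tr \<subseteq> carrier G" "Tr \<noteq> {}" "bij_betw (\<lambda>(b, t). b \<otimes> t) (B \<times> Tr) (carrier G)"
proof -
  have BG: "B \<subseteq> carrier G" using subgroup.subset assms .
  \<comment> \<open>The choice depends on the coset only, so equal cosets get equal
    representatives.\<close>
  define rep where "rep y = (SOME t. t \<in> B #> y)" for y
  define Tr where "Tr = rep ` carrier G"
  have rep: "rep y \<in> B #> y" if "y \<in> carrier G" for y
    unfolding rep_def using rcos_self[OF that assms] by (rule someI)
  have repG: "rep y \<in> carrier G" if "y \<in> carrier G" for y
    using r_coset_subset_G[OF BG that] rep[OF that] by blast
  have coset: "B #> rep y = B #> y" if "y \<in> carrier G" for y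
    using repr_independence[OF rep[OF that] that assms] by simp
  have idem: "rep (rep y) = rep y" if "y \<in> carrier G" for y
    using coset[OF that] unfolding rep_def[of "rep y"] by (simp add: rep_def)
  have bt: "rep (b \<otimes> t) = t" if b: "b \<in> B" and t: "t \<in> Tr" for b t
  proof -
    obtain y where y: "y \<in> carrier G" "t = rep y" using t unfolding Tr_def by blast
    have tG: "t \<in> carrier G" using y repG by blast
    have "b \<otimes> t \<in> B #> t" using b unfolding r_coset_def by blast
    hence "B #> (b \<otimes> t) = B #> t" using repr_independence[OF _ tG assms] by simp
    hence "rep (b \<otimes> t) = rep t" unfolding rep_def by simp
    thus ?thesis using idem y by simp
  qed
  show ?thesis
  proof
    show TG: "Tr \<subseteq> carrier G" unfolding Tr_def using repG by blast
    show "Tr \<noteq> {}" unfolding Tr_def by blast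
    show "bij_betw (\<lambda>(b, t). b \<otimes> t) (B \<times> Tr) (carrier G)"
      unfolding bij_betw_def
    proof
      show "inj_on (\<lambda>(b, t). b \<otimes> t) (B \<times> Tr)"
      proof (rule inj_onI, clarify)
        fix b t b' t' assume *: "b \<in> B" "t \<in> Tr" "b' \<in> B" "t' \<in> Tr" "b \<otimes> t = b' \<otimes> t'"
        hence "t = t'" using bt by metis
        thus "b = b' \<and> t = t'" using * BG TG by (metis right_cancel subsetD)
      qed
      show "(\<lambda>(b, t). b \<otimes> t) ` (B \<times> Tr) = carrier G"
      proof
        show "(\<lambda>(b, t). b \<otimes> t) ` (B \<times> Tr) \<subseteq> carrier G" using BG TG by auto
        show "carrier G \<subseteq> (\<lambda>(b, t). b \<otimes> t) ` (B \<times> Tr)"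
        proof
          fix y assume y: "y \<in> carrier G"
          have "y \<in> B #> rep y" using coset[OF y] rcos_self[OF y assms] by simp
          then obtain b where "b \<in> B" "y = b \<otimes> rep y" unfolding r_coset_def by blast
          moreover have "rep y \<in> Tr" using y unfolding Tr_def by blast
          ultimately show "y \<in> (\<lambda>(b, t). b \<otimes> t) ` (B \<times> Tr)" by (intro image_eqI[of _ _ "(b, rep y)"]) auto
        qed
      qed
    qed
  qed
qed

text \<open>The factor \<open>nat\<close> makes the set infinite even over a finite type, so
  multiplication by a nonempty set of no larger cardinality does not change its size. Hence one set
  serves all vertex groups.\<close>

lemma infinite_absorbs:
  fixes A :: "'a set"
  assumes "A \<noteq> {}"
  obtains q :: "('a \<times> nat) \<Rightarrow> 'a \<times> ('a \<times> nat)" where "bij_betw q UNIV (A \<times> UNIV)"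
proof -
  have inf: "infinite (UNIV :: ('a \<times> nat) set)" by (simp add: finite_prod)
  have le: "(card_of A, card_of (UNIV :: ('a \<times> nat) set)) \<in> ordLeq"
    by (rule card_of_ordLeqI[of "\<lambda>t. (t, 0)"]) (auto simp: inj_on_def)
  have "(card_of (A \<times> (UNIV :: ('a \<times> nat) set)), card_of (UNIV :: ('a \<times> nat) set)) \<in> ordIso"
    using card_of_Times_infinite[OF inf assms le] by (rule conjunct2)
  hence "(card_of (UNIV :: ('a \<times> nat) set), card_of (A \<times> (UNIV :: ('a \<times> nat) set))) \<in> ordIso"
    by (rule ordIso_symmetric)
  hence "\<exists>q :: 'a \<times> nat \<Rightarrow> 'a \<times> ('a \<times> nat). bij_betw q UNIV (A \<times> UNIV)"
    unfolding card_of_ordIso .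
  thus ?thesis by (elim exE) (rule that)
qed

text \<open>Under the action of \<open>E\<close> through \<open>j\<close>, \<open>G\<close> is
  \<open>E\<close> times a transversal, and \<open>absorb\<close> swallows the transversal into the
  infinite factor. The resulting model depends on \<open>E\<close> only, which lets the two ends of
  an edge be matched.\<close>

lemma (in group) free_extension:
  fixes E :: "('h, 'z) monoid_scheme" and b :: "'a \<times> 'k \<Rightarrow> 'k"
  assumes E: "group E" and j: "j \<in> hom E G" "inj_on j (carrier E)"
    and b: "bij_betw b (carrier G \<times> UNIV) UNIV"
    and absorb: "\<And>A :: 'a set. A \<noteq> {} \<Longrightarrow> \<exists>q :: 'k \<Rightarrow> 'a \<times> 'k. bij_betw q UNIV (A \<times> UNIV)"
  obtains A :: "'h \<times> 'k \<Rightarrow> 'k" where "bij_betw A (carrier E \<times> UNIV) UNIV"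
    "\<And>c c' k. \<lbrakk>c \<in> carrier E; c' \<in> carrier E\<rbrakk> \<Longrightarrow>
      \<exists>y\<in>carrier G. \<exists>l. A (c', k) = b (y, l) \<and> A (c \<otimes>\<^bsub>E\<^esub> c', k) = b (j c \<otimes> y, l)"
proof -
  interpret E: group E by fact
  interpret j: group_hom E G j using j(1) by unfold_locales
  have B: "subgroup (j ` carrier E) G" using j.img_is_subgroup .
  obtain Tr where Tr: "Tr \<subseteq> carrier G" "Tr \<noteq> {}"
    "bij_betw (\<lambda>(b, t). b \<otimes> t) (j ` carrier E \<times> Tr) (carrier G)" using transversal[OF B] .
  obtain q :: "'k \<Rightarrow> 'a \<times> 'k" where q: "bij_betw q UNIV (Tr \<times> UNIV)" using absorb[OF Tr(2)] by blast
  define A where "A = (\<lambda>(c, k). b (j c \<otimes> fst (q k), snd (q k)))"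
  have qTr: "fst (q k) \<in> Tr" for k using q unfolding bij_betw_def by (metis mem_Times_iff rangeI)
  hence qG: "fst (q k) \<in> carrier G" for k using Tr(1) by blast
  show ?thesis
  proof
    show "bij_betw A (carrier E \<times> UNIV) UNIV"
      unfolding bij_betw_def
    proof
      show "inj_on A (carrier E \<times> UNIV)"
      proof (rule inj_onI, clarify)
        fix c k c' k' assume c: "c \<in> carrier E" "c' \<in> carrier E" "A (c, k) = A (c', k')"
        have "(j c \<otimes> fst (q k), snd (q k)) \<in> carrier G \<times> UNIV"
          "(j c' \<otimes> fst (q k'), snd (q k')) \<in> carrier G \<times> UNIV" using c qG by auto
        hence "(j c \<otimes> fst (q k), snd (q k)) = (j c' \<otimes> fst (q k'), snd (q k'))"
          using c(3) unfolding A_def by (intro inj_onD[OF bij_betw_imp_inj_on[OF b]]) simp_all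
        hence eq: "j c \<otimes> fst (q k) = j c' \<otimes> fst (q k')" "snd (q k) = snd (q k')" by simp_all
        have "(j c, fst (q k)) = (j c', fst (q k'))"
          using inj_onD[OF bij_betw_imp_inj_on[OF Tr(3)], of "(j c, fst (q k))" "(j c', fst (q k'))"] eq c qTr by auto
        hence "c = c'" "q k = q k'" using inj_onD[OF j(2) _ c(1,2)] eq(2) by (auto intro: prod_eqI)
        thus "c = c' \<and> k = k'" using inj_onD[OF bij_betw_imp_inj_on[OF q]] by blast
      qed
      show "A ` (carrier E \<times> UNIV) = UNIV"
      proof (rule subset_antisym[OF subset_UNIV], rule subsetI)
        fix z
        obtain y l where y: "y \<in> carrier G" "z = b (y, l)"
          using b unfolding bij_betw_def by (metis (no_types, lifting) SigmaE UNIV_I imageE)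
        obtain c t where c: "c \<in> carrier E" "t \<in> Tr" "y = j c \<otimes> t"
        proof -
          have "y \<in> (\<lambda>(b, t). b \<otimes> t) ` (j ` carrier E \<times> Tr)"
            using bij_betw_imp_surj_on[OF Tr(3)] y(1) by simp
          thus ?thesis using that by force
        qed
        obtain k where "q k = (t, l)" using q c(2) unfolding bij_betw_def by (metis SigmaI UNIV_I imageE)
        hence "A (c, k) = z" unfolding A_def using c y by simp
        thus "z \<in> A ` (carrier E \<times> UNIV)" using c(1) by blast
      qed
    qed
    show "\<exists>y\<in>carrier G. \<exists>l. A (c', k) = b (y, l) \<and> A (c \<otimes>\<^bsub>E\<^esub> c', k) = b (j c \<otimes> y, l)"
      if "c \<in> carrier E" "c' \<in> carrier E" for c c' k
    proof (intro bexI exI conjI)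
      show "A (c', k) = b (j c' \<otimes> fst (q k), snd (q k))" unfolding A_def by simp
      show "A (c \<otimes>\<^bsub>E\<^esub> c', k) = b (j c \<otimes> (j c' \<otimes> fst (q k)), snd (q k))"
        unfolding A_def using that qG by (simp add: m_assoc)
      show "j c' \<otimes> fst (q k) \<in> carrier G" using that qG by simp
    qed
  qed
qed

context based_graph_of_groups begin

text \<open>
  Each vertex group acts freely, by left multiplication on the first factor, on the product of its
  carrier with one fixed infinite set, which is in bijection with that infinite set. As \<open>G\<^sub>e\<close>-sets, the
  sets belonging to the two ends of an edge \<open>e\<close> are then isomorphic.
\<close>

lemma vertex_map_inj:
  assumes v: "v \<in> bverts"
  shows "inj_on (vmap v) (vcar v)"
proof -
  have ex_b: "\<exists>b :: 'g \<times> ('g \<times> nat) \<Rightarrow> 'g \<times> nat. bij_betw b (vcar u \<times> UNIV) UNIV"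
    if "u \<in> bverts" for u
  proof -
    have "vcar u \<noteq> {}" using group.is_monoid[OF group_vgrp[OF that]] monoid.one_closed by blast
    thus ?thesis using infinite_absorbs[of "vcar u"] bij_betw_inv_into by metis
  qed
  then obtain b :: "'v \<Rightarrow> 'g \<times> ('g \<times> nat) \<Rightarrow> 'g \<times> nat" where
    b: "\<And>u. u \<in> bverts \<Longrightarrow> bij_betw (b u) (vcar u \<times> UNIV) UNIV" by metis
  have "\<exists>A :: 'h \<times> ('g \<times> nat) \<Rightarrow> 'g \<times> nat. bij_betw A (ecar e \<times> UNIV) UNIV \<and>
      (\<forall>c\<in>ecar e. \<forall>c'\<in>ecar e. \<forall>k. \<exists>y\<in>vcar (snd e). \<exists>l.
        A (c', k) = b (snd e) (y, l) \<and>
        A (c \<otimes>\<^bsub>egrp \<G> e\<^esub> c', k) = b (snd e) (emb \<G> e c \<otimes>\<^bsub>vgrp \<G> (snd e)\<^esub> y, l))"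
    if e: "e \<in> barcs" for e
  proof -
    obtain A :: "'h \<times> ('g \<times> nat) \<Rightarrow> 'g \<times> nat" where "bij_betw A (ecar e \<times> UNIV) UNIV"
      "\<And>c c' k. \<lbrakk>c \<in> ecar e; c' \<in> ecar e\<rbrakk> \<Longrightarrow>
        \<exists>y\<in>vcar (snd e). \<exists>l. A (c', k) = b (snd e) (y, l) \<and>
        A (c \<otimes>\<^bsub>egrp \<G> e\<^esub> c', k) = b (snd e) (emb \<G> e c \<otimes>\<^bsub>vgrp \<G> (snd e)\<^esub> y, l)"
      using group.free_extension[OF group_vgrp[OF arcD(2)[OF e]] group_egrp[OF e] emb_hom[OF e] emb_inj[OF e] b[OF arcD(2)[OF e]]]
        infinite_absorbs by metis
    thus ?thesis by blast
  qed
  then obtain A :: "'v \<times> 'v \<Rightarrow> 'h \<times> ('g \<times> nat) \<Rightarrow> 'g \<times> nat" where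
    A: "\<And>e. e \<in> barcs \<Longrightarrow> bij_betw (A e) (ecar e \<times> UNIV) UNIV" and
    Ab: "\<And>e c c' k. \<lbrakk>e \<in> barcs; c \<in> ecar e; c' \<in> ecar e\<rbrakk> \<Longrightarrow>
      \<exists>y\<in>vcar (snd e). \<exists>l. A e (c', k) = b (snd e) (y, l) \<and>
        A e (c \<otimes>\<^bsub>egrp \<G> e\<^esub> c', k) = b (snd e) (emb \<G> e c \<otimes>\<^bsub>vgrp \<G> (snd e)\<^esub> y, l)"
    by metis
  define \<alpha> where "\<alpha> u x z = (case inv_into (vcar u \<times> UNIV) (b u) z of
    (y, l) \<Rightarrow> b u (x \<otimes>\<^bsub>vgrp \<G> u\<^esub> y, l))" for u x z
  \<comment> \<open>\<open>A e\<close> describes the action of the edge group at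
    \<open>snd e\<close> in coordinates on the edge group itself. So \<open>\<phi> e\<close>
    intertwines its actions at \<open>snd e\<close> and at \<open>fst e\<close>.\<close>
  define \<phi> where "\<phi> e z = A (prod.swap e) (inv_into (ecar e \<times> UNIV) (A e) z)" for e z
  have \<alpha>: "\<alpha> u x (b u (y, l)) = b u (x \<otimes>\<^bsub>vgrp \<G> u\<^esub> y, l)"
    if "u \<in> bverts" "y \<in> vcar u" for u x y l
    unfolding \<alpha>_def using bij_betw_inv_into_left[OF b[OF that(1)]] that(2) by simp
  have \<phi>: "\<phi> e (A e (c, k)) = A (prod.swap e) (c, k)"
    if "e \<in> barcs" "c \<in> ecar e" for e c k
    unfolding \<phi>_def using bij_betw_inv_into_left[OF A[OF that(1)]] that(2) by simp
  have b_ex: "\<exists>y\<in>vcar u. \<exists>l. z = b u (y, l)" if "u \<in> bverts" for u z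
  proof -
    have "z \<in> b u ` (vcar u \<times> UNIV)" using b[OF that] unfolding bij_betw_def by simp
    thus ?thesis by auto
  qed
  have A_ex: "\<exists>c\<in>ecar e. \<exists>k. z = A (prod.swap e) (c, k)" if e: "e \<in> barcs" for e z
  proof -
    have "z \<in> A (prod.swap e) ` (ecar e \<times> UNIV)"
      using A[OF arcD(4)[OF e]] egrp_swap[OF e] unfolding bij_betw_def by simp
    thus ?thesis by auto
  qed
  have \<phi>': "\<phi> (prod.swap e) (A (prod.swap e) (c, k)) = A e (c, k)"
    if "e \<in> barcs" "c \<in> ecar e" for e c k
    using \<phi>[OF arcD(4)[OF that(1)], of c k] egrp_swap[OF that(1)] that(2) by simp
  obtain \<rho> :: "('v, 'g) letter \<Rightarrow> 'g \<times> nat \<Rightarrow> 'g \<times> nat" and \<gamma> :: "'v \<Rightarrow> 'g \<times> nat \<Rightarrow> 'g \<times> nat" where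
    \<rho>: "\<And>w w'. weq w w' \<Longrightarrow> composite \<rho> w = composite \<rho> w'"
      "\<And>v x. v \<in> bverts \<Longrightarrow> \<rho> (Vtx v x) \<circ> \<gamma> v = \<gamma> v \<circ> \<alpha> v x"
      "\<And>v. v \<in> bverts \<Longrightarrow> bij (\<gamma> v)"
  proof (rule representation[of \<alpha> \<phi>])
    show "\<alpha> u \<one>\<^bsub>vgrp \<G> u\<^esub> = id" if u: "u \<in> bverts" for u
    proof
      fix z
      interpret K: group "vgrp \<G> u" by (rule group_vgrp[OF u])
      obtain y l where "y \<in> vcar u" "z = b u (y, l)" using b_ex[OF u] by blast
      thus "\<alpha> u \<one>\<^bsub>vgrp \<G> u\<^esub> z = id z" using \<alpha>[OF u] by simp
    qed
    show "\<alpha> u (x \<otimes>\<^bsub>vgrp \<G> u\<^esub> x') = \<alpha> u x \<circ> \<alpha> u x'"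
      if u: "u \<in> bverts" and x: "x \<in> vcar u" "x' \<in> vcar u" for u x x'
    proof
      fix z
      interpret K: group "vgrp \<G> u" by (rule group_vgrp[OF u])
      obtain y l where "y \<in> vcar u" "z = b u (y, l)" using b_ex[OF u] by blast
      thus "\<alpha> u (x \<otimes>\<^bsub>vgrp \<G> u\<^esub> x') z = (\<alpha> u x \<circ> \<alpha> u x') z" using \<alpha>[OF u] x by (simp add: K.m_assoc)
    qed
    show "\<phi> e \<circ> \<phi> (prod.swap e) = id" if e: "e \<in> barcs" for e
    proof
      fix z
      obtain c k where "c \<in> ecar e" "z = A (prod.swap e) (c, k)" using A_ex[OF e] by blast
      thus "(\<phi> e \<circ> \<phi> (prod.swap e)) z = id z" using \<phi>[OF e] \<phi>'[OF e] by simp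
    qed
    show "\<phi> e \<circ> \<alpha> (snd e) (emb \<G> e c) \<circ> \<phi> (prod.swap e) = \<alpha> (fst e) (emb \<G> (prod.swap e) c)"
      if e: "e \<in> barcs" and c: "c \<in> ecar e" for e c
    proof
      fix z
      interpret E: group "egrp \<G> e" by (rule group_egrp[OF e])
      note e' = arcD(4)[OF e]
      obtain c' k where c': "c' \<in> ecar e" "z = A (prod.swap e) (c', k)" using A_ex[OF e] by blast
      obtain y l where y: "y \<in> vcar (snd e)" "A e (c', k) = b (snd e) (y, l)"
        "A e (c \<otimes>\<^bsub>egrp \<G> e\<^esub> c', k) = b (snd e) (emb \<G> e c \<otimes>\<^bsub>vgrp \<G> (snd e)\<^esub> y, l)"
        using Ab[OF e c c'(1)] by blast
      obtain y' l' where y': "y' \<in> vcar (fst e)" "A (prod.swap e) (c', k) = b (fst e) (y', l')"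
        "A (prod.swap e) (c \<otimes>\<^bsub>egrp \<G> e\<^esub> c', k) =
          b (fst e) (emb \<G> (prod.swap e) c \<otimes>\<^bsub>vgrp \<G> (fst e)\<^esub> y', l')"
        using Ab[OF e', of c c' k] egrp_swap[OF e] c c'(1) by auto
      have "\<alpha> (snd e) (emb \<G> e c) (\<phi> (prod.swap e) z) = A e (c \<otimes>\<^bsub>egrp \<G> e\<^esub> c', k)"
        using \<phi>'[OF e c'(1)] \<alpha>[OF arcD(2)[OF e] y(1)] y c' by simp
      hence "(\<phi> e \<circ> \<alpha> (snd e) (emb \<G> e c) \<circ> \<phi> (prod.swap e)) z = A (prod.swap e) (c \<otimes>\<^bsub>egrp \<G> e\<^esub> c', k)"
        using \<phi>[OF e, of "c \<otimes>\<^bsub>egrp \<G> e\<^esub> c'" k] c c' by simp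
      thus "(\<phi> e \<circ> \<alpha> (snd e) (emb \<G> e c) \<circ> \<phi> (prod.swap e)) z = \<alpha> (fst e) (emb \<G> (prod.swap e) c) z"
        using \<alpha>[OF arcD(1)[OF e] y'(1)] y' c' by simp
    qed
  qed (rule that)
  interpret K: group "vgrp \<G> v" by (rule group_vgrp[OF v])
  show ?thesis
  proof (rule inj_onI)
    fix x y assume x: "x \<in> vcar v" and y: "y \<in> vcar v"
      and eq: "vmap v x = vmap v y"
    have "weq [Vtx v x] [Vtx v y]"
      using eq cls_eq_iff[of "[Vtx v x]"] v x unfolding vertex_map_def by simp
    hence "\<rho> (Vtx v x) = \<rho> (Vtx v y)" using \<rho>(1)[of "[Vtx v x]" "[Vtx v y]"] by simp
    hence "\<gamma> v \<circ> \<alpha> v x = \<gamma> v \<circ> \<alpha> v y" using \<rho>(2)[OF v, symmetric] by simp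
    hence "\<gamma> v (\<alpha> v x z) = \<gamma> v (\<alpha> v y z)" for z by (metis comp_apply)
    hence "\<alpha> v x z = \<alpha> v y z" for z using \<rho>(3)[OF v] by (metis bij_pointE)
    \<comment> \<open>At a point with first coordinate one the action reads off the group element;
      \<open>undefined\<close> is an arbitrary second coordinate.\<close>
    from this[of "b v (\<one>\<^bsub>vgrp \<G> v\<^esub>, undefined)"]
    have "b v (x, undefined) = b v (y, undefined)" using \<alpha>[OF v K.one_closed] x y by simp
    hence "(x, undefined :: 'g \<times> nat) = (y, undefined)"
      using inj_onD[OF bij_betw_imp_inj_on[OF b[OF v]]] x y by blast
    thus "x = y" by simp
  qed
qed

section \<open>The Bass--Serre tree\<close>

sublocale pi: group pi1 by (rule pi1_group)

lemma vertex_map_closed: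
  "\<lbrakk>v \<in> bverts; x \<in> vcar v\<rbrakk> \<Longrightarrow> vmap v x \<in> GG"
  unfolding vertex_map_def by (rule cls_closed) simp

lemma vertex_map_hom:
  assumes "v \<in> bverts"
  shows "vmap v \<in> hom (vgrp \<G> v) pi1"
proof (rule homI)
  fix x y assume xy: "x \<in> vcar v" "y \<in> vcar v"
  show "vmap v x \<in> GG" using vertex_map_closed assms xy by blast
  have "vmap v x \<cdot> vmap v y = cls [Vtx v x, Vtx v y]"
    unfolding vertex_map_def using cls_mult[of "[Vtx v x]" "[Vtx v y]"] assms xy by simp
  also have "\<dots> = cls [Vtx v (x \<otimes>\<^bsub>vgrp \<G> v\<^esub> y)]"
    by (rule cls_eqI[OF word_eq.vertex_mult[OF assms xy]])
  finally show "vmap v (x \<otimes>\<^bsub>vgrp \<G> v\<^esub> y) = vmap v x \<cdot> vmap v y"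
    unfolding vertex_map_def by simp
qed

lemma vertex_group_hom: "v \<in> bverts \<Longrightarrow> group_hom (vgrp \<G> v) pi1 (vmap v)"
  unfolding group_hom_def group_hom_axioms_def using vertex_map_hom group_vgrp pi1_group by blast

lemma vertex_subgroup: "v \<in> bverts \<Longrightarrow> subgroup (stab v) pi1"
  using group_hom.img_is_subgroup[OF vertex_group_hom] .

section \<open>Vertices, adjacency and connectedness\<close>

definition vx where "vx v g = (v, g <#\<^bsub>pi1\<^esub> stab v)"

definition vertices where "vertices = {vx v g | v g. v \<in> bverts \<and> g \<in> GG}"

definition adj where
  "adj = {(vx (fst e) g, vx (snd e) (g \<cdot> st e)) | e g.
    e \<in> barcs \<and> g \<in> GG}"

lemma vx_vertices: "\<lbrakk>v \<in> bverts; g \<in> GG\<rbrakk> \<Longrightarrow> vx v g \<in> vertices"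
  unfolding vertices_def by blast

lemma stable_letter_closed: "e \<in> barcs \<Longrightarrow> st e \<in> GG"
  unfolding stable_letter_def by (rule cls_closed) simp

lemma stable_letter_swap:
  assumes "e \<in> barcs"
  shows "st e \<cdot> st (prod.swap e) = \<^bold>1"
  unfolding stable_letter_def one_cls
  using cls_mult[of "[Arc e]" "[Arc (prod.swap e)]"] cls_eqI[OF word_eq.arc_inverse[OF assms]] assms arcD(4)
  by simp

lemma stable_letter_tree: "e \<in> parcs S \<Longrightarrow> st e = \<^bold>1"
  unfolding stable_letter_def one_cls using cls_eqI[OF word_eq.tree_arc] S_arcs by blast

lemma stable_letter_edge:
  assumes e: "e \<in> barcs" and c: "c \<in> ecar e"
  shows "emap e c \<cdot> st e =
    st e \<cdot> vmap (snd e) (emb \<G> e c)"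
proof -
  let ?t = "st e" and ?t' = "st (prod.swap e)"
    and ?a = "vmap (snd e) (emb \<G> e c)"
  have cl: "?t \<in> GG" "?t' \<in> GG" "?a \<in> GG"
    using stable_letter_closed e arcD[OF e] vertex_map_closed emb_closed[OF e c] by auto
  have "emap e c = cls ([Arc e] @ [Vtx (snd e) (emb \<G> e c)] @ [Arc (prod.swap e)])"
    unfolding edge_map_def vertex_map_def using cls_eqI[OF word_eq.edge_relation[OF e c]] by simp
  also have "\<dots> = ?t \<cdot> (?a \<cdot> ?t')"
    unfolding stable_letter_def vertex_map_def using cls_mult e arcD[OF e] emb_closed[OF e c] by simp
  finally have "emap e c \<cdot> ?t = ?t \<cdot> (?a \<cdot> ?t') \<cdot> ?t" by simp
  also have "\<dots> = ?t \<cdot> (?a \<cdot> (?t' \<cdot> ?t))"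
    using cl by (simp add: pi.m_assoc)
  also have "?t' \<cdot> ?t = \<^bold>1" using stable_letter_swap[OF arcD(4)[OF e]] by simp
  finally show ?thesis using cl by simp
qed

lemma edge_subgroup_subset:
  "e \<in> barcs \<Longrightarrow> estab e \<subseteq> stab (fst e)"
  unfolding edge_map_def using emb_swap_closed by blast

lemma one_edge_subgroup:
  assumes "e \<in> barcs"
  shows "\<^bold>1 \<in> estab e"
proof -
  interpret E: group "egrp \<G> e" by (rule group_egrp[OF assms])
  interpret K: group "vgrp \<G> (fst e)" by (rule group_vgrp[OF arcD(1)[OF assms]])
  interpret h: group_hom "egrp \<G> e" "vgrp \<G> (fst e)" "emb \<G> (prod.swap e)"
    using emb_hom[OF arcD(4)[OF assms]] egrp_swap[OF assms] by unfold_locales simp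
  interpret k: group_hom "vgrp \<G> (fst e)" pi1 "vmap (fst e)"
    by (rule vertex_group_hom[OF arcD(1)[OF assms]])
  have "emap e \<one>\<^bsub>egrp \<G> e\<^esub> = \<^bold>1" unfolding edge_map_def by simp
  thus ?thesis using E.one_closed by (metis imageI)
qed

text \<open>By the last hypothesis \<open>K\<close> moves past \<open>t\<close> into
  \<open>B\<close>, so it disappears in the product. With an edge group as \<open>K\<close> this
  computes the ends of an arc: \<open>t\<close> is trivial at the tail and the stable letter at the
  head.\<close>

lemma coset_absorb:
  assumes "subgroup B pi1" "K \<subseteq> GG" "\<^bold>1 \<in> K" "t \<in> GG" "g \<in> GG"
    and "\<And>k. k \<in> K \<Longrightarrow> \<exists>b\<in>B. k \<cdot> t = t \<cdot> b"
  shows "(g <#\<^bsub>pi1\<^esub> K) <#>\<^bsub>pi1\<^esub> (t <#\<^bsub>pi1\<^esub> B) = (g \<cdot> t) <#\<^bsub>pi1\<^esub> B"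
proof
  have B: "B \<subseteq> GG" using subgroup.subset assms(1) .
  show "(g <#\<^bsub>pi1\<^esub> K) <#>\<^bsub>pi1\<^esub> (t <#\<^bsub>pi1\<^esub> B) \<subseteq> (g \<cdot> t) <#\<^bsub>pi1\<^esub> B"
  proof
    fix z assume "z \<in> (g <#\<^bsub>pi1\<^esub> K) <#>\<^bsub>pi1\<^esub> (t <#\<^bsub>pi1\<^esub> B)"
    then obtain k b where k: "k \<in> K" "b \<in> B" "z = (g \<cdot> k) \<cdot> (t \<cdot> b)"
      unfolding l_coset_def set_mult_def by blast
    obtain b' where b': "b' \<in> B" "k \<cdot> t = t \<cdot> b'" using assms(6)[OF k(1)] by blast
    have c: "k \<in> GG" "b \<in> GG" "b' \<in> GG" using k b' B assms(2) by auto
    have "z = g \<cdot> (k \<cdot> t) \<cdot> b" using k(3) c assms(4,5) by (simp add: pi.m_assoc)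
    also have "\<dots> = (g \<cdot> t) \<cdot> (b' \<cdot> b)" using b'(2) c assms(4,5) by (simp add: pi.m_assoc)
    finally show "z \<in> (g \<cdot> t) <#\<^bsub>pi1\<^esub> B"
      unfolding l_coset_def using subgroup.m_closed[OF assms(1) b'(1) k(2)] by blast
  qed
  show "(g \<cdot> t) <#\<^bsub>pi1\<^esub> B \<subseteq> (g <#\<^bsub>pi1\<^esub> K) <#>\<^bsub>pi1\<^esub> (t <#\<^bsub>pi1\<^esub> B)"
  proof
    fix z assume "z \<in> (g \<cdot> t) <#\<^bsub>pi1\<^esub> B"
    then obtain b where b: "b \<in> B" "z = g \<cdot> t \<cdot> b" unfolding l_coset_def by blast
    have "z = (g \<cdot> \<^bold>1) \<cdot> (t \<cdot> b)" using b B assms(4,5) by (auto simp: pi.m_assoc)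
    thus "z \<in> (g <#\<^bsub>pi1\<^esub> K) <#>\<^bsub>pi1\<^esub> (t <#\<^bsub>pi1\<^esub> B)"
      unfolding l_coset_def set_mult_def using b(1) assms(3) by blast
  qed
qed

lemma tail_head:
  assumes e: "e \<in> barcs" and g: "g \<in> GG"
  shows "tail BT (e, g <#\<^bsub>pi1\<^esub> estab e) = vx (fst e) g"
    and "head BT (e, g <#\<^bsub>pi1\<^esub> estab e) =
      vx (snd e) (g \<cdot> st e)"
proof -
  have V: "subgroup (stab (fst e)) pi1" "subgroup (stab (snd e)) pi1"
    using vertex_subgroup arcD[OF e] by auto
  have K: "estab e \<subseteq> GG"
    using edge_subgroup_subset[OF e] subgroup.subset[OF V(1)] by blast
  have "(g <#\<^bsub>pi1\<^esub> estab e) <#>\<^bsub>pi1\<^esub> (\<^bold>1 <#\<^bsub>pi1\<^esub> stab (fst e)) =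
      (g \<cdot> \<^bold>1) <#\<^bsub>pi1\<^esub> stab (fst e)"
  proof (rule coset_absorb[OF V(1) K one_edge_subgroup[OF e] pi.one_closed g])
    fix k assume "k \<in> estab e"
    thus "\<exists>b\<in>stab (fst e). k \<cdot> \<^bold>1 = \<^bold>1 \<cdot> b"
      using edge_subgroup_subset[OF e] K by (intro bexI[of _ k]) auto
  qed
  thus "tail BT (e, g <#\<^bsub>pi1\<^esub> estab e) = vx (fst e) g"
    unfolding bass_serre_tree_def Let_def vx_def
    using g pi.lcos_mult_one[OF subgroup.subset[OF V(1)]] by simp
  have "(g <#\<^bsub>pi1\<^esub> estab e) <#>\<^bsub>pi1\<^esub> (st e <#\<^bsub>pi1\<^esub> stab (snd e)) =
      (g \<cdot> st e) <#\<^bsub>pi1\<^esub> stab (snd e)"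
  proof (rule coset_absorb[OF V(2) K one_edge_subgroup[OF e] stable_letter_closed[OF e] g])
    fix k assume "k \<in> estab e"
    then obtain c where c: "c \<in> ecar e" "k = emap e c" by blast
    show "\<exists>b\<in>stab (snd e). k \<cdot> st e = st e \<cdot> b"
      unfolding c(2) using stable_letter_edge[OF e c(1)] emb_closed[OF e c(1)] by blast
  qed
  thus "head BT (e, g <#\<^bsub>pi1\<^esub> estab e) =
      vx (snd e) (g \<cdot> st e)"
    unfolding bass_serre_tree_def Let_def vx_def by simp
qed

lemma verts_tree: "verts BT = vertices"
  unfolding bass_serre_tree_def Let_def vertices_def vx_def LCOSETS_def by auto

lemma arcs_tree:
  "arcs BT =
    {(e, g <#\<^bsub>pi1\<^esub> estab e) | e g. e \<in> barcs \<and> g \<in> GG}"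
  unfolding bass_serre_tree_def Let_def LCOSETS_def by auto

lemma arcs_ends_tree: "arcs_ends BT = adj"
proof
  show "arcs_ends BT \<subseteq> adj"
  proof
    fix p assume "p \<in> arcs_ends BT"
    then obtain e g where e: "e \<in> barcs" "g \<in> GG"
      "p = (tail BT (e, g <#\<^bsub>pi1\<^esub> estab e),
        head BT (e, g <#\<^bsub>pi1\<^esub> estab e))"
      unfolding arcs_ends_conv arcs_tree by blast
    have "p = (vx (fst e) g, vx (snd e) (g \<cdot> st e))"
      using e(3) tail_head[OF e(1,2)] by simp
    thus "p \<in> adj" unfolding adj_def using e(1,2) by blast
  qed
  show "adj \<subseteq> arcs_ends BT"
  proof
    fix p assume "p \<in> adj"
    then obtain e g where e: "e \<in> barcs" "g \<in> GG"
      "p = (vx (fst e) g, vx (snd e) (g \<cdot> st e))" unfolding adj_def by blast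
    hence "(e, g <#\<^bsub>pi1\<^esub> estab e) \<in> arcs BT" unfolding arcs_tree by blast
    thus "p \<in> arcs_ends BT"
      unfolding arcs_ends_conv e(3) tail_head[OF e(1,2), symmetric] by (rule imageI)
  qed
qed

lemma vx_absorb:
  assumes "v \<in> bverts" "g \<in> GG" "a \<in> stab v"
  shows "vx v (g \<cdot> a) = vx v g"
proof -
  note V = vertex_subgroup[OF assms(1)]
  have a: "a \<in> GG" using subgroup.mem_carrier[OF V assms(3)] .
  show ?thesis unfolding vx_def
    using pi.lcos_m_assoc[OF subgroup.subset[OF V] assms(2) a] pi.coset_join3[OF a V assms(3)] by simp
qed

lemma vx_eqD:
  assumes "vx v g = vx w h" "v \<in> bverts" "g \<in> GG" "h \<in> GG"
  shows "v = w" "\<exists>a\<in>stab v. h = g \<cdot> a"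
proof -
  show vw: "v = w" using assms(1) unfolding vx_def by simp
  have "h \<in> g <#\<^bsub>pi1\<^esub> stab v"
    using pi.lcos_self[OF assms(4) vertex_subgroup[OF assms(2)]] assms(1) vw unfolding vx_def by simp
  thus "\<exists>a\<in>stab v. h = g \<cdot> a" unfolding l_coset_def by blast
qed

lemma action_vx:
  "\<lbrakk>v \<in> bverts; g \<in> GG; h \<in> GG\<rbrakk> \<Longrightarrow>
    move g (vx v h) = vx v (g \<cdot> h)"
  unfolding bs_vertex_action_def vx_def
  using pi.lcos_m_assoc[OF subgroup.subset[OF vertex_subgroup]] by simp

lemma action_closed: "\<lbrakk>g \<in> GG; p \<in> vertices\<rbrakk> \<Longrightarrow> move g p \<in> vertices"
  unfolding vertices_def using action_vx by fastforce

lemma action_one: "p \<in> vertices \<Longrightarrow> move \<^bold>1 p = p"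
  unfolding vertices_def using action_vx by fastforce

lemma action_mult:
  "\<lbrakk>g \<in> GG; h \<in> GG; p \<in> vertices\<rbrakk> \<Longrightarrow>
    move (g \<cdot> h) p = move g (move h p)"
  unfolding vertices_def using action_vx by (fastforce simp: pi.m_assoc)

lemma action_fst: "fst (move g p) = fst p"
  unfolding bs_vertex_action_def by (simp add: split_beta)

lemma adjE:
  assumes "(p, q) \<in> adj"
  obtains e g where "e \<in> barcs" "g \<in> GG" "p = vx (fst e) g"
    "q = vx (snd e) (g \<cdot> st e)"
  using assms unfolding adj_def by blast

lemma adjI: "\<lbrakk>e \<in> barcs; g \<in> GG\<rbrakk> \<Longrightarrow>
    (vx (fst e) g, vx (snd e) (g \<cdot> st e)) \<in> adj"
  unfolding adj_def by blast

lemma adj_vertices: "adj \<subseteq> vertices \<times> vertices"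
  unfolding adj_def using vx_vertices arcD stable_letter_closed by auto

text \<open>The base graph has no loops. As the action preserves first components
  (\<open>action_fst\<close>), no element maps a vertex to a neighbour, so none inverts an
  edge.\<close>

lemma adj_fst: "(p, q) \<in> adj \<Longrightarrow> fst p \<noteq> fst q"
  by (erule adjE) (use arcD(3) in \<open>simp add: vx_def\<close>)

lemma adj_sym: "sym adj"
proof (rule symI)
  fix p q assume "(p, q) \<in> adj"
  then obtain e g where e: "e \<in> barcs" "g \<in> GG" "p = vx (fst e) g"
    "q = vx (snd e) (g \<cdot> st e)" by (rule adjE)
  note t = stable_letter_closed[OF e(1)] stable_letter_closed[OF arcD(4)[OF e(1)]]
  have "g \<cdot> st e \<cdot> st (prod.swap e) = g"
    using stable_letter_swap[OF e(1)] e(2) t by (simp add: pi.m_assoc)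
  thus "(q, p) \<in> adj"
    using adjI[OF arcD(4)[OF e(1)], of "g \<cdot> st e"] e t by simp
qed

lemma adj_action:
  assumes "g \<in> GG" "(p, q) \<in> adj"
  shows "(move g p, move g q) \<in> adj"
proof -
  obtain e h where e: "e \<in> barcs" "h \<in> GG" "p = vx (fst e) h"
    "q = vx (snd e) (h \<cdot> st e)" using assms(2) by (rule adjE)
  thus ?thesis
    using adjI[OF e(1), of "g \<cdot> h"] action_vx arcD[OF e(1)] stable_letter_closed[OF e(1)] assms(1)
    by (simp add: pi.m_assoc)
qed

lemma adj_action_rtrancl:
  assumes "g \<in> GG" "(p, q) \<in> adj\<^sup>*"
  shows "(move g p, move g q) \<in> adj\<^sup>*"
  using assms(2) by induction (use adj_action[OF assms(1)] in \<open>auto intro: rtrancl_into_rtrancl\<close>)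

text \<open>A word is read as a path between base vertices and their translates. A letter from the
  group of \<open>x\<close> fixes the base vertex over \<open>x\<close>, an arc letter moves the
  base vertex over \<open>snd e\<close> next to the one over \<open>fst e\<close>, and the base
  vertices are linked along \<open>S\<close>, whose stable letters are trivial.\<close>

lemma adj_connected:
  assumes "p \<in> vertices" "q \<in> vertices"
  shows "(p, q) \<in> adj\<^sup>*"
proof -
  have sym: "(y, x) \<in> adj\<^sup>*" if "(x, y) \<in> adj\<^sup>*" for x y
    using that adj_sym by (metis sym_rtrancl symD)
  interpret T: wf_digraph "with_proj S" by (rule S_wf)
  have tree: "(vx u \<^bold>1, vx v \<^bold>1) \<in> adj\<^sup>*"
    if "u \<in> bverts" "v \<in> bverts" for u v
  proof -
    obtain r where "T.awalk u r v" using S_walk \<open>u \<in> _\<close> \<open>v \<in> _\<close> by blast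
    thus ?thesis
    proof (induction r arbitrary: u)
      case (Cons e r)
      hence e: "e \<in> parcs S" "fst e = u" "T.awalk (snd e) r v" by (auto simp: T.awalk_Cons_iff)
      hence "(vx u \<^bold>1, vx (snd e) \<^bold>1) \<in> adj"
        using adjI[of e "\<^bold>1"] stable_letter_tree[OF e(1)] S_arcs by auto
      thus ?case using Cons.IH[OF e(3)] by (rule converse_rtrancl_into_rtrancl)
    qed (auto simp: T.awalk_Nil_iff)
  qed
  have ind: "(vx u \<^bold>1, vx v (cls w)) \<in> adj\<^sup>*"
    if "w \<in> words" "u \<in> bverts" "v \<in> bverts" for w u v
    using that
  proof (induction w arbitrary: u rule: list.induct)
    case Nil
    then show ?case using tree one_cls by simp
  next
    case (Cons a w)
    have a: "cls [a] \<in> GG" "cls w \<in> GG" using cls_closed Cons by auto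
    have aw: "cls (a # w) = cls [a] \<cdot> cls w" using cls_mult[of "[a]" w] Cons by simp
    have IH: "(vx x (cls [a]), vx v (cls (a # w))) \<in> adj\<^sup>*" if "x \<in> bverts" for x
    proof -
      have "(vx x \<^bold>1, vx v (cls w)) \<in> adj\<^sup>*" using Cons that by auto
      from adj_action_rtrancl[OF a(1) this]
      show ?thesis using action_vx a that Cons(4) aw by simp
    qed
    show ?case
    proof (cases a)
      case (Vtx x y)
      hence x: "x \<in> bverts" "y \<in> vcar x" using Cons by auto
      have "vx x (\<^bold>1 \<cdot> vmap x y) = vx x \<^bold>1" using vx_absorb x by blast
      hence "vx x (cls [a]) = vx x \<^bold>1" using a unfolding Vtx vertex_map_def by simp
      thus ?thesis using tree[OF Cons(3) x(1)] IH[OF x(1)] by simp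
    next
      case (Arc e)
      hence e: "e \<in> barcs" using Cons by auto
      have "(vx (fst e) \<^bold>1, vx (snd e) (cls [a])) \<in> adj"
        using adjI[OF e pi.one_closed] a unfolding Arc stable_letter_def by simp
      thus ?thesis using tree[OF Cons(3) arcD(1)[OF e]] IH[OF arcD(2)[OF e]]
        by (meson rtrancl_trans converse_rtrancl_into_rtrancl)
    qed
  qed
  obtain u g where p: "u \<in> bverts" "g \<in> GG" "p = vx u g"
    using assms(1) unfolding vertices_def by blast
  obtain v h where q: "v \<in> bverts" "h \<in> GG" "q = vx v h"
    using assms(2) unfolding vertices_def by blast
  have "(vx u \<^bold>1, p) \<in> adj\<^sup>*" "(vx u \<^bold>1, q) \<in> adj\<^sup>*"
    using ind p q carrier_cls by metis+
  thus ?thesis using sym by (meson rtrancl_trans)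
qed

section \<open>The action on sets of edges and the tree property\<close>

text \<open>Extending the action by the identity makes it injective on the whole type, so that
  \<open>push\<close> commutes with symmetric differences of arbitrary sets.\<close>

definition perm where "perm g p = (if p \<in> vertices then move g p else p)"

definition push where "push g m = (`) (perm g) ` m"

text \<open>The lift of \<open>e\<close> that starts at the base vertex over \<open>fst e\<close>.
  The lift of the reversed edge is a translate of it, see \<open>push_edge0\<close>.\<close>

definition edge0 where "edge0 e = {vx (fst e) \<^bold>1, vx (snd e) (st e)}"

lemma perm_one: "perm \<^bold>1 = id"
  unfolding perm_def using action_one by auto

lemma perm_mult: "\<lbrakk>g \<in> GG; h \<in> GG\<rbrakk> \<Longrightarrow> perm (g \<cdot> h) p = perm g (perm h p)"
  unfolding perm_def using action_mult action_closed by simp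

lemma perm_inj:
  assumes "g \<in> GG"
  shows "inj (perm g)"
proof (rule inj_on_inverseI)
  show "perm (inv\<^bsub>pi1\<^esub> g) (perm g p) = p" for p
    using perm_mult[of "inv\<^bsub>pi1\<^esub> g" g p] assms perm_one by simp
qed

lemma push_one: "push \<^bold>1 m = m"
  unfolding push_def perm_one by simp

lemma push_mult: "\<lbrakk>g \<in> GG; h \<in> GG\<rbrakk> \<Longrightarrow> push (g \<cdot> h) m = push g (push h m)"
  unfolding push_def by (simp add: image_image perm_mult)

lemma push_sym_diff:
  assumes "g \<in> GG"
  shows "push g (sym_diff m m') = sym_diff (push g m) (push g m')"
proof -
  have "inj ((`) (perm g))" using perm_inj[OF assms] by (simp add: inj_on_def inj_image_eq_iff)
  thus ?thesis unfolding push_def by (simp add: image_Un image_set_diff)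
qed

lemma push_empty: "push g {} = {}"
  unfolding push_def by simp

lemma push_vx:
  assumes "g \<in> GG" "u \<in> bverts" "v \<in> bverts" "h \<in> GG" "k \<in> GG"
  shows "push g {{vx u h, vx v k}} = {{vx u (g \<cdot> h), vx v (g \<cdot> k)}}"
  unfolding push_def perm_def using assms vx_vertices action_vx by simp

lemma push_edge0:
  assumes "e \<in> barcs"
  shows "push (st e) {edge0 (prod.swap e)} = {edge0 e}"
  unfolding edge0_def
  using push_vx[of "st e" "snd e" "fst e" "\<^bold>1" "st (prod.swap e)"]
    stable_letter_closed arcD[OF assms] assms stable_letter_swap[OF assms]
  by (simp add: insert_commute)

lemma push_edge0_fixed:
  assumes e: "e \<in> barcs" and c: "c \<in> ecar e"
  shows "push (emap e c) {edge0 e} = {edge0 e}"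
proof -
  have k: "emap e c \<in> stab (fst e)"
    "vmap (snd e) (emb \<G> e c) \<in> stab (snd e)"
    using edge_subgroup_subset[OF e] c emb_closed[OF e c] by auto
  have cl: "emap e c \<in> GG"
    using k(1) subgroup.subset[OF vertex_subgroup[OF arcD(1)[OF e]]] by blast
  have "vx (fst e) (emap e c) = vx (fst e) \<^bold>1"
    using vx_absorb[OF arcD(1)[OF e] pi.one_closed k(1)] cl by simp
  moreover have "vx (snd e) (emap e c \<cdot> st e) = vx (snd e) (st e)"
    unfolding stable_letter_edge[OF e c] using vx_absorb[OF arcD(2)[OF e] stable_letter_closed[OF e] k(2)] .
  ultimately show ?thesis
    unfolding edge0_def using push_vx[OF cl arcD(1,2)[OF e] pi.one_closed stable_letter_closed[OF e]] cl by simp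
qed

text \<open>
  The group acts on the power set of the set of edges by the affine maps which act on the edges by
  translation and fix, for each vertex \<open>v\<close> of the base graph, the set \<open>\<gamma> v {}\<close>. By equivariance,
  this assigns to every vertex of the tree the set of edges which separate it from a base point.
\<close>

lemma crossing_function:
  "\<exists>f. \<forall>p q E. (p, q) \<in> adj \<longrightarrow> (E \<in> f p) \<noteq> (E \<in> f q) \<longleftrightarrow> E = {p, q}"
proof -
  let ?t = "st"
  define \<alpha> where "\<alpha> v x = push (vmap v x)" for v x
  \<comment> \<open>The linear part is the action of the stable letter; the translation part records
    the crossing of the lifted edge.\<close>
  define \<phi> where "\<phi> e m = sym_diff {edge0 e} (push (?t e) m)" for e m
  note tcl = stable_letter_closed
  obtain \<rho> :: "('v, 'g) letter \<Rightarrow> ('v, 'g) bs_vertex set set \<Rightarrow> ('v, 'g) bs_vertex set set" and \<gamma> path where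
    \<rho>: "\<And>w w'. weq w w' \<Longrightarrow> composite \<rho> w = composite \<rho> w'"
      "\<And>v x. v \<in> bverts \<Longrightarrow> \<rho> (Vtx v x) \<circ> \<gamma> v = \<gamma> v \<circ> \<alpha> v x"
      "\<And>e. e \<in> barcs \<Longrightarrow> \<rho> (Arc e) \<circ> \<gamma> (snd e) = \<gamma> (fst e) \<circ> \<phi> e"
      "\<And>v. v \<in> bverts \<Longrightarrow> bij (\<gamma> v)"
      "\<And>v. v \<in> bverts \<Longrightarrow> \<gamma> v = composite \<phi> (path v) \<and> set (path v) \<subseteq> parcs S"
  proof (rule representation[of \<alpha> \<phi>])
    show "\<alpha> v \<one>\<^bsub>vgrp \<G> v\<^esub> = id" if "v \<in> bverts" for v
      unfolding \<alpha>_def using group_hom.hom_one[OF vertex_group_hom[OF that]] push_one by auto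
    show "\<alpha> v (x \<otimes>\<^bsub>vgrp \<G> v\<^esub> y) = \<alpha> v x \<circ> \<alpha> v y"
      if "v \<in> bverts" "x \<in> vcar v" "y \<in> vcar v" for v x y
      unfolding \<alpha>_def hom_mult[OF vertex_map_hom[OF that(1)] that(2,3)]
      using push_mult[OF vertex_map_closed vertex_map_closed] that by auto
    show "\<phi> e \<circ> \<phi> (prod.swap e) = id" if e: "e \<in> barcs" for e
    proof
      fix m
      note e' = arcD(4)[OF e]
      \<comment> \<open>Crossing an edge and coming back adds the same edge twice, which cancels in
        the symmetric difference.\<close>
      have "push (?t e) (sym_diff {edge0 (prod.swap e)} (push (?t (prod.swap e)) m)) = sym_diff {edge0 e} m"
        unfolding push_sym_diff[OF tcl[OF e]] push_edge0[OF e] push_mult[OF tcl[OF e] tcl[OF e'], symmetric]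
          stable_letter_swap[OF e] push_one ..
      thus "(\<phi> e \<circ> \<phi> (prod.swap e)) m = id m" unfolding \<phi>_def comp_def by auto
    qed
    show "\<phi> e \<circ> \<alpha> (snd e) (emb \<G> e c) \<circ> \<phi> (prod.swap e) = \<alpha> (fst e) (emb \<G> (prod.swap e) c)"
      if e: "e \<in> barcs" and c: "c \<in> ecar e" for e c
    proof
      fix m
      let ?a = "vmap (snd e) (emb \<G> e c)" and ?k = "emap e c"
      note e' = arcD(4)[OF e]
      have cl: "?t e \<in> GG" "?t (prod.swap e) \<in> GG" "?a \<in> GG" "?k \<in> GG"
        using tcl e e' vertex_map_closed[OF arcD(2)[OF e] emb_closed[OF e c]]
          vertex_map_closed[OF arcD(1)[OF e] emb_swap_closed[OF e c]] unfolding edge_map_def by auto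
      have ta: "push (?t e) (push ?a z) = push ?k (push (?t e) z)" for z
        using push_mult[OF cl(1,3), of z] push_mult[OF cl(4,1), of z] stable_letter_edge[OF e c] by simp
      \<comment> \<open>The edge group fixes the lifted edge, so the two copies of it cancel here
        too.\<close>
      have "push (?t e) (push ?a (sym_diff {edge0 (prod.swap e)} (push (?t (prod.swap e)) m)))
          = sym_diff {edge0 e} (push ?k m)"
        unfolding ta push_sym_diff[OF cl(1)] push_edge0[OF e] push_mult[OF cl(1,2), symmetric]
          stable_letter_swap[OF e] push_one push_sym_diff[OF cl(4)] push_edge0_fixed[OF e c] ..
      thus "(\<phi> e \<circ> \<alpha> (snd e) (emb \<G> e c) \<circ> \<phi> (prod.swap e)) m = \<alpha> (fst e) (emb \<G> (prod.swap e) c) m"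
        unfolding \<phi>_def \<alpha>_def comp_def edge_map_def by auto
    qed
  qed (rule that)
  \<comment> \<open>Stable letters of edges of \<open>S\<close> are trivial, so along
    \<open>S\<close> all \<open>\<phi> e\<close>, and hence \<open>\<gamma> v\<close>, are pure
    translations.\<close>
  have shift: "sym_diff (\<gamma> v m) (\<gamma> v m') = sym_diff m m'" if "v \<in> bverts" for v m m'
  proof -
    have "sym_diff (composite \<phi> p m) (composite \<phi> p m') = sym_diff m m'" if "set p \<subseteq> parcs S" for p
      using that
    proof (induction p)
      case (Cons e p)
      have "\<phi> e z = sym_diff {edge0 e} z" for z
        unfolding \<phi>_def using stable_letter_tree push_one Cons(2) by simp
      moreover have "sym_diff (composite \<phi> p m) (composite \<phi> p m') = sym_diff m m'" using Cons by simp
      ultimately show ?case by auto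
    qed simp
    thus ?thesis using \<rho>(5)[OF that] by simp
  qed
  have surj: "\<exists>n. m = \<gamma> v n" if "v \<in> bverts" for v m
    using bij_is_surj[OF \<rho>(4)[OF that]] by (metis surjD)
  have \<rho>v: "\<rho> (Vtx v x) (\<gamma> v m) = \<gamma> v (push (vmap v x) m)" if "v \<in> bverts" for v x m
    using fun_cong[OF \<rho>(2)[OF that, of x], of m] unfolding \<alpha>_def comp_def .
  have \<rho>e: "\<rho> (Arc e) (\<gamma> (snd e) m) = \<gamma> (fst e) (\<phi> e m)" if "e \<in> barcs" for e m
    using fun_cong[OF \<rho>(3)[OF that], of m] unfolding comp_def .
  have letter: "sym_diff (\<rho> a m) (\<rho> a m') = push (cls [a]) (sym_diff m m')" if "a \<in> letters \<G>" for a m m'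
  proof (cases a)
    case (Vtx v x)
    hence v: "v \<in> bverts" "x \<in> vcar v" using that by auto
    obtain n n' where n: "m = \<gamma> v n" "m' = \<gamma> v n'"
      using surj[OF v(1), of m] surj[OF v(1), of m'] by (elim exE)
    show ?thesis
      using push_sym_diff[OF vertex_map_closed[OF v], of n n', symmetric]
      unfolding Vtx n \<rho>v[OF v(1)] shift[OF v(1)] unfolding vertex_map_def .
  next
    case (Arc e)
    hence e: "e \<in> barcs" using that by auto
    obtain n n' where n: "m = \<gamma> (snd e) n" "m' = \<gamma> (snd e) n'"
      using surj[OF arcD(2)[OF e], of m] surj[OF arcD(2)[OF e], of m'] by (elim exE)
    have "sym_diff (\<phi> e n) (\<phi> e n') = sym_diff (push (?t e) n) (push (?t e) n')" unfolding \<phi>_def by auto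
    also have "\<dots> = push (?t e) (sym_diff n n')" using push_sym_diff[OF tcl[OF e], symmetric] .
    finally show ?thesis
      unfolding Arc n \<rho>e[OF e] shift[OF arcD(1)[OF e]] shift[OF arcD(2)[OF e]] stable_letter_def .
  qed
  have word: "sym_diff (composite \<rho> w m) (composite \<rho> w m') = push (cls w) (sym_diff m m')"
    if "w \<in> words" for w m m'
    using that
  proof (induction w rule: list.induct)
    case Nil
    then show ?case using push_one one_cls by simp
  next
    case (Cons a w)
    have a: "a \<in> letters \<G>" "w \<in> words" using Cons by auto
    have "cls (a # w) = cls [a] \<cdot> cls w" using cls_mult[of "[a]" w] a by simp
    hence "push (cls (a # w)) (sym_diff m m') = push (cls [a]) (push (cls w) (sym_diff m m'))"
      using push_mult cls_closed a by simp
    also have "\<dots> = push (cls [a]) (sym_diff (composite \<rho> w m) (composite \<rho> w m'))"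
      unfolding Cons.IH[OF a(2)] ..
    also have "\<dots> = sym_diff (\<rho> a (composite \<rho> w m)) (\<rho> a (composite \<rho> w m'))"
      unfolding letter[OF a(1)] ..
    finally show ?case by (simp only: composite.simps comp_apply)
  qed
  \<comment> \<open>The vertex group fixes the point \<open>\<gamma> v {}\<close>, because in the
    coordinate \<open>\<gamma> v\<close> it acts linearly. So the orbit map descends to
    cosets.\<close>
  have rep: "composite \<rho> w (\<gamma> v {}) = composite \<rho> w' (\<gamma> v {})"
    if v: "v \<in> bverts" and w: "w \<in> words" "w' \<in> words" and eq: "vx v (cls w) = vx v (cls w')" for v w w'
  proof -
    obtain x where x: "x \<in> vcar v" "cls w' = cls w \<cdot> vmap v x"
      using vx_eqD(2)[OF eq v cls_closed cls_closed] w by blast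
    hence "cls w' = cls (w @ [Vtx v x])" unfolding vertex_map_def using cls_mult[of w "[Vtx v x]"] w v by simp
    hence "composite \<rho> w' = composite \<rho> w \<circ> \<rho> (Vtx v x)"
      using cls_eq_iff[OF w(2)] \<rho>(1)[of w' "w @ [Vtx v x]"] by (simp add: composite_append)
    thus ?thesis using \<rho>v[OF v, of x "{}"] push_empty by simp
  qed
  define f where "f p = (SOME m. \<exists>w\<in>words. p = vx (fst p) (cls w) \<and> m = composite \<rho> w (\<gamma> (fst p) {}))" for p
  have f: "f (vx v (cls w)) = composite \<rho> w (\<gamma> v {})" if "v \<in> bverts" "w \<in> words" for v w
  proof -
    have [simp]: "fst (vx v g) = v" for g unfolding vx_def by simp
    show ?thesis unfolding f_def
    proof (rule some_equality)
      show "\<exists>w'\<in>words. vx v (cls w) = vx (fst (vx v (cls w))) (cls w') \<and>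
          composite \<rho> w (\<gamma> v {}) = composite \<rho> w' (\<gamma> (fst (vx v (cls w))) {})"
        by (rule bexI[OF _ that(2)]) simp
      fix m assume "\<exists>w'\<in>words. vx v (cls w) = vx (fst (vx v (cls w))) (cls w') \<and>
          m = composite \<rho> w' (\<gamma> (fst (vx v (cls w))) {})"
      then obtain w' where w': "w' \<in> words" "vx v (cls w) = vx v (cls w')" "m = composite \<rho> w' (\<gamma> v {})"
        by auto
      show "m = composite \<rho> w (\<gamma> v {})" unfolding w'(3) using rep[OF that w'(1,2)] by simp
    qed
  qed
  have "(E \<in> f p) \<noteq> (E \<in> f q) \<longleftrightarrow> E = {p, q}" if pq: "(p, q) \<in> adj" for p q E
  proof -
    obtain e g where e: "e \<in> barcs" and g: "g \<in> GG" "p = vx (fst e) g"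
      "q = vx (snd e) (g \<cdot> ?t e)" using pq by (rule adjE)
    obtain w where w: "w \<in> words" "g = cls w" using carrier_cls[OF g(1)] .
    have "g \<cdot> ?t e = cls (w @ [Arc e])"
      unfolding stable_letter_def w(2) using cls_mult[of w "[Arc e]"] w(1) e by simp
    hence "f q = composite \<rho> (w @ [Arc e]) (\<gamma> (snd e) {})"
      using f[OF arcD(2)[OF e], of "w @ [Arc e]"] w(1) e g(3) by simp
    also have "\<dots> = composite \<rho> w (\<gamma> (fst e) {edge0 e})"
      using \<rho>e[OF e, of "{}"] unfolding \<phi>_def push_empty by (simp add: composite_append)
    finally have fq: "f q = composite \<rho> w (\<gamma> (fst e) {edge0 e})" .
    have fp: "f p = composite \<rho> w (\<gamma> (fst e) {})" using f[OF arcD(1)[OF e] w(1)] g(2) w(2) by simp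
    \<comment> \<open>The linear part \<open>push g\<close> takes the lifted edge to the edge from
      \<open>p\<close> to \<open>q\<close>, which is therefore the only coordinate that
      changes.\<close>
    have "sym_diff (f p) (f q) = push g (sym_diff {} {edge0 e})"
      unfolding fp fq word[OF w(1)] shift[OF arcD(1)[OF e]] w(2) ..
    also have "\<dots> = {{p, q}}"
      using push_vx[OF g(1) arcD(1,2)[OF e] pi.one_closed tcl[OF e]] g unfolding edge0_def by simp
    finally have "E \<in> sym_diff (f p) (f q) \<longleftrightarrow> E = {p, q}" by simp
    thus ?thesis by blast
  qed
  thus ?thesis by (intro exI[of _ f] allI impI)
qed

lemma tree_cube: "\<exists>f. cube_tree vertices adj f"
proof -
  obtain f where f: "\<forall>p q E. (p, q) \<in> adj \<longrightarrow> (E \<in> f p) \<noteq> (E \<in> f q) \<longleftrightarrow> E = {p, q}"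
    using crossing_function by blast
  have "cube_tree vertices adj f"
  proof
    show "(E \<in> f p) \<noteq> (E \<in> f q) \<longleftrightarrow> E = {p, q}" if "(p, q) \<in> adj" for p q E
      using f that by blast
  qed (fact adj_vertices adj_sym adj_connected)+
  thus ?thesis by (rule exI[of "\<lambda>f. cube_tree vertices adj f"])
qed

section \<open>Distances between vertices of the tree\<close>

text \<open>\<open>D\<close> depends on the adjacency alone, so each proof may obtain a crossing
  function anew without changing the distance.\<close>

abbreviation tdist where "tdist \<equiv> cube_tree.D adj"

lemma tree_wf: "wf_digraph BT"
proof
  fix a assume "a \<in> arcs BT"
  hence "(tail BT a, head BT a) \<in> adj"
    unfolding arcs_ends_tree[symmetric] arcs_ends_conv by (rule imageI)
  thus "tail BT a \<in> verts BT"
    "head BT a \<in> verts BT"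
    unfolding verts_tree using adj_vertices by auto
qed

lemma vertex_dist_tree:
  assumes "p \<in> vertices" "q \<in> vertices"
  shows "vertex_dist BT p q = real (tdist p q)"
proof -
  interpret T: wf_digraph "BT" by (rule tree_wf)
  obtain f where "cube_tree vertices adj f" using tree_cube ..
  then interpret C: cube_tree vertices adj f .
  have walk: "(p, q) \<in> adj ^^ length r" if "T.awalk p r q" for p r q
    using that
  proof (induction r arbitrary: p)
    case (Cons a r)
    hence a: "a \<in> arcs BT" "p = tail BT a"
      "T.awalk (head BT a) r q" by (auto simp: T.awalk_Cons_iff)
    hence "(p, head BT a) \<in> adj"
      unfolding arcs_ends_tree[symmetric] arcs_ends_conv by blast
    thus ?case using Cons.IH[OF a(3)] relpow_Suc_I2 by (simp only: length_Cons) fast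
  qed (auto simp: T.awalk_Nil_iff)
  have walk_ex: "\<exists>r. T.awalk p r q \<and> length r = n" if "(p, q) \<in> adj ^^ n" "p \<in> vertices" for p q n
    using that
  proof (induction n arbitrary: p)
    case 0
    then show ?case by (intro exI[of _ "[]"]) (simp add: T.awalk_Nil_iff verts_tree)
  next
    case (Suc n)
    then obtain z where z: "(p, z) \<in> adj" "(z, q) \<in> adj ^^ n" using relpow_Suc_D2 by metis
    then obtain r where r: "T.awalk z r q" "length r = n" using Suc.IH adj_vertices by blast
    obtain a where "a \<in> arcs BT" "p = tail BT a"
      "z = head BT a" using z(1) unfolding arcs_ends_tree[symmetric] arcs_ends_conv by blast
    thus ?case using r by (intro exI[of _ "a # r"]) (simp add: T.awalk_Cons_iff)
  qed
  have cost: "T.awalk_cost (\<lambda>_. 1) r = real (length r)" for r :: "('v, 'g) bs_arc list"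
    by (induction r) auto
  have "T.\<mu> (\<lambda>_. 1) p q = ereal (real (tdist p q))"
    unfolding T.\<mu>_def cost
  proof (rule antisym)
    obtain r where r: "T.awalk p r q" "length r = tdist p q" using walk_ex[OF C.D_relpow[OF assms] assms(1)] by blast
    thus "(INF r\<in>{r. T.awalk p r q}. ereal (real (length r))) \<le> ereal (real (tdist p q))"
      by (intro INF_lower2[of r]) auto
    show "ereal (real (tdist p q)) \<le> (INF r\<in>{r. T.awalk p r q}. ereal (real (length r)))"
      by (rule INF_greatest) (use C.D_le[OF walk] in auto)
  qed
  thus ?thesis unfolding vertex_dist_def by simp
qed

lemma tdist_action:
  assumes "g \<in> GG" "p \<in> vertices" "q \<in> vertices"
  shows "tdist (move g p) (move g q) = tdist p q"
proof -
  obtain f where "cube_tree vertices adj f" using tree_cube ..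
  then interpret C: cube_tree vertices adj f .
  have pow: "(move g p, move g q) \<in> adj ^^ n"
    if "(p, q) \<in> adj ^^ n" "g \<in> GG" for p q g n
    using that
  proof (induction n arbitrary: q)
    case (Suc n)
    then obtain z where "(p, z) \<in> adj ^^ n" "(z, q) \<in> adj" by auto
    thus ?case using Suc.IH[of z] Suc.prems(2) adj_action[of g z q] by (auto intro: relpow_Suc_I)
  qed simp
  have le: "tdist (move g p) (move g q) \<le> tdist p q"
    if "g \<in> GG" "p \<in> vertices" "q \<in> vertices" for g p q
    using C.D_le[OF pow[OF C.D_relpow[OF that(2,3)] that(1)]] .
  have inv: "move (inv\<^bsub>pi1\<^esub> g) (move g p) = p" if "p \<in> vertices" for p
    using action_mult[of "inv\<^bsub>pi1\<^esub> g" g p] assms(1) that action_one by simp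
  show ?thesis
    using le[OF assms] le[of "inv\<^bsub>pi1\<^esub> g" "move g p" "move g q"]
      inv assms action_closed by simp
qed

end

section \<open>Displacement in the geometric realization\<close>

definition delta :: "'x \<Rightarrow> 'x \<Rightarrow> real" where "delta x = (\<lambda>y. if y = x then 1 else 0)"

lemma supp_delta [simp]: "supp (delta x) = {x}"
  unfolding supp_def delta_def by auto

lemma delta_same [simp]: "delta x x = 1"
  unfolding delta_def by simp

lemma realization_singleton:
  assumes "z \<in> realization T" "supp z = {x}"
  shows "z = delta x"
proof
  fix y
  have "z x = 1" using assms unfolding realization_def by simp
  moreover have "z y = 0" if "y \<noteq> x" using that assms(2) unfolding supp_def by blast
  ultimately show "z y = delta x y" unfolding delta_def by auto
qed

lemma realization_map_apply:
  "z \<in> realization T \<Longrightarrow> realization_map T f z y = (\<Sum>x\<in>{x \<in> supp z. f x = y}. z x)"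
  unfolding realization_map_def by simp

context based_graph_of_groups begin

lemma simplices_tree:
  "s \<in> simplices BT \<longleftrightarrow> (\<exists>p\<in>vertices. s = {p}) \<or> (\<exists>p q. (p, q) \<in> adj \<and> s = {p, q})"
proof -
  let ?T = "BT"
  have "(\<exists>p q. (p, q) \<in> adj \<and> s = {p, q}) \<longleftrightarrow> s \<in> (\<lambda>e. {tail ?T e, head ?T e}) ` arcs ?T" (is "?L \<longleftrightarrow> ?R")
  proof
    assume ?L
    then obtain p q where "(p, q) \<in> arcs_ends ?T" "s = {p, q}" unfolding arcs_ends_tree by (elim exE conjE)
    thus ?R unfolding arcs_ends_conv by (elim imageE) simp
  next
    assume ?R
    then obtain e where e: "e \<in> arcs ?T" "s = {tail ?T e, head ?T e}" by (rule imageE)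
    have "(tail ?T e, head ?T e) \<in> adj" unfolding arcs_ends_tree[symmetric] arcs_ends_conv using e(1) by (rule imageI)
    thus ?L using e(2) by (intro exI conjI)
  qed
  moreover have "(\<exists>p\<in>vertices. s = {p}) \<longleftrightarrow> s \<in> (\<lambda>x. {x}) ` verts BT"
    unfolding verts_tree by (auto simp: image_iff)
  ultimately show ?thesis unfolding simplices_def Un_iff by (simp only:) 
qed

lemma bs_space_cases:
  assumes "z \<in> BX"
  obtains p where "p \<in> vertices" "z = delta p"
  | p q where "(p, q) \<in> adj" "supp z = {p, q}" "p \<noteq> q" "z p + z q = 1" "0 < z p" "0 < z q"
proof -
  have z: "\<And>x. 0 \<le> z x" "supp z \<in> simplices BT" "(\<Sum>x\<in>supp z. z x) = 1"
    using assms unfolding bs_space_def realization_def by auto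
  consider p where "p \<in> vertices" "supp z = {p}" | p q where "(p, q) \<in> adj" "supp z = {p, q}"
    using z(2) unfolding simplices_tree by blast
  thus ?thesis
  proof cases
    case 1
    show ?thesis using that(1)[OF 1(1) realization_singleton[OF assms[unfolded bs_space_def] 1(2)]] .
  next
    case 2
    have ne: "p \<noteq> q" using adj_fst[OF 2(1)] by auto
    have "z p \<noteq> 0" "z q \<noteq> 0" using 2(2) unfolding supp_def by auto
    hence "0 < z p" "0 < z q" using z(1)[of p] z(1)[of q] by linarith+
    moreover have "z p + z q = 1" using z(3) 2(2) ne by simp
    ultimately show ?thesis using that(2) 2 ne by simp
  qed
qed

lemma delta_in_space: "p \<in> vertices \<Longrightarrow> delta p \<in> BX"
  unfolding bs_space_def realization_def simplices_tree mem_Collect_eq supp_delta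
  by (simp add: delta_def)

lemma adj_tdist:
  assumes "(p, q) \<in> adj"
  shows "tdist p q = 1"
proof -
  obtain f where "cube_tree vertices adj f" using tree_cube by (elim exE)
  then interpret C: cube_tree vertices adj f .
  have "p \<noteq> q" using adj_fst[OF assms] by auto
  hence "tdist p q \<noteq> 0" using C.D_zero[OF C.RD(1,2)[OF assms]] by simp
  thus ?thesis using C.D_adjacent_le[OF assms] by simp
qed

lemma bs_dist_delta:
  assumes p: "p \<in> vertices" and q: "q \<in> vertices"
  shows "bsdist (delta p) (delta q) = real (tdist p q)"
proof (cases "\<exists>s\<in>simplices BT. {p} \<union> {q} \<subseteq> s")
  case True
  hence eq: "bsdist (delta p) (delta q) = (\<Sum>x\<in>{p} \<union> {q}. \<bar>delta p x - delta q x\<bar>) / 2"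
    unfolding bs_dist_def realization_dist_def supp_delta by (rule if_P)
  obtain f where "cube_tree vertices adj f" using tree_cube by (elim exE)
  then interpret C: cube_tree vertices adj f .
  show ?thesis
  proof (cases "p = q")
    case True
    thus ?thesis unfolding eq using C.D_zero[OF p p] by simp
  next
    case ne: False
    obtain s where "s \<in> simplices BT" "p \<in> s" "q \<in> s" using True by auto
    then obtain a b where ab: "(a, b) \<in> adj" "p \<in> {a, b}" "q \<in> {a, b}"
      unfolding simplices_tree using ne by (elim disjE bexE exE conjE) auto
    hence "(p, q) \<in> adj" using ne C.RD(3)[OF ab(1)] by (elim insertE emptyE) auto
    thus ?thesis unfolding eq using ne by (simp add: adj_tdist delta_def)
  qed
next
  case False
  hence "bsdist (delta p) (delta q) =
      Min ((\<lambda>(x, y). (1 - delta p x) + vertex_dist BT x y + (1 - delta q y)) ` ({p} \<times> {q}))"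
    unfolding bs_dist_def realization_dist_def supp_delta by (rule if_not_P)
  thus ?thesis using vertex_dist_tree[OF p q] by simp
qed

lemma bs_action_delta:
  assumes "p \<in> vertices"
  shows "bsact g (delta p) = delta (move g p)"
proof
  fix y
  have "bsact g (delta p) y = (\<Sum>x\<in>{x \<in> {p}. move g x = y}. delta p x)"
    unfolding bs_action_def supp_delta[symmetric]
    by (rule realization_map_apply) (use delta_in_space[OF assms] in \<open>simp add: bs_space_def\<close>)
  also have "{x \<in> {p}. move g x = y} = (if move g p = y then {p} else {})"
    by auto
  finally show "bsact g (delta p) y = delta (move g p) y"
    by (auto simp: delta_def)
qed

lemma action_inverse:
  assumes "g \<in> GG" "p \<in> vertices"
  shows "move (inv\<^bsub>pi1\<^esub> g) (move g p) = p"
    "move g (move (inv\<^bsub>pi1\<^esub> g) p) = p"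
  using action_mult[of "inv\<^bsub>pi1\<^esub> g" g p] action_mult[of g "inv\<^bsub>pi1\<^esub> g" p] action_one[of p] assms by simp_all

lemma action_inj:
  "\<lbrakk>g \<in> GG; p \<in> vertices; q \<in> vertices; move g p = move g q\<rbrakk> \<Longrightarrow> p = q"
  using action_inverse(1) by metis

lemma supp_vertices:
  assumes "z \<in> BX" "y \<in> supp z"
  shows "y \<in> vertices"
  using assms(1)
proof (cases rule: bs_space_cases)
  case (1 p)
  thus ?thesis using assms(2) by simp
next
  case (2 p q)
  thus ?thesis using assms(2) adj_vertices by auto
qed

lemma bs_action_apply:
  assumes "z \<in> BX" "g \<in> GG" "y \<in> vertices"
  shows "bsact g z (move g y) = z y"
proof -
  have "bsact g z (move g y) =
      (\<Sum>x\<in>{x \<in> supp z. move g x = move g y}. z x)"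
    unfolding bs_action_def by (rule realization_map_apply) (use assms(1) in \<open>simp add: bs_space_def\<close>)
  also have "{x \<in> supp z. move g x = move g y} = {x \<in> supp z. x = y}"
    using action_inj[OF assms(2) supp_vertices[OF assms(1)] assms(3)] by (intro Collect_cong) auto
  also have "\<dots> = (if y \<in> supp z then {y} else {})" by auto
  finally show ?thesis by (auto simp: supp_def)
qed

lemma supp_action:
  assumes "z \<in> BX" "g \<in> GG"
  shows "supp (bsact g z) = move g ` supp z"
proof
  show "move g ` supp z \<subseteq> supp (bsact g z)"
  proof (rule image_subsetI)
    fix y assume "y \<in> supp z"
    thus "move g y \<in> supp (bsact g z)"
      using bs_action_apply[OF assms supp_vertices[OF assms(1)]] unfolding supp_def by simp
  qed
  show "supp (bsact g z) \<subseteq> move g ` supp z"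
  proof
    fix y assume "y \<in> supp (bsact g z)"
    hence "(\<Sum>x\<in>{x \<in> supp z. move g x = y}. z x) \<noteq> 0"
      using realization_map_apply[of z "BT"] assms(1)
      unfolding bs_action_def supp_def bs_space_def by simp
    hence "{x \<in> supp z. move g x = y} \<noteq> {}" by (metis sum.empty)
    thus "y \<in> move g ` supp z" by auto
  qed
qed

lemma delta_action_image:
  assumes "A \<subseteq> BX" "g \<in> GG" "p \<in> vertices"
  shows "delta (move g p) \<in> bsact g ` A \<longleftrightarrow> delta p \<in> A"
proof
  assume "delta p \<in> A"
  thus "delta (move g p) \<in> bsact g ` A"
    unfolding bs_action_delta[OF assms(3), symmetric] by (rule imageI)
next
  assume "delta (move g p) \<in> bsact g ` A"
  then obtain z where z: "z \<in> A" "delta (move g p) = bsact g z" by (rule imageE)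
  have zX: "z \<in> BX" using z(1) assms(1) by (rule rev_subsetD)
  have "move g ` supp z = {move g p}"
    using supp_action[OF zX assms(2)] z(2)[symmetric] by simp
  hence "\<And>y. y \<in> supp z \<Longrightarrow> y = p" "supp z \<noteq> {}"
    using action_inj[OF assms(2) supp_vertices[OF zX] assms(3)] by auto
  hence "supp z = {p}" by auto
  hence "z = delta p" by (rule realization_singleton[OF zX[unfolded bs_space_def]])
  thus "delta p \<in> A" using z(1) by simp
qed

text \<open>From inside an edge, a route to the image leaves through an end \<open>x\<close> and
  enters through an end \<open>y\<close>. If \<open>y\<close> is the image of \<open>x\<close>, the
  displacement of \<open>x\<close> is a lower bound. Otherwise the two partial edges have total
  length 1, which makes up for the step between the images of the ends. A common closed cell forces
  a fixed vertex, since neighbours have different first components.\<close>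

lemma displacement_ge:
  assumes z: "z \<in> BX" and g: "g \<in> GG"
    and min: "\<And>p. p \<in> vertices \<Longrightarrow> \<tau> \<le> tdist p (move g p)"
  shows "real \<tau> \<le> bsdist z (bsact g z)"
  using z
proof (cases rule: bs_space_cases)
  case (1 p)
  thus ?thesis using bs_dist_delta[OF 1(1) action_closed[OF g 1(1)]] bs_action_delta[OF 1(1)] min[OF 1(1)] by simp
next
  case (2 p q)
  obtain f where "cube_tree vertices adj f" using tree_cube by (elim exE)
  then interpret C: cube_tree vertices adj f .
  let ?a = "move g" and ?z' = "bsact g z"
  have V: "p \<in> vertices" "q \<in> vertices" using C.RD[OF 2(1)] by auto
  have aV: "?a p \<in> vertices" "?a q \<in> vertices" using action_closed g V by auto
  have supp: "supp ?z' = {?a p, ?a q}" using supp_action[OF z g] 2(2) by simp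
  have z': "?z' (?a p) = z p" "?z' (?a q) = z q" using bs_action_apply[OF z g] V by auto
  show ?thesis
  proof (cases "\<exists>s\<in>simplices BT. supp z \<union> supp ?z' \<subseteq> s")
    case True
    hence eq: "bsdist z ?z' = (\<Sum>x\<in>supp z \<union> supp ?z'. \<bar>z x - ?z' x\<bar>) / 2"
      unfolding bs_dist_def realization_dist_def by (rule if_P)
    obtain s where s: "s \<in> simplices BT" "p \<in> s" "q \<in> s" "?a p \<in> s"
      using True 2(2) supp by auto
    obtain a b where "s = {a, b}" using s(1) unfolding simplices_tree by (elim disjE bexE exE conjE) auto
    hence "?a p = p \<or> ?a p = q" using s(2-4) 2(3) by auto
    moreover have "?a p \<noteq> q" using adj_fst[OF 2(1)] action_fst[of g p] by auto
    ultimately have "\<tau> = 0" using min[OF V(1)] C.D_zero[OF V(1,1)] by simp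
    thus ?thesis unfolding eq by (simp add: sum_nonneg)
  next
    case False
    hence eq: "bsdist z ?z' = Min ((\<lambda>(x, y). (1 - z x) + vertex_dist BT x y + (1 - ?z' y)) `
        (supp z \<times> supp ?z'))"
      unfolding bs_dist_def realization_dist_def by (rule if_not_P)
    have pq: "tdist (?a q) (?a p) = 1" "tdist (?a p) (?a q) = 1"
      using adj_tdist[OF adj_action[OF g 2(1)]] C.D_sym[OF aV] by auto
    have le: "\<tau> \<le> tdist p (?a q) + 1" "\<tau> \<le> tdist q (?a p) + 1"
      using C.D_triangle[OF V(1) aV(2,1)] C.D_triangle[OF V(2) aV] min[OF V(1)] min[OF V(2)] pq by linarith+
    have "real \<tau> \<le> (1 - z x) + vertex_dist BT x y + (1 - ?z' y)"
      if "x \<in> {p, q}" "y \<in> {?a p, ?a q}" for x y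
    proof -
      have "real \<tau> \<le> real (tdist p (?a q)) + 1" "real \<tau> \<le> real (tdist q (?a p)) + 1"
        "real \<tau> \<le> real (tdist p (?a p))" "real \<tau> \<le> real (tdist q (?a q))"
        using le min[OF V(1)] min[OF V(2)] by linarith+
      thus ?thesis using that vertex_dist_tree V aV z' 2(4-6) by (elim insertE emptyE) simp_all
    qed
    thus ?thesis unfolding eq supp 2(2) by (subst Min_ge_iff) auto
  qed
qed

section \<open>Translation lengths and axes in terms of vertices\<close>

definition min_displacement where
  "min_displacement g = (LEAST n. \<exists>p\<in>vertices. tdist p (move g p) = n)"

lemma vertices_nonempty: "vertices \<noteq> {}"
proof -
  have "bverts \<noteq> {}"
    using S_connected unfolding connected_def strongly_connected_def mk_symmetric_def by (auto simp: S_verts)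
  thus ?thesis unfolding vertices_def using pi.one_closed by blast
qed

lemma min_displacement_attained: "\<exists>p\<in>vertices. tdist p (move g p) = min_displacement g"
  unfolding min_displacement_def by (rule LeastI_ex) (use vertices_nonempty in blast)

lemma min_displacement_le: "p \<in> vertices \<Longrightarrow> min_displacement g \<le> tdist p (move g p)"
  unfolding min_displacement_def by (rule Least_le) blast

text \<open>By \<open>displacement_ge\<close> a vertex of least displacement attains the infimum
  over the realization. So translation lengths are integers, and every axis contains a
  vertex.\<close>

lemma translation_length_eq:
  assumes "g \<in> GG"
  shows "translation_length BX bsdist (bsact g) = real (min_displacement g)"
  unfolding translation_length_def
proof (rule cInf_eq_minimum)
  obtain p where p: "p \<in> vertices" "tdist p (move g p) = min_displacement g"
    using min_displacement_attained by blast
  have "bsdist (delta p) (bsact g (delta p)) = real (min_displacement g)"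
    using bs_dist_delta[OF p(1) action_closed[OF assms p(1)]] bs_action_delta[OF p(1)] p(2) by simp
  thus "real (min_displacement g) \<in> (\<lambda>z. bsdist z (bsact g z)) ` BX"
    using delta_in_space[OF p(1)] by (intro image_eqI[of _ _ "delta p"]) simp_all
  show "real (min_displacement g) \<le> x" if "x \<in> (\<lambda>z. bsdist z (bsact g z)) ` BX" for x
    using that displacement_ge[OF _ assms min_displacement_le] by (elim imageE) simp
qed

lemma delta_axis:
  assumes "g \<in> GG" "p \<in> vertices"
  shows "delta p \<in> axis BX bsdist (bsact g) \<longleftrightarrow>
    tdist p (move g p) = min_displacement g"
  unfolding axis_def translation_length_eq[OF assms(1)] mem_Collect_eq bs_action_delta[OF assms(2)]
    bs_dist_delta[OF assms(2) action_closed[OF assms]]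
  using delta_in_space[OF assms(2)] by simp

lemma convex_min_displacement_tree:
  assumes "g \<in> GG"
  shows "tree_metric.convex vertices tdist {p \<in> vertices. tdist p (move g p) = min_displacement g}"
proof -
  obtain f where "cube_tree vertices adj f" using tree_cube by (elim exE)
  then interpret C: cube_tree vertices adj f .
  show ?thesis
    by (rule C.convex_min_displacement) (use action_closed tdist_action min_displacement_le assms in simp_all)
qed

text \<open>Without inversions, a vertex of the axis is aligned with its first two images by
  \<open>hyperbolic_btw\<close>, so the displacement grows linearly with the exponent. A negative
  power displaces the vertex as much as its inverse does.\<close>

lemma power_displacement:
  fixes k :: int
  assumes g: "g \<in> GG" and pos: "0 < min_displacement g" and p: "p \<in> vertices"
    and min: "tdist p (move g p) = min_displacement g" and k: "k \<noteq> 0"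
  shows "min_displacement g \<le> tdist p (move (g [^]\<^bsub>pi1\<^esub> k) p)"
proof -
  obtain f where "cube_tree vertices adj f" using tree_cube by (elim exE)
  then interpret C: cube_tree vertices adj f .
  let ?a = "move g"
  have ne: "?a p \<noteq> p" using pos min C.D_zero[OF p p] by auto
  have "C.btw p (?a p) (?a (?a p))"
  proof (rule C.hyperbolic_btw)
    show "\<exists>y'. (x, y') \<in> adj \<and> y = ?a y'" if "(?a x, y) \<in> adj" "x \<in> vertices" for x y
      using adj_action[OF pi.inv_closed[OF g] that(1)] action_inverse[OF g] that C.RD(2)[OF that(1)] by metis
    show "\<not> (?a x = y \<and> ?a y = x)" if "(x, y) \<in> adj" for x y
      using adj_fst[OF that] action_fst[of g x] by auto
    show "tdist p (?a p) \<le> tdist y (?a y)" if "y \<in> vertices" for y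
      using min min_displacement_le[OF that] by simp
  qed (use action_closed[OF g] tdist_action[OF g] p ne in simp_all)
  hence pow: "tdist p ((?a ^^ Suc n) p) = Suc n * tdist p (?a p)" for n
    by (intro C.iterate_displacement) (use action_closed[OF g] tdist_action[OF g] p ne in simp_all)
  have act_pow: "move (g [^]\<^bsub>pi1\<^esub> n) p = (?a ^^ n) p" for n :: nat
  proof (induction n)
    case (Suc n)
    have "g [^]\<^bsub>pi1\<^esub> Suc n = g \<cdot> g [^]\<^bsub>pi1\<^esub> n" using pi.nat_pow_Suc2[OF g] .
    thus ?case using Suc action_mult[OF g pi.nat_pow_closed[OF g] p] by simp
  qed (use action_one p in simp)
  have nat: "min_displacement g \<le> tdist p (move (g [^]\<^bsub>pi1\<^esub> n) p)" if "0 < n" for n :: nat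
    using pow[of "n - 1"] that min unfolding act_pow by simp
  define n where "n = nat \<bar>k\<bar>"
  have n: "0 < n" unfolding n_def using k by simp
  show ?thesis
  proof (cases "0 \<le> k")
    case True
    hence "k = int n" unfolding n_def by simp
    thus ?thesis using nat[OF n] by (simp add: int_pow_int)
  next
    case False
    hence "k = - int n" unfolding n_def by simp
    hence eq: "g [^]\<^bsub>pi1\<^esub> k = inv\<^bsub>pi1\<^esub> (g [^]\<^bsub>pi1\<^esub> n)" using pi.int_pow_neg[OF g] by (simp add: int_pow_int)
    let ?b = "g [^]\<^bsub>pi1\<^esub> n"
    have b: "?b \<in> GG" using g by simp
    have "tdist p (move (inv\<^bsub>pi1\<^esub> ?b) p) = tdist (move ?b p) p"
      using tdist_action[OF b p action_closed[OF pi.inv_closed[OF b] p]] action_inverse(2)[OF b p] by simp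
    thus ?thesis unfolding eq using nat[OF n] C.D_sym[OF p action_closed[OF b p]] by simp
  qed
qed

section \<open>Small cancellation\<close>

text \<open>The bounds on real diameters and translation lengths become the integer inequalities of
  \<open>tree_rotation\<close> for the vertices on the axes.\<close>

lemma rotation_subgroup_acts_freely:
  fixes \<Xi> :: "'i set" and gen :: "'i \<Rightarrow> ('v, 'g) letter list set"
  assumes rf: "rotation_family pi1 BX bsact \<Xi> \<sigma> A H"
    and gen: "\<And>\<xi>. \<xi> \<in> \<Xi> \<Longrightarrow> gen \<xi> \<in> GG \<and> H \<xi> = generate pi1 {gen \<xi>} \<and>
      hyperbolic BX bsdist (bsact (gen \<xi>)) \<and>
      A \<xi> = axis BX bsdist (bsact (gen \<xi>))"
    and small: "small_cancellation (1/6) BX bsdist bsact \<Xi> A gen"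
    and n: "n \<in> generate pi1 (\<Union>\<xi>\<in>\<Xi>. H \<xi>)" and p: "p \<in> vertices"
    and fixed: "move n p = p"
  shows "n = \<^bold>1"
proof -
  interpret RF: rotation_family pi1 "BX" "bsact" \<Xi> \<sigma> A H by (rule rf)
  obtain f where "cube_tree vertices adj f" using tree_cube by (elim exE)
  then interpret C: cube_tree vertices adj f .
  let ?a = "move"
  let ?l = "l_max bsdist \<Xi> A"
  let ?R = "R_min BX bsdist bsact \<Xi> gen"
  have lR: "?l < ennreal (1/6) * ?R" using small unfolding small_cancellation_def .
  hence "?l < top_class.top" by (rule less_le_trans) (rule top_greatest)
  then obtain l where l: "0 \<le> l" "?l = ennreal l" unfolding less_top_ennreal by (elim exE conjE)
  \<comment> \<open>Vertex distances are integers, so rounding down keeps the bound on overlaps, and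
    it only helps in the comparison with translation lengths.\<close>
  define L where "L = nat \<lfloor>l\<rfloor>"
  define Y where "Y \<xi> = {q \<in> vertices. delta q \<in> A \<xi>}" for \<xi>
  have Y_eq: "Y \<xi> = {q \<in> vertices. tdist q (?a (gen \<xi>) q) = min_displacement (gen \<xi>)}" if "\<xi> \<in> \<Xi>" for \<xi>
    unfolding Y_def using gen[OF that] delta_axis by auto
  have tl: "6 * L < min_displacement (gen \<xi>)" if \<xi>: "\<xi> \<in> \<Xi>" for \<xi>
  proof -
    have "?R \<le> ennreal (real (min_displacement (gen \<xi>)))"
      unfolding R_min_def using INF_lower[OF \<xi>, of "\<lambda>\<xi>. ennreal (translation_length BX bsdist (bsact (gen \<xi>)))"]
        translation_length_eq[of "gen \<xi>"] gen[OF \<xi>] by simp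
    hence "ennreal (1/6) * ?R \<le> ennreal (1/6) * ennreal (real (min_displacement (gen \<xi>)))"
      by (rule mult_left_mono) simp
    also have "\<dots> = ennreal (real (min_displacement (gen \<xi>)) / 6)"
      by (simp add: ennreal_mult'[symmetric])
    finally have "ennreal l < ennreal (real (min_displacement (gen \<xi>)) / 6)"
      using lR unfolding l(2) by (rule less_le_trans[rotated])
    hence "l < real (min_displacement (gen \<xi>)) / 6" using l(1) by (simp add: ennreal_less_iff)
    moreover have "real L \<le> l" unfolding L_def using l(1) by simp
    ultimately have "real (6 * L) < real (min_displacement (gen \<xi>))" by simp
    thus ?thesis by (simp only: of_nat_less_iff)
  qed
  have overlap: "tdist x y \<le> L"
    if "\<xi> \<in> \<Xi>" "\<eta> \<in> \<Xi>" "\<xi> \<noteq> \<eta>" "x \<in> Y \<xi>" "x \<in> Y \<eta>" "y \<in> Y \<xi>" "y \<in> Y \<eta>" for \<xi> \<eta> x y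
  proof -
    have xy: "x \<in> vertices" "y \<in> vertices" "delta x \<in> A \<xi> \<inter> A \<eta>" "delta y \<in> A \<xi> \<inter> A \<eta>"
      using that unfolding Y_def by auto
    have "ennreal (bsdist (delta x) (delta y)) \<le> diam bsdist (A \<xi> \<inter> A \<eta>)"
      unfolding diam_def by (rule SUP_upper2[OF xy(3)], rule SUP_upper2[OF xy(4)], rule order_refl)
    also have "\<dots> \<le> ?l"
      unfolding l_max_def
      by (rule SUP_upper2[OF that(1)], rule SUP_upper2[of \<eta>]) (use that(2,3) in simp_all)
    finally have "ennreal (real (tdist x y)) \<le> ennreal l" using bs_dist_delta[OF xy(1,2)] l(2) by simp
    hence "real (tdist x y) \<le> l" using l(1) by (simp add: ennreal_le_iff)
    thus ?thesis unfolding L_def by (rule le_nat_floor)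
  qed
  have Y_vertices: "Y \<xi> \<subseteq> vertices" for \<xi> unfolding Y_def by (rule Collect_restrict)
  have Y_nonempty: "Y \<xi> \<noteq> {}" if "\<xi> \<in> \<Xi>" for \<xi>
    unfolding Y_eq[OF that] using min_displacement_attained[of "gen \<xi>"] by (auto simp: Bex_def)
  have Y_convex: "C.convex (Y \<xi>)" if "\<xi> \<in> \<Xi>" for \<xi>
    unfolding Y_eq[OF that] using convex_min_displacement_tree gen[OF that] by simp
  have Y_act: "?a g q \<in> Y (\<sigma> g \<xi>) \<longleftrightarrow> q \<in> Y \<xi>" if "g \<in> GG" "\<xi> \<in> \<Xi>" "q \<in> vertices" for g \<xi> q
    unfolding Y_def mem_Collect_eq RF.A_equivariant[OF that(1,2)]
      delta_action_image[OF RF.A_subset[OF that(2)] that(1,3)] using that(3) action_closed[OF that(1,3)] by simp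
  have \<sigma>_closed: "\<sigma> g \<xi> \<in> \<Xi>" if "g \<in> GG" "\<xi> \<in> \<Xi>" for g \<xi>
    using RF.element_image[OF that] by simp
  have \<sigma>_inverse: "\<sigma> g (\<sigma> (inv\<^bsub>pi1\<^esub> g) \<xi>) = \<xi>" if g: "g \<in> GG" and \<xi>: "\<xi> \<in> \<Xi>" for g \<xi>
  proof -
    have "\<sigma> (g \<cdot> inv\<^bsub>pi1\<^esub> g) \<xi> = \<sigma> g (\<sigma> (inv\<^bsub>pi1\<^esub> g) \<xi>)"
      using RF.composition_rule[OF \<xi> g pi.inv_closed[OF g]] .
    thus ?thesis using g RF.id_eq_one[symmetric] \<xi> by simp
  qed
  have H_displacement: "6 * L < tdist x (?a h x)"
    if \<xi>: "\<xi> \<in> \<Xi>" and h: "h \<in> H \<xi>" "h \<noteq> \<^bold>1" and x: "x \<in> Y \<xi>" for \<xi> h x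
  proof -
    have g: "gen \<xi> \<in> GG" using gen[OF \<xi>] by simp
    have "h \<in> generate pi1 {gen \<xi>}" using h(1) gen[OF \<xi>] by simp
    then obtain k :: int where k: "h = gen \<xi> [^]\<^bsub>pi1\<^esub> k" unfolding pi.generate_pow[OF g] by auto
    have "k \<noteq> 0" using h(2) k by auto
    moreover have "0 < min_displacement (gen \<xi>)" using tl[OF \<xi>] by simp
    ultimately have "min_displacement (gen \<xi>) \<le> tdist x (?a h x)"
      unfolding k using power_displacement[OF g] x unfolding Y_eq[OF \<xi>] by simp
    thus ?thesis using tl[OF \<xi>] by simp
  qed
  text \<open>
    The edges which lie on no axis are added to the family, with trivial groups, so that the members
    of the family cover the tree. They meet the axes, and each other, in at most one vertex.
  \<close>
  define E where "E = {{x, y} | x y. (x, y) \<in> adj \<and> \<not> (\<exists>\<xi>\<in>\<Xi>. {x, y} \<subseteq> Y \<xi>)}"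
  define \<Xi>' :: "('i + ('v, 'g) bs_vertex set) set" where "\<Xi>' = Inl ` \<Xi> \<union> Inr ` E"
  define \<sigma>' :: "('v, 'g) letter list set \<Rightarrow> 'i + ('v, 'g) bs_vertex set \<Rightarrow> 'i + ('v, 'g) bs_vertex set"
    where "\<sigma>' g = case_sum (\<lambda>\<xi>. Inl (\<sigma> g \<xi>)) (\<lambda>e. Inr (?a g ` e))" for g
  define Y' where "Y' = case_sum Y (\<lambda>e. e)"
  define H' where "H' = case_sum H (\<lambda>_ :: ('v, 'g) bs_vertex set. {\<^bold>1})"
  note defs = \<sigma>'_def Y'_def H'_def
  have E_cases: "\<exists>x y. e = {x, y} \<and> (x, y) \<in> adj \<and> x \<noteq> y \<and> x \<in> vertices \<and> y \<in> vertices \<and>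
      \<not> (\<exists>\<xi>\<in>\<Xi>. {x, y} \<subseteq> Y \<xi>)" if e: "e \<in> E" for e
  proof -
    obtain x y where xy: "e = {x, y}" "(x, y) \<in> adj" "\<not> (\<exists>\<xi>\<in>\<Xi>. {x, y} \<subseteq> Y \<xi>)"
      using e unfolding E_def by (elim CollectE exE conjE)
    have "x \<noteq> y" using adj_fst[OF xy(2)] by (rule contrapos_nn) simp
    thus ?thesis using xy C.RD(1,2)[OF xy(2)] by (intro exI conjI)
  qed
  have E_vertices: "e \<subseteq> vertices" if "e \<in> E" for e using E_cases[OF that] by (elim exE conjE) simp
  have E_one: "?a \<^bold>1 ` e = e" if e: "e \<in> E" for e
  proof -
    have "?a \<^bold>1 x = x" if "x \<in> e" for x using action_one[OF subsetD[OF E_vertices[OF e] that]] .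
    thus ?thesis by simp
  qed
  have E_mult: "?a (g \<cdot> h) ` e = ?a g ` ?a h ` e"
    if gh: "g \<in> GG" "h \<in> GG" and e: "e \<in> E" for g h e
  proof -
    have "?a (g \<cdot> h) x = ?a g (?a h x)" if "x \<in> e" for x
      using action_mult[OF gh subsetD[OF E_vertices[OF e] that]] .
    thus ?thesis unfolding image_image by (intro image_cong HOL.refl)
  qed
  have E_two: "x = y" if e: "e \<in> E" and B: "\<exists>e'\<in>E. e' \<noteq> e \<and> B = e' \<or> (\<exists>\<xi>\<in>\<Xi>. B = Y \<xi>)"
      and x: "x \<in> e" "x \<in> B" and y: "y \<in> e" "y \<in> B" for e B x y
  proof (rule ccontr)
    assume ne: "x \<noteq> y"
    obtain a b where ab: "e = {a, b}" "\<not> (\<exists>\<xi>\<in>\<Xi>. {a, b} \<subseteq> Y \<xi>)" using E_cases[OF e] by (elim exE conjE)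
    have exy: "e = {x, y}" using x(1) y(1) ne unfolding ab(1) by (elim insertE emptyE) (simp_all add: insert_commute)
    hence no: "\<not> (\<exists>\<xi>\<in>\<Xi>. B = Y \<xi>)" using ab x(2) y(2) by (metis empty_subsetI insert_subset)
    then obtain e' where e': "e' \<in> E" "e' \<noteq> e" "B = e'" using B by metis
    obtain c d where cd: "e' = {c, d}" using E_cases[OF e'(1)] by (elim exE conjE)
    have "e' = {x, y}" using x(2) y(2) ne unfolding e'(3) cd by (elim insertE emptyE) (simp_all add: insert_commute)
    thus False using exy e'(2) by simp
  qed
  interpret TR: tree_rotation vertices tdist pi1 ?a \<Xi>' \<sigma>' Y' H' L
  proof (intro tree_rotation.intro tree_rotation_axioms.intro, rule C.tree_metric_axioms, rule pi1_group)
    fix g x assume gx: "g \<in> GG" "x \<in> vertices"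
    show "?a g x \<in> vertices" using action_closed[OF gx] .
  next
    fix x assume "x \<in> vertices"
    thus "?a \<^bold>1 x = x" by (rule action_one)
  next
    fix g h x assume "g \<in> GG" "h \<in> GG" "x \<in> vertices"
    thus "?a (g \<cdot> h) x = ?a g (?a h x)" by (rule action_mult)
  next
    fix g x y assume "g \<in> GG" "x \<in> vertices" "y \<in> vertices"
    thus "tdist (?a g x) (?a g y) = tdist x y" by (rule tdist_action)
  next
    fix g \<zeta> assume g: "g \<in> GG" and \<zeta>: "\<zeta> \<in> \<Xi>'"
    show "\<sigma>' g \<zeta> \<in> \<Xi>'"
    proof (cases \<zeta>)
      case (Inl \<xi>)
      thus ?thesis using \<zeta> \<sigma>_closed[OF g] unfolding \<Xi>'_def \<sigma>'_def by auto
    next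
      case (Inr e)
      hence e: "e \<in> E" using \<zeta> unfolding \<Xi>'_def by auto
      obtain x y where xy: "e = {x, y}" "(x, y) \<in> adj" "x \<in> vertices" "y \<in> vertices"
        "\<not> (\<exists>\<xi>\<in>\<Xi>. {x, y} \<subseteq> Y \<xi>)" using E_cases[OF e] by (elim exE conjE)
      have "\<not> (\<exists>\<xi>\<in>\<Xi>. {?a g x, ?a g y} \<subseteq> Y \<xi>)"
      proof
        assume "\<exists>\<xi>\<in>\<Xi>. {?a g x, ?a g y} \<subseteq> Y \<xi>"
        then obtain \<xi> where \<xi>: "\<xi> \<in> \<Xi>" "?a g x \<in> Y \<xi>" "?a g y \<in> Y \<xi>" by auto
        let ?\<eta> = "\<sigma> (inv\<^bsub>pi1\<^esub> g) \<xi>"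
        have \<eta>: "?\<eta> \<in> \<Xi>" using \<sigma>_closed[OF pi.inv_closed[OF g] \<xi>(1)] .
        have "x \<in> Y ?\<eta>" "y \<in> Y ?\<eta>"
          using Y_act[OF g \<eta> xy(3)] Y_act[OF g \<eta> xy(4)] \<sigma>_inverse[OF g \<xi>(1)] \<xi> by simp_all
        thus False using xy(5) \<eta> by simp
      qed
      moreover have "?a g ` e = {?a g x, ?a g y}" unfolding xy(1) by simp
      ultimately have "?a g ` e \<in> E" unfolding E_def using adj_action[OF g xy(2)] by (intro CollectI exI conjI)
      thus ?thesis unfolding Inr \<Xi>'_def \<sigma>'_def by simp
    qed
    show "Y' (\<sigma>' g \<zeta>) = ?a g ` Y' \<zeta>"
    proof (cases \<zeta>)
      case (Inr e)
      thus ?thesis unfolding defs by simp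
    next
      case (Inl \<xi>)
      hence \<xi>: "\<xi> \<in> \<Xi>" using \<zeta> unfolding \<Xi>'_def by auto
      have "Y (\<sigma> g \<xi>) = ?a g ` Y \<xi>"
      proof
        show "?a g ` Y \<xi> \<subseteq> Y (\<sigma> g \<xi>)"
          using Y_act[OF g \<xi> subsetD[OF Y_vertices]] by (intro image_subsetI) simp
        show "Y (\<sigma> g \<xi>) \<subseteq> ?a g ` Y \<xi>"
        proof
          fix q assume q: "q \<in> Y (\<sigma> g \<xi>)"
          have qV: "q \<in> vertices" using subsetD[OF Y_vertices q] .
          have "?a (inv\<^bsub>pi1\<^esub> g) q \<in> Y \<xi>"
            using Y_act[OF g \<xi> action_closed[OF pi.inv_closed[OF g] qV]] action_inverse(2)[OF g qV] q by simp
          thus "q \<in> ?a g ` Y \<xi>" using action_inverse(2)[OF g qV] by (metis imageI)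
        qed
      qed
      thus ?thesis unfolding Inl defs by simp
    qed
    fix h assume h: "h \<in> H' \<zeta>"
    show "g \<cdot> h \<cdot> inv\<^bsub>pi1\<^esub> g \<in> H' (\<sigma>' g \<zeta>)"
    proof (cases \<zeta>)
      case (Inr e)
      thus ?thesis using h g unfolding defs by simp
    next
      case (Inl \<xi>)
      hence \<xi>: "\<xi> \<in> \<Xi>" "h \<in> H \<xi>" using \<zeta> h unfolding \<Xi>'_def defs by auto
      show ?thesis unfolding Inl defs sum.case RF.H_equivariant[OF g \<xi>(1)]
        using \<xi>(2) unfolding l_coset_def r_coset_def by auto
    qed
  next
    fix \<zeta> assume "\<zeta> \<in> \<Xi>'"
    thus "\<sigma>' \<^bold>1 \<zeta> = \<zeta>"
      unfolding \<Xi>'_def defs using RF.id_eq_one[symmetric] E_one by (elim UnE imageE) simp_all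
  next
    fix g h \<zeta> assume "g \<in> GG" "h \<in> GG" "\<zeta> \<in> \<Xi>'"
    thus "\<sigma>' (g \<cdot> h) \<zeta> = \<sigma>' g (\<sigma>' h \<zeta>)"
      unfolding \<Xi>'_def defs using RF.composition_rule E_mult by (elim UnE imageE) simp_all
  next
    fix \<zeta> assume \<zeta>: "\<zeta> \<in> \<Xi>'"
    show "C.convex (Y' \<zeta>)"
    proof (cases \<zeta>)
      case (Inl \<xi>)
      thus ?thesis using \<zeta> Y_convex unfolding \<Xi>'_def defs by auto
    next
      case (Inr e)
      hence e: "e \<in> E" using \<zeta> unfolding \<Xi>'_def by auto
      obtain x y where xy: "e = {x, y}" "(x, y) \<in> adj" "x \<in> vertices" "y \<in> vertices"
        using E_cases[OF e] by (elim exE conjE)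
      have z: "z = x \<or> z = y" if "z \<in> vertices" "tdist x z + tdist z y \<le> 1" for z
      proof -
        have "tdist x z = 0 \<or> tdist z y = 0" using that(2) by linarith
        thus ?thesis using C.D_zero[OF xy(3) that(1)] C.D_zero[OF that(1) xy(4)] by auto
      qed
      have d: "tdist x y = 1" "tdist y x = 1" "tdist x x = 0" "tdist y y = 0"
        using adj_tdist[OF xy(2)] C.D_sym[OF xy(3,4)] C.D_zero[OF xy(3,3)] C.D_zero[OF xy(4,4)] by simp_all
      show ?thesis unfolding Inr defs sum.case xy(1) C.convex_def C.btw_def
      proof (intro conjI ballI impI)
        show "{x, y} \<subseteq> vertices" using xy by simp
        fix u w z assume u: "u \<in> {x, y}" and w: "w \<in> {x, y}" and zV: "z \<in> vertices"
          and b: "tdist u z + tdist z w = tdist u w"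
        have "z = u \<or> tdist x z + tdist z y \<le> 1"
          using u w b d C.D_sym[OF xy(3) zV] C.D_sym[OF xy(4) zV] C.D_zero[OF xy(3) zV] C.D_zero[OF xy(4) zV]
          by (elim insertE emptyE) simp_all
        thus "z \<in> {x, y}" using z[OF zV] u by auto
      qed
    qed
    show "Y' \<zeta> \<noteq> {}"
      using \<zeta> Y_nonempty E_cases unfolding \<Xi>'_def defs by (elim UnE imageE) fastforce+
    show "subgroup (H' \<zeta>) pi1"
      using \<zeta> RF.H_subgroup pi.triv_subgroup unfolding \<Xi>'_def defs by (elim UnE imageE) simp_all
    fix h x assume h: "h \<in> H' \<zeta>" and x: "x \<in> Y' \<zeta>"
    show "?a h x \<in> Y' \<zeta>"
    proof (cases \<zeta>)
      case (Inl \<xi>)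
      hence \<xi>: "\<xi> \<in> \<Xi>" "h \<in> H \<xi>" "x \<in> Y \<xi>" using \<zeta> h x unfolding \<Xi>'_def defs by auto
      have hG: "h \<in> GG" using subgroup.mem_carrier[OF RF.H_subgroup[OF \<xi>(1)] \<xi>(2)] .
      have xV: "x \<in> vertices" "delta x \<in> A \<xi>" using \<xi>(3) unfolding Y_def by auto
      have "delta (?a h x) \<in> bsact h ` A \<xi>"
        using delta_action_image[OF RF.A_subset[OF \<xi>(1)] hG xV(1)] xV(2) by simp
      thus ?thesis unfolding Inl defs sum.case Y_def mem_Collect_eq RF.H_stabilises[OF \<xi>(1,2)]
        using action_closed[OF hG xV(1)] by simp
    next
      case (Inr e)
      hence e: "e \<in> E" using \<zeta> unfolding \<Xi>'_def by auto
      thus ?thesis using h x action_one[OF subsetD[OF E_vertices[OF e]]] unfolding Inr defs by simp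
    qed
    show "6 * L < tdist x (?a h x)" if ne: "h \<noteq> \<^bold>1"
    proof (cases \<zeta>)
      case (Inl \<xi>)
      hence \<xi>: "\<xi> \<in> \<Xi>" "h \<in> H \<xi>" "x \<in> Y \<xi>" using \<zeta> h x unfolding \<Xi>'_def defs by auto
      thus ?thesis using H_displacement ne by simp
    next
      case (Inr e)
      thus ?thesis using h ne unfolding defs by simp
    qed
  next
    fix \<zeta> \<theta> x y assume \<zeta>: "\<zeta> \<in> \<Xi>'" and \<theta>: "\<theta> \<in> \<Xi>'" and ne: "\<zeta> \<noteq> \<theta>"
      and x: "x \<in> Y' \<zeta>" "x \<in> Y' \<theta>" and y: "y \<in> Y' \<zeta>" "y \<in> Y' \<theta>"
    have zero: "tdist z z \<le> L" if "z \<in> vertices" for z using C.D_zero[OF that that] by simp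
    show "tdist x y \<le> L"
    proof (cases \<zeta>; cases \<theta>)
      fix \<xi> \<eta> assume *: "\<zeta> = Inl \<xi>" "\<theta> = Inl \<eta>"
      hence "\<xi> \<in> \<Xi>" "\<eta> \<in> \<Xi>" "\<xi> \<noteq> \<eta>" using \<zeta> \<theta> ne unfolding \<Xi>'_def by auto
      thus ?thesis using overlap[of \<xi> \<eta> x y] x y unfolding * Y'_def by simp
    next
      fix \<xi> e assume *: "\<zeta> = Inl \<xi>" "\<theta> = Inr e"
      hence i: "\<xi> \<in> \<Xi>" "e \<in> E" using \<zeta> \<theta> unfolding \<Xi>'_def by auto
      have xy: "x \<in> Y \<xi>" "x \<in> e" "y \<in> Y \<xi>" "y \<in> e" using x y unfolding * Y'_def by simp_all
      have "x = y" by (rule E_two[OF i(2) _ xy(2,1,4,3)]) (use i in auto)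
      thus ?thesis using zero subsetD[OF E_vertices[OF i(2)] xy(4)] by simp
    next
      fix e \<xi> assume *: "\<zeta> = Inr e" "\<theta> = Inl \<xi>"
      hence i: "\<xi> \<in> \<Xi>" "e \<in> E" using \<zeta> \<theta> unfolding \<Xi>'_def by auto
      have xy: "x \<in> Y \<xi>" "x \<in> e" "y \<in> Y \<xi>" "y \<in> e" using x y unfolding * Y'_def by simp_all
      have "x = y" by (rule E_two[OF i(2) _ xy(2,1,4,3)]) (use i in auto)
      thus ?thesis using zero subsetD[OF E_vertices[OF i(2)] xy(4)] by simp
    next
      fix e e' assume *: "\<zeta> = Inr e" "\<theta> = Inr e'"
      hence i: "e \<in> E" "e' \<in> E" "e' \<noteq> e" using \<zeta> \<theta> ne unfolding \<Xi>'_def by auto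
      have xy: "x \<in> e'" "x \<in> e" "y \<in> e'" "y \<in> e" using x y unfolding * Y'_def by simp_all
      have "x = y" by (rule E_two[OF i(1) _ xy(2,1,4,3)]) (use i in auto)
      thus ?thesis using zero subsetD[OF E_vertices[OF i(1)] xy(4)] by simp
    qed
  next
    fix W assume W: "W \<subseteq> vertices" "W \<noteq> {}" and sat: "\<And>\<zeta>. \<zeta> \<in> \<Xi>' \<Longrightarrow> Y' \<zeta> \<inter> W \<noteq> {} \<Longrightarrow> Y' \<zeta> \<subseteq> W"
    \<comment> \<open>A saturated set contains the neighbours of its vertices: the connecting edge
      lies on an axis or is itself a member of the family.\<close>
    have step: "y \<in> W" if x: "x \<in> W" and xy: "(x, y) \<in> adj" for x y
    proof (cases "\<exists>\<xi>\<in>\<Xi>. {x, y} \<subseteq> Y \<xi>")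
      case True
      then obtain \<xi> where \<xi>: "\<xi> \<in> \<Xi>" "x \<in> Y \<xi>" "y \<in> Y \<xi>" by auto
      have "Y' (Inl \<xi>) \<subseteq> W" by (rule sat) (use \<xi> x in \<open>auto simp: \<Xi>'_def Y'_def\<close>)
      thus ?thesis using \<xi>(3) unfolding Y'_def by auto
    next
      case False
      hence "{x, y} \<in> E" unfolding E_def using xy by (intro CollectI exI[of _ x] exI[of _ y]) simp
      hence "Y' (Inr {x, y}) \<subseteq> W" by (intro sat) (use x in \<open>auto simp: \<Xi>'_def Y'_def\<close>)
      thus ?thesis unfolding Y'_def by simp
    qed
    obtain w where w: "w \<in> W" using W(2) by auto
    have "y \<in> W" if "(w, y) \<in> adj\<^sup>*" for y using that by induction (use w step in simp_all)
    hence "vertices \<subseteq> W" using adj_connected[OF subsetD[OF W(1) w]] by (intro subsetI) simp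
    with W(1) show "W = vertices" by (rule equalityI)
  qed
  have "n \<in> generate pi1 (\<Union>\<zeta>\<in>\<Xi>'. H' \<zeta>)"
  proof (rule subsetD[OF pi.mono_generate n])
    show "(\<Union>\<xi>\<in>\<Xi>. H \<xi>) \<subseteq> (\<Union>\<zeta>\<in>\<Xi>'. H' \<zeta>)" unfolding \<Xi>'_def H'_def by auto
  qed
  thus ?thesis using TR.rotations_act_freely[OF p _ fixed] by simp
qed

section \<open>Passage to the quotient\<close>

text \<open>Conjugation permutes the subgroups \<open>H \<xi>\<close>, so the group they generate is
  already normal.\<close>

lemma normal_closure_rotations:
  assumes "rotation_family pi1 X act \<Xi> \<sigma> A H"
  shows "normal_closure pi1 (generate pi1 (\<Union>\<xi>\<in>\<Xi>. H \<xi>)) \<subseteq> generate pi1 (\<Union>\<xi>\<in>\<Xi>. H \<xi>)"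
proof -
  interpret RF: rotation_family pi1 X act \<Xi> \<sigma> A H by (rule assms)
  have "generate pi1 (\<Union>\<xi>\<in>\<Xi>. H \<xi>) \<lhd> pi1"
  proof (rule pi.normal_generateI)
    show "(\<Union>\<xi>\<in>\<Xi>. H \<xi>) \<subseteq> GG" using subgroup.subset[OF RF.H_subgroup] by (rule UN_least)
    fix h g assume h: "h \<in> (\<Union>\<xi>\<in>\<Xi>. H \<xi>)" and g: "g \<in> GG"
    from h obtain \<xi> where \<xi>: "\<xi> \<in> \<Xi>" "h \<in> H \<xi>" by (rule UN_E)
    have "g \<cdot> h \<cdot> inv\<^bsub>pi1\<^esub> g \<in> H (\<sigma> g \<xi>)"
      unfolding RF.H_equivariant[OF g \<xi>(1)] using \<xi>(2) unfolding l_coset_def r_coset_def by auto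
    moreover have "\<sigma> g \<xi> \<in> \<Xi>" using RF.element_image[OF g \<xi>(1)] by simp
    ultimately show "g \<cdot> h \<cdot> inv\<^bsub>pi1\<^esub> g \<in> (\<Union>\<xi>\<in>\<Xi>. H \<xi>)" by (rule UN_I[rotated])
  qed
  thus ?thesis unfolding normal_closure_def by (intro Inter_lower) simp
qed

lemma one_normal_closure: "\<^bold>1 \<in> normal_closure pi1 Z"
  unfolding normal_closure_def by (auto intro: subgroup.one_closed normal_imp_subgroup)

text \<open>The images of \<open>x\<close> and \<open>y\<close> fix the same vertex of the tree, so
  the element of \<open>N\<close> by which they differ fixes it too and is trivial. The rest is
  \<open>vertex_map_inj\<close>.\<close>

lemma quotient_inj_vertex_group:
  assumes v: "v \<in> bverts" and one: "\<^bold>1 \<in> N" and N: "N \<subseteq> GG"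
    and free: "\<And>n p. \<lbrakk>n \<in> N; p \<in> vertices; move n p = p\<rbrakk> \<Longrightarrow> n = \<^bold>1"
  shows "inj_on (\<lambda>x. N #>\<^bsub>pi1\<^esub> vmap v x) (vcar v)"
proof (rule inj_onI)
  fix x y assume x: "x \<in> vcar v" and y: "y \<in> vcar v"
    and eq: "N #>\<^bsub>pi1\<^esub> vmap v x = N #>\<^bsub>pi1\<^esub> vmap v y"
  let ?x = "vmap v x" and ?y = "vmap v y"
  have c: "?x \<in> GG" "?y \<in> GG" using vertex_map_closed v x y by auto
  have "\<^bold>1 \<cdot> ?x \<in> N #>\<^bsub>pi1\<^esub> ?x" using one unfolding r_coset_def by (intro UN_I[of "\<^bold>1"]) simp_all
  hence "?x \<in> N #>\<^bsub>pi1\<^esub> ?y" using c eq by simp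
  then obtain n where n: "n \<in> N" "?x = n \<cdot> ?y" unfolding r_coset_def by auto
  have nG: "n \<in> GG" using n(1) N by auto
  have fix_v: "vx v z = vx v \<^bold>1" if "z \<in> stab v" for z
    using vx_absorb[OF v pi.one_closed that] subgroup.mem_carrier[OF vertex_subgroup[OF v] that] by simp
  have "move n (vx v ?y) = vx v ?x" using action_vx[OF v nG c(2)] n(2) by simp
  hence "move n (vx v ?y) = vx v ?y" using fix_v[of ?x] fix_v[of ?y] x y by simp
  hence "n = \<^bold>1" using free[OF n(1) vx_vertices[OF v c(2)]] by simp
  hence "?x = ?y" using n(2) c by simp
  thus "x = y" using inj_onD[OF vertex_map_inj[OF v]] x y by simp
qed

text \<open>The edge group maps through the vertex group at its origin by the injective
  \<open>emb\<close>.\<close>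

lemma quotient_inj_edge_group:
  assumes "e \<in> barcs"
    and "inj_on (\<lambda>x. N #>\<^bsub>pi1\<^esub> vmap (fst e) x) (vcar (fst e))"
  shows "inj_on (\<lambda>c. N #>\<^bsub>pi1\<^esub> emap e c) (ecar e)"
proof (rule inj_onI)
  fix c c' assume c: "c \<in> ecar e" "c' \<in> ecar e"
    and eq: "N #>\<^bsub>pi1\<^esub> emap e c = N #>\<^bsub>pi1\<^esub> emap e c'"
  have "emb \<G> (prod.swap e) c = emb \<G> (prod.swap e) c'"
    using inj_onD[OF assms(2) eq[unfolded edge_map_def]] emb_swap_closed[OF assms(1)] c by simp
  thus "c = c'" using inj_onD[OF emb_inj[OF arcD(4)[OF assms(1)]]] egrp_swap[OF assms(1)] c by simp
qed

end

theorem proposition1p2: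
  fixes \<G> :: "('v, 'g, 'h) gog"
    and S :: "'v pair_pre_digraph"
    and \<Xi> :: "'i set"
    and \<sigma> :: "('v, 'g) letter list set \<Rightarrow> 'i \<Rightarrow> 'i"
    and A :: "'i \<Rightarrow> (('v, 'g) bs_vertex \<Rightarrow> real) set"
    and H :: "'i \<Rightarrow> ('v, 'g) letter list set set"
    and gen :: "'i \<Rightarrow> ('v, 'g) letter list set"
  defines "G \<equiv> fundamental_group \<G> S"
    and "X \<equiv> bs_space \<G> S"
    and "d \<equiv> bs_dist \<G> S"
    and "act \<equiv> bs_action \<G> S"
  assumes "graph_of_groups \<G>"
    and "undirected_spanning_tree S (base \<G>)"
    and "rotation_family G X act \<Xi> \<sigma> A H"
    and RF1: "\<And>\<xi>. \<xi> \<in> \<Xi> \<Longrightarrow>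
      infinite_cyclic G (H \<xi>) \<and> gen \<xi> \<in> carrier G \<and> H \<xi> = generate G {gen \<xi>} \<and>
      hyperbolic X d (act (gen \<xi>)) \<and> A \<xi> = axis X d (act (gen \<xi>))"
    and RF2: "\<And>\<xi>. \<xi> \<in> \<Xi> \<Longrightarrow> infinite_cyclic G {g \<in> carrier G. act g ` A \<xi> = A \<xi>}"
    and "small_cancellation (1/6) X d act \<Xi> A gen"
  defines "N \<equiv> normal_closure G (generate G (\<Union>\<xi>\<in>\<Xi>. H \<xi>))"
  shows "(\<forall>v\<in>pverts (base \<G>). inj_on (\<lambda>x. N #>\<^bsub>G\<^esub> vertex_map \<G> S v x) (carrier (vgrp \<G> v))) \<and>
    (\<forall>e\<in>parcs (base \<G>). inj_on (\<lambda>c. N #>\<^bsub>G\<^esub> edge_map \<G> S e c) (carrier (egrp \<G> e)))"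
proof -
  interpret based_graph_of_groups \<G> S
    using assms(5,6) by (simp add: based_graph_of_groups_def based_graph_of_groups_axioms_def)
  note rf = assms(7)[unfolded G_def X_def act_def]
  have gen: "gen \<xi> \<in> carrier pi1 \<and> H \<xi> = generate pi1 {gen \<xi>} \<and>
      hyperbolic (bs_space \<G> S) (bs_dist \<G> S) (bs_action \<G> S (gen \<xi>)) \<and>
      A \<xi> = axis (bs_space \<G> S) (bs_dist \<G> S) (bs_action \<G> S (gen \<xi>))" if "\<xi> \<in> \<Xi>" for \<xi>
    using RF1[OF that] unfolding G_def X_def d_def act_def by (elim conjE) (intro conjI)
  note small = assms(10)[unfolded X_def d_def act_def]
  have N: "N \<subseteq> generate pi1 (\<Union>\<xi>\<in>\<Xi>. H \<xi>)" unfolding N_def G_def by (rule normal_closure_rotations[OF rf])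
  have "generate pi1 (\<Union>\<xi>\<in>\<Xi>. H \<xi>) \<subseteq> carrier pi1"
    by (intro pi.generate_incl UN_least subgroup.subset rotation_family.H_subgroup[OF rf])
  with N have "N \<subseteq> carrier pi1" by (rule subset_trans)
  moreover have "\<one>\<^bsub>pi1\<^esub> \<in> N" unfolding N_def G_def by (rule one_normal_closure)
  moreover have "n = \<one>\<^bsub>pi1\<^esub>" if "n \<in> N" "p \<in> vertices" "bs_vertex_action \<G> S n p = p" for n p
    by (rule rotation_subgroup_acts_freely[OF rf gen small subsetD[OF N that(1)] that(2,3)])
  ultimately have V: "inj_on (\<lambda>x. N #>\<^bsub>pi1\<^esub> vertex_map \<G> S v x) (carrier (vgrp \<G> v))"
    if "v \<in> pverts (base \<G>)" for v
    by (intro quotient_inj_vertex_group[OF that])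
  moreover have "inj_on (\<lambda>c. N #>\<^bsub>pi1\<^esub> edge_map \<G> S e c) (carrier (egrp \<G> e))"
    if "e \<in> parcs (base \<G>)" for e
    by (rule quotient_inj_edge_group[OF that V[OF arcD(1)[OF that]]])
  ultimately show ?thesis unfolding G_def by (intro conjI ballI)
qed

end
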